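(* Let $X_t$ be a Lévy process on $\mathbb{R}$, $X_0=0$, which has a continuous density $\rho(x,t)$, $t>0$. Let $\Delta$ be a finite union of disjoint segments, $L_\Delta$ the truncated generator, and $\psi(x,s)$, $s>0$, the function defined in the context. Then for every $f\in C_\Delta$ and every $s>0$, $$\bigl((sI-L_\Delta)f,\ \psi(\cdot,s)\bigr)_\Delta=f(0),$$ where $(g,h)_\Delta=\int_\Delta g(x)\overline{h(x)}\,dx$ and $f$ is extended by $0$ outside $\Delta$.
   Context: Lévy process: $E\{\exp[izX_t]\}=\mu(z,t)=\exp[-t\lambda(z)]$ with $\lambda(z)=\tfrac12Az^{2}-i\gamma z-\int_{-\infty}^{\infty}(e^{ixz}-1-ixz1_{[-1,1]}(x))\,d\nu(x)$, $A\ge0$, $\gamma\in\mathbb{R}$, $\int\frac{x^2}{1+x^2}d\nu(x)<\infty$. Generator: $Lf=\tfrac12Af''+\gamma f'+\int_{-\infty}^{\infty}(f(x+y)-f(x)-yf'(x)1_{[-1,1]}(y))\,d\nu(y)$. The density is $\rho(x,t)=\frac1{2\pi}\int_{-\infty}^{\infty}e^{-ixz}\mu(z,t)\,dz$, $t>0$. $\Delta=\bigcup_{k=1}^n[a_k,b_k]$ with $a_1<b_1<a_2<b_2<\dots<a_n<b_n$. $C_\Delta$ is the set of functions $g$ on $\Delta$ with $g(a_k)=g(b_k)=g'(a_k)=g'(b_k)=0$ $(1\le k\le n)$ and $g''\in L^p(\Delta)$, $p>1$. $P_\Delta f(x)=f(x)$ for $x\in\Delta$ and $P_\Delta f(x)=0$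 for $x\notin\Delta$; the truncated generator is $L_\Delta=P_\Delta LP_\Delta$. Definition of $\psi$: let $V(x)=1$ for $x\notin\Delta$ and $V(x)=0$ for $x\in\Delta$; $Q_0(x,t)=\rho(x,t)$ and $Q_{n+1}(x,t)=\int_0^t\int_{-\infty}^{\infty}Q_0(x-\xi,t-\tau)V(\xi)Q_n(\xi,\tau)\,d\xi\,d\tau$; $Q(x,t,u)=\sum_{n=0}^{\infty}(-1)^nu^nQ_n(x,t)$ for $u\ge0$; $\psi(x,s,u)=\int_0^{\infty}e^{-st}Q(x,t,u)\,dt$ for $s>0$. The function $\psi(x,s,u)$ is nonnegative and decreasing in $u$, and $\psi(x,s)=\lim_{u\to\infty}\psi(x,s,u)$. (One has $\psi(x,s)=0$ for $x\notin\Delta$, and $\int_0^\infty e^{-st}p(t,\Delta)\,dt=\int_\Delta\psi(x,s)\,dx$, where $p(t,\Delta)=P(X_\tau\in\Delta,\ 0\le\tau\le t)$.) *)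

theory Defs
  imports "HOL-Probability.Probability"
begin

section \<open>Levy processes\<close>

definition levy_process :: "'a measure \<Rightarrow> (real \<Rightarrow> 'a \<Rightarrow> real) \<Rightarrow> bool" where
  "levy_process M X \<longleftrightarrow>
     prob_space M \<and>
     (\<forall>t\<ge>0. X t \<in> borel_measurable M) \<and>
     (AE \<omega> in M. X 0 \<omega> = 0) \<and>
     (\<forall>(n::nat) \<tau>. 0 \<le> \<tau> 0 \<and> (\<forall>i<n. \<tau> i \<le> \<tau> (Suc i)) \<longrightarrow>
        prob_space.indep_vars M (\<lambda>_. borel) (\<lambda>i \<omega>. X (\<tau> (Suc i)) \<omega> - X (\<tau> i) \<omega>) {..<n}) \<and>
     (\<forall>r\<ge>0. \<forall>h\<ge>0. distr M borel (\<lambda>\<omega>. X (r + h) \<omega> - X r \<omega>) = distr M borel (X h)) \<and>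
     (AE \<omega> in M. \<forall>t\<ge>0.
        continuous (at_right t) (\<lambda>r. X r \<omega>) \<and>
        (0 < t \<longrightarrow> (\<exists>l. ((\<lambda>r. X r \<omega>) \<longlongrightarrow> l) (at_left t))))"

definition levy_triplet :: "real \<Rightarrow> real \<Rightarrow> real measure \<Rightarrow> bool" where
  "levy_triplet A \<gamma> \<nu> \<longleftrightarrow>
     0 \<le> A \<and> sets \<nu> = sets borel \<and> integrable \<nu> (\<lambda>x. x\<^sup>2 / (1 + x\<^sup>2))"

definition levy_exponent :: "real \<Rightarrow> real \<Rightarrow> real measure \<Rightarrow> real \<Rightarrow> complex" where
  "levy_exponent A \<gamma> \<nu> z =
     of_real (A * z\<^sup>2 / 2) - \<i> * of_real (\<gamma> * z)
     - (CLINT x|\<nu>. iexp (x * z) - 1 - \<i> * of_real (x * z * indicator {-1..1} x))"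

text \<open>The continuous version of the density is unique, so this predicate determines
  the values \<open>\<rho> x t\<close> for \<open>t > 0\<close>; the values for \<open>t \<le> 0\<close> are never used.\<close>

definition continuous_density ::
  "'a measure \<Rightarrow> (real \<Rightarrow> 'a \<Rightarrow> real) \<Rightarrow> (real \<Rightarrow> real \<Rightarrow> real) \<Rightarrow> bool" where
  "continuous_density M X \<rho> \<longleftrightarrow>
     (\<forall>t>0. continuous_on UNIV (\<lambda>x. \<rho> x t) \<and> (\<forall>x. 0 \<le> \<rho> x t) \<and>
        distributed M lborel (X t) (\<lambda>x. ennreal (\<rho> x t)))"

section \<open>The truncated generator\<close>

definition segments :: "nat \<Rightarrow> (nat \<Rightarrow> real) \<Rightarrow> (nat \<Rightarrow> real) \<Rightarrow> real set" where
  "segments n a b = (\<Union>k\<in>{1..n}. {a k..b k})"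

definition trunc :: "real set \<Rightarrow> (real \<Rightarrow> complex) \<Rightarrow> real \<Rightarrow> complex" where
  "trunc \<Delta> f x = (if x \<in> \<Delta> then f x else 0)"

definition generator ::
  "real \<Rightarrow> real \<Rightarrow> real measure \<Rightarrow> (real \<Rightarrow> complex) \<Rightarrow> real \<Rightarrow> complex" where
  "generator A \<gamma> \<nu> f x =
     of_real (A / 2) * vector_derivative (\<lambda>y. vector_derivative f (at y)) (at x)
     + of_real \<gamma> * vector_derivative f (at x)
     + (CLINT y|\<nu>. f (x + y) - f x
          - of_real (y * indicator {-1..1} y) * vector_derivative f (at x))"

definition trunc_generator ::
  "real \<Rightarrow> real \<Rightarrow> real measure \<Rightarrow> real set \<Rightarrow> (real \<Rightarrow> complex) \<Rightarrow> real \<Rightarrow> complex" where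
  "trunc_generator A \<gamma> \<nu> \<Delta> f = trunc \<Delta> (generator A \<gamma> \<nu> (trunc \<Delta> f))"

text \<open>Derivative of a function on \<open>\<Delta>\<close>, one-sided at the endpoints of the segments.\<close>

definition deriv_on :: "real set \<Rightarrow> (real \<Rightarrow> complex) \<Rightarrow> real \<Rightarrow> complex" where
  "deriv_on \<Delta> g x = vector_derivative g (at x within \<Delta>)"

definition in_Lp :: "real \<Rightarrow> real set \<Rightarrow> (real \<Rightarrow> complex) \<Rightarrow> bool" where
  "in_Lp p S h \<longleftrightarrow> set_borel_measurable lborel S h \<and>
     set_integrable lborel S (\<lambda>x. cmod (h x) powr p)"

text \<open>As usual for functions with second derivative in \<open>L\<^sup>p\<close>, \<open>g'\<close> is absolutely continuous
  on each segment: \<open>g''\<close> exists almost everywhere and \<open>g'\<close> is an indefinite integral of it.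
  Where \<open>g'\<close> is not differentiable, the value of \<open>g''\<close> is an irrelevant constant.
  Only the values of \<open>g\<close> on \<open>\<Delta>\<close> matter.\<close>

definition C_Delta ::
  "real \<Rightarrow> nat \<Rightarrow> (nat \<Rightarrow> real) \<Rightarrow> (nat \<Rightarrow> real) \<Rightarrow> (real \<Rightarrow> complex) set" where
  "C_Delta p n a b = {g.
     let \<Delta> = segments n a b; g1 = deriv_on \<Delta> g; g2 = deriv_on \<Delta> g1 in
       (\<forall>x\<in>\<Delta>. g differentiable (at x within \<Delta>)) \<and>
       (AE x in lborel. x \<in> \<Delta> \<longrightarrow> g1 differentiable (at x within \<Delta>)) \<and>
       in_Lp p \<Delta> g2 \<and>
       (\<forall>k\<in>{1..n}. \<forall>x\<in>{a k..b k}. g1 x = g1 (a k) + (CLINT y:{a k..x}|lborel. g2 y)) \<and>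
       (\<forall>k\<in>{1..n}. g (a k) = 0 \<and> g (b k) = 0 \<and> g1 (a k) = 0 \<and> g1 (b k) = 0)}"

definition pairing ::
  "real set \<Rightarrow> (real \<Rightarrow> complex) \<Rightarrow> (real \<Rightarrow> complex) \<Rightarrow> complex" where
  "pairing \<Delta> g h = (CLINT x:\<Delta>|lborel. g x * cnj (h x))"

section \<open>The function \<open>\<psi>\<close>\<close>

definition V_out :: "real set \<Rightarrow> real \<Rightarrow> real" where
  "V_out \<Delta> x = (if x \<in> \<Delta> then 0 else 1)"

primrec Q_iter ::
  "(real \<Rightarrow> real \<Rightarrow> real) \<Rightarrow> real set \<Rightarrow> nat \<Rightarrow> real \<Rightarrow> real \<Rightarrow> real" where
  "Q_iter \<rho> \<Delta> 0 = \<rho>"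
| "Q_iter \<rho> \<Delta> (Suc n) = (\<lambda>x t.
     LINT \<tau>:{0<..<t}|lborel. LINT \<xi>|lborel.
       \<rho> (x - \<xi>) (t - \<tau>) * V_out \<Delta> \<xi> * Q_iter \<rho> \<Delta> n \<xi> \<tau>)"

definition Q_sum ::
  "(real \<Rightarrow> real \<Rightarrow> real) \<Rightarrow> real set \<Rightarrow> real \<Rightarrow> real \<Rightarrow> real \<Rightarrow> real" where
  "Q_sum \<rho> \<Delta> x t u = (\<Sum>n. (-1) ^ n * u ^ n * Q_iter \<rho> \<Delta> n x t)"

definition psi_u ::
  "(real \<Rightarrow> real \<Rightarrow> real) \<Rightarrow> real set \<Rightarrow> real \<Rightarrow> real \<Rightarrow> real \<Rightarrow> real" where
  "psi_u \<rho> \<Delta> x s u = (LINT t:{0<..}|lborel. exp (- s * t) * Q_sum \<rho> \<Delta> x t u)"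

definition psi :: "(real \<Rightarrow> real \<Rightarrow> real) \<Rightarrow> real set \<Rightarrow> real \<Rightarrow> real \<Rightarrow> real" where
  "psi \<rho> \<Delta> x s = Lim at_top (\<lambda>u. psi_u \<rho> \<Delta> x s u)"

end

theory Submission
  imports Defs
begin

text \<open>Let \<open>G(x) = \<integral>\<^sub>0\<^sup>\<infinity> e\<^sup>-\<^sup>s\<^sup>t \<rho>(x,t) dt\<close> be the resolvent density. Perturbation theory gives
  \<open>\<psi>\<^sub>u + u G * (V \<psi>\<^sub>u) = G\<close>, and Dynkin's formula gives \<open>\<integral> (s - L)F(x) G(x - \<xi>) dx = F(\<xi>)\<close>.
  Since \<open>F V = 0\<close>, it follows that \<open>\<integral> (s - L)F \<psi>\<^sub>u = F(0)\<close> for every \<open>u\<close>. As \<open>u\<close> tends to infinity,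
  \<open>\<psi>\<^sub>u\<close> decreases to \<open>\<psi>\<close>, which vanishes almost everywhere off \<open>\<Delta>\<close>, and dominated convergence applies
  as soon as \<open>|(s - L)F| G\<close> is integrable. This last point is not obvious because \<open>F''\<close> is only
  integrable and \<open>G\<close> may be unbounded. It holds because \<open>L F\<close> depends on \<open>F''\<close> through
  \<open>A/2 F'' + K * F''\<close> with a finite measure \<open>K\<close> made from the small jumps, and the resolvent equation itself
  forces the adjoint expression \<open>A/2 G + G * K\<close> to be bounded.\<close>

section \<open>Convolution of nonnegative functions\<close>

text \<open>Two obstacles shape the argument. \<open>\<psi>\<close> is built pointwise from an
  alternating series of iterated Bochner integrals whose sign, monotonicity in u and finiteness are
  invisible. Let A and C be the times spent outside and inside \<Delta> up to time t. The series
  stands for E exp(-u A); since A + C = t, it equals exp(-u t) E exp(u C), whose expansion has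
  nonnegative terms. This is why words in both weights are studied. The identity A + C = t rests on
  Chapman-Kolmogorov, which is available almost everywhere, with an inequality at every point; one
  further convolution erases the null sets. Convolutions take values in \<open>ennreal\<close>,
  where Fubini needs no integrability, and are used on space-time as well as on the line. The second
  obstacle is regularity: F'' exists only almost everywhere and \<open>G\<close> is not known to be
  differentiable. The resolvent equation is therefore divided by (1 - i z)^2 on the Fourier side.
  Division by 1 - i z is convolution with the exponential density, so only integrable functions are
  compared, through uniqueness of Fourier transforms.\<close>

definition nnconv :: "('a::euclidean_space \<Rightarrow> ennreal) \<Rightarrow> ('a \<Rightarrow> ennreal) \<Rightarrow> 'a \<Rightarrow> ennreal" where
  "nnconv F G x = (\<integral>\<^sup>+y. F (x - y) * G y \<partial>lborel)"

lemma lborel_distr_reflect: "distr lborel borel (\<lambda>y. c - y) = (lborel :: 'a::euclidean_space measure)"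
  using lborel_affine[of "-1" c] by (simp add: density_1)

lemma nn_integral_reflect:
  fixes F :: "'a::euclidean_space \<Rightarrow> ennreal"
  assumes [measurable]: "F \<in> borel_measurable borel"
  shows "(\<integral>\<^sup>+y. F (c - y) \<partial>lborel) = (\<integral>\<^sup>+y. F y \<partial>lborel)"
  by (subst (2) lborel_distr_reflect[of c, symmetric]) (simp add: nn_integral_distr)

lemma nn_integral_translate:
  fixes F :: "'a::euclidean_space \<Rightarrow> ennreal"
  assumes [measurable]: "F \<in> borel_measurable borel"
  shows "(\<integral>\<^sup>+y. F (c + y) \<partial>lborel) = (\<integral>\<^sup>+y. F y \<partial>lborel)"
  by (subst (2) lborel_distr_plus[of c, symmetric]) (simp add: nn_integral_distr)

lemma AE_reflect:
  fixes P :: "'a::euclidean_space \<Rightarrow> bool"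
  assumes "AE y in lborel. P y"
  shows "AE y in lborel. P (c - y)"
proof -
  have "AE y in distr lborel borel (\<lambda>y. c - y). P y"
    using assms by (subst lborel_distr_reflect)
  then show ?thesis
    by (rule AE_distrD[rotated]) simp
qed

lemma borel_measurable_fst_snd [measurable]:
  "fst \<in> borel_measurable (borel :: ('a::euclidean_space \<times> 'b::euclidean_space) measure)"
  "snd \<in> borel_measurable (borel :: ('a::euclidean_space \<times> 'b::euclidean_space) measure)"
  by (intro borel_measurable_continuous_onI continuous_intros)+

lemma measurable_nnconv [measurable]:
  assumes [measurable]: "F \<in> borel_measurable borel" "G \<in> borel_measurable borel"
  shows "nnconv F G \<in> borel_measurable borel"
  unfolding nnconv_def by measurable

text \<open>Changes of the factors on null sets disappear at every point of the convolution, not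
  just at almost every one. This is how an almost everywhere Chapman-Kolmogorov equation becomes
  usable pointwise.\<close>

lemma nnconv_cong_AE:
  assumes "AE x in lborel. F x = F' x" "AE x in lborel. G x = G' x"
  shows "nnconv F G = nnconv F' G'"
proof
  fix x
  show "nnconv F G x = nnconv F' G' x"
    unfolding nnconv_def
    by (rule nn_integral_cong_AE) (use AE_reflect[OF assms(1), of x] assms(2) in eventually_elim, simp)
qed

lemma nnconv_assoc:
  assumes [measurable]: "F \<in> borel_measurable borel" "G \<in> borel_measurable borel"
    "H \<in> borel_measurable borel"
  shows "nnconv (nnconv F G) H = nnconv F (nnconv G H)"
proof
  fix x
  have "nnconv (nnconv F G) H x = (\<integral>\<^sup>+z. \<integral>\<^sup>+y. F (x - z - y) * G y * H z \<partial>lborel \<partial>lborel)"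
    unfolding nnconv_def by (simp add: nn_integral_multc)
  also have "\<dots> = (\<integral>\<^sup>+z. \<integral>\<^sup>+y. F (x - y) * G (y - z) * H z \<partial>lborel \<partial>lborel)"
  proof (rule nn_integral_cong)
    fix z :: 'a
    show "(\<integral>\<^sup>+y. F (x - z - y) * G y * H z \<partial>lborel) = (\<integral>\<^sup>+y. F (x - y) * G (y - z) * H z \<partial>lborel)"
      by (subst nn_integral_translate[of "\<lambda>y. F (x - z - y) * G y * H z" "-z", symmetric])
        (simp_all add: algebra_simps)
  qed
  also have "\<dots> = (\<integral>\<^sup>+y. \<integral>\<^sup>+z. F (x - y) * G (y - z) * H z \<partial>lborel \<partial>lborel)"
    by (rule lborel_pair.Fubini') measurable
  also have "\<dots> = nnconv F (nnconv G H) x"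
    unfolding nnconv_def by (simp add: nn_integral_cmult mult.assoc)
  finally show "nnconv (nnconv F G) H x = nnconv F (nnconv G H) x" .
qed

lemma nnconv_add_right:
  assumes [measurable]: "F \<in> borel_measurable borel" "G \<in> borel_measurable borel"
    "H \<in> borel_measurable borel"
  shows "nnconv F (\<lambda>p. G p + H p) x = nnconv F G x + nnconv F H x"
  unfolding nnconv_def by (simp add: distrib_left nn_integral_add)

lemma nnconv_cmult_right:
  assumes [measurable]: "F \<in> borel_measurable borel" "G \<in> borel_measurable borel"
  shows "nnconv F (\<lambda>p. c * G p) x = c * nnconv F G x"
  unfolding nnconv_def by (simp add: nn_integral_cmult mult.left_commute)

lemma nnconv_suminf_right:
  assumes [measurable]: "F \<in> borel_measurable borel" "\<And>n. G n \<in> borel_measurable borel"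
  shows "nnconv F (\<lambda>p. \<Sum>n. G n p) x = (\<Sum>n. nnconv F (G n) x)"
  unfolding nnconv_def by (subst nn_integral_suminf[symmetric]) (auto simp: ennreal_suminf_cmult)

lemma nn_integral_nnconv:
  assumes [measurable]: "F \<in> borel_measurable borel" "G \<in> borel_measurable borel"
  shows "(\<integral>\<^sup>+x. nnconv F G x \<partial>lborel) = (\<integral>\<^sup>+x. F x \<partial>lborel) * (\<integral>\<^sup>+x. G x \<partial>lborel)"
proof -
  have "(\<integral>\<^sup>+x. nnconv F G x \<partial>lborel) = (\<integral>\<^sup>+y. \<integral>\<^sup>+x. F (x - y) * G y \<partial>lborel \<partial>lborel)"
    unfolding nnconv_def by (rule lborel_pair.Fubini') measurable
  also have "\<dots> = (\<integral>\<^sup>+y. (\<integral>\<^sup>+x. F x \<partial>lborel) * G y \<partial>lborel)"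
    using nn_integral_translate[of F "- y" for y]
    by (intro nn_integral_cong) (simp add: nn_integral_multc)
  finally show ?thesis
    by (simp add: nn_integral_cmult)
qed

subsection \<open>Words in two complementary weights\<close>

text \<open>For the transition density \<open>r\<close> of a Markov process, \<open>word_conv r V W j k\<close> is the density
  of \<open>E[A\<^sup>j/j! C\<^sup>k/k!; X\<^sub>t \<in> dx]\<close> with \<open>A\<close> and \<open>C\<close> the time integrals of \<open>V(X)\<close> and \<open>W(X)\<close>.\<close>

fun word_conv ::
  "(real \<times> real \<Rightarrow> ennreal) \<Rightarrow> (real \<Rightarrow> ennreal) \<Rightarrow> (real \<Rightarrow> ennreal) \<Rightarrow> nat \<Rightarrow> nat
    \<Rightarrow> real \<times> real \<Rightarrow> ennreal" where
  "word_conv r V W 0 0 = r"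
| "word_conv r V W (Suc j) 0 = nnconv r (\<lambda>p. V (fst p) * word_conv r V W j 0 p)"
| "word_conv r V W 0 (Suc k) = nnconv r (\<lambda>p. W (fst p) * word_conv r V W 0 k p)"
| "word_conv r V W (Suc j) (Suc k) =
     nnconv r (\<lambda>p. V (fst p) * word_conv r V W j (Suc k) p + W (fst p) * word_conv r V W (Suc j) k p)"

declare word_conv.simps [simp del]

lemma measurable_word_conv [measurable]:
  assumes [measurable]: "r \<in> borel_measurable borel" "V \<in> borel_measurable borel"
    "W \<in> borel_measurable borel"
  shows "word_conv r V W j k \<in> borel_measurable borel"
  using assms
proof (induction r V W j k rule: word_conv.induct)
  case (1 r V W) then show ?case by (simp add: word_conv.simps)
next
  case (2 r V W j)
  then have [measurable]: "word_conv r V W j 0 \<in> borel_measurable borel" by blast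
  note 2(2-) [measurable]
  show ?case by (simp add: word_conv.simps)
next
  case (3 r V W k)
  then have [measurable]: "word_conv r V W 0 k \<in> borel_measurable borel" by blast
  note 3(2-) [measurable]
  show ?case by (simp add: word_conv.simps)
next
  case (4 r V W j k)
  then have [measurable]: "word_conv r V W j (Suc k) \<in> borel_measurable borel"
    "word_conv r V W (Suc j) k \<in> borel_measurable borel" by blast+
  note 4(3-) [measurable]
  show ?case by (simp add: word_conv.simps)
qed

text \<open>Integrating Chapman-Kolmogorov over the intermediate time gives r * r = t r. Equality is
  assumed almost everywhere (\<open>rr_AE\<close>); the inequality at every point
  (\<open>rr_le\<close>) keeps all iterates finite everywhere.\<close>

locale conv_semigroup =
  fixes r :: "real \<times> real \<Rightarrow> ennreal" and V W :: "real \<Rightarrow> ennreal"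
  assumes r_meas [measurable]: "r \<in> borel_measurable borel"
    and V_meas [measurable]: "V \<in> borel_measurable borel"
    and W_meas [measurable]: "W \<in> borel_measurable borel"
    and VW: "V x + W x = 1"
    and r_past: "t \<le> 0 \<Longrightarrow> r (x, t) = 0"
    and r_finite: "r p < \<infinity>"
    and rr_le: "nnconv r r (x, t) \<le> ennreal t * r (x, t)"
    and rr_AE: "AE p in lborel. nnconv r r p = ennreal (snd p) * r p"
begin

abbreviation B :: "nat \<Rightarrow> nat \<Rightarrow> real \<times> real \<Rightarrow> ennreal" where
  "B j k \<equiv> word_conv r V W j k"

lemma nnconv_past:
  assumes "\<And>x t. t \<le> 0 \<Longrightarrow> G (x, t) = 0" "t \<le> 0"
  shows "nnconv r G (x, t) = 0"
proof -
  have "r ((x, t) - q) * G q = 0" for q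
    by (cases q; cases "snd q \<le> 0") (use assms r_past in auto)
  then show ?thesis
    by (simp only: nnconv_def nn_integral_const mult_zero_left)
qed

lemma B_past: "t \<le> 0 \<Longrightarrow> B j k (x, t) = 0"
proof -
  \<comment> \<open>The induction rule varies kernel and weights too, so they are generalised and
    the kernel is tied back by \<open>r' = r\<close>.\<close>
  have "\<forall>x t. t \<le> 0 \<longrightarrow> word_conv r' V' W' j k (x, t) = 0" if "r' = r" for r' V' W'
    using that
  proof (induction r' V' W' j k rule: word_conv.induct)
    case (1 r V W) then show ?case using r_past by (simp add: word_conv.simps)
  next
    case (2 r V W j) then show ?case by (auto intro!: nnconv_past simp: word_conv.simps)
  next
    case (3 r V W k) then show ?case by (auto intro!: nnconv_past simp: word_conv.simps)
  next
    case (4 r V W j k) then show ?case by (auto intro!: nnconv_past simp: word_conv.simps)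
  qed
  then show "t \<le> 0 \<Longrightarrow> B j k (x, t) = 0"
    by blast
qed

text \<open>Multiplication by time is a derivation for convolution, because t = (t - tau) + tau.
  Vanishing at nonpositive times makes this work in \<open>ennreal\<close>, where negative times are
  truncated to 0.\<close>

lemma time_nnconv:
  assumes [measurable]: "G \<in> borel_measurable borel" and "\<And>x t. t \<le> 0 \<Longrightarrow> G (x, t) = 0"
  shows "ennreal (snd p) * nnconv r G p =
    nnconv (\<lambda>q. ennreal (snd q) * r q) G p + nnconv r (\<lambda>q. ennreal (snd q) * G q) p"
proof -
  have "ennreal (snd p) * (r (p - q) * G q) =
      ennreal (snd (p - q)) * r (p - q) * G q + r (p - q) * (ennreal (snd q) * G q)" for q
  proof (cases "snd q \<le> 0 \<or> snd p \<le> snd q")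
    case True
    then have "r (p - q) * G q = 0"
      using assms(2)[of "snd q" "fst q"] r_past[of "snd (p - q)" "fst (p - q)"] by (cases q; cases p) auto
    then show ?thesis
      by (auto simp: mult.assoc mult.left_commute)
  next
    case False
    then have "ennreal (snd p) = ennreal (snd (p - q)) + ennreal (snd q)"
      by (simp flip: ennreal_plus)
    then show ?thesis
      by (simp add: algebra_simps)
  qed
  then have "ennreal (snd p) * nnconv r G p =
     (\<integral>\<^sup>+q. (ennreal (snd (p - q)) * r (p - q) * G q + r (p - q) * (ennreal (snd q) * G q)) \<partial>lborel)"
    unfolding nnconv_def by (subst nn_integral_cmult[symmetric]) auto
  then show ?thesis
    unfolding nnconv_def by (subst nn_integral_add[symmetric]) auto
qed

lemma B_split: "j + k > 0 \<Longrightarrow> nnconv r (B j k) p =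
    nnconv r (\<lambda>q. V (fst q) * B j k q) p + nnconv r (\<lambda>q. W (fst q) * B j k q) p"
proof -
  have "B j k q = V (fst q) * B j k q + W (fst q) * B j k q" for q
    using VW[of "fst q"] by (metis distrib_right mult_1)
  then have "nnconv r (B j k) p = nnconv r (\<lambda>q. V (fst q) * B j k q + W (fst q) * B j k q) p"
    by (intro arg_cong[where f="\<lambda>G. nnconv r G p"] ext)
  also have "\<dots> = nnconv r (\<lambda>q. V (fst q) * B j k q) p + nnconv r (\<lambda>q. W (fst q) * B j k q) p"
    by (rule nnconv_add_right) auto
  finally show ?thesis .
qed

text \<open>The derivation rule with t r replaced by r * r. The replacement holds almost everywhere,
  but it happens under the convolution with \<open>G\<close>, so the result is exact at every
  point.\<close>

lemma time_nnconv_r: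
  assumes [measurable]: "G \<in> borel_measurable borel" and "\<And>x t. t \<le> 0 \<Longrightarrow> G (x, t) = 0"
  shows "ennreal (snd p) * nnconv r G p =
    nnconv r (nnconv r G) p + nnconv r (\<lambda>q. ennreal (snd q) * G q) p"
proof -
  have "nnconv (\<lambda>q. ennreal (snd q) * r q) G = nnconv (nnconv r r) G"
    by (rule nnconv_cong_AE) (use rr_AE in auto)
  then show ?thesis
    using time_nnconv[OF assms] by (simp add: nnconv_assoc)
qed

text \<open>Exact at every point, since V + W = 1. The comparison with t r, which would be the case
  j = k = 0 of \<open>B_time\<close>, is known only almost everywhere and is therefore excluded
  there.\<close>

lemma B_time_00: "B 1 0 p + B 0 1 p = nnconv r r p"
proof -
  have "r q = V (fst q) * r q + W (fst q) * r q" for q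
    using VW[of "fst q"] by (metis distrib_right mult_1)
  then have "nnconv r r p = nnconv r (\<lambda>q. V (fst q) * r q + W (fst q) * r q) p"
    by (intro arg_cong[where f="\<lambda>G. nnconv r G p"] ext)
  then show ?thesis
    by (simp add: word_conv.simps nnconv_add_right)
qed

lemma B_time_00_AE: "AE q in lborel. ennreal (snd q) * B 0 0 q = B 1 0 q + B 0 1 q"
  using rr_AE B_time_00 by (auto simp: word_conv.simps)

text \<open>This is the density form of \<open>A + C = t\<close>.\<close>

lemma B_time:
  "j + k > 0 \<Longrightarrow>
    ennreal (snd p) * B j k p = of_nat (Suc j) * B (Suc j) k p + of_nat (Suc k) * B j (Suc k) p"
proof (induction "j + k" arbitrary: j k p)
  case (Suc n)
  \<comment> \<open>An almost everywhere version suffices, as it is applied under a convolution; in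
    this form the index (0, 0) is covered as well.\<close>
  have IH: "AE q in lborel. ennreal (snd q) * B j k q =
      of_nat (Suc j) * B (Suc j) k q + of_nat (Suc k) * B j (Suc k) q" if "j + k = n" for j k
  proof (cases "n = 0")
    case True
    then show ?thesis using that B_time_00_AE by simp
  next
    case False
    then show ?thesis using that Suc.hyps(1)[of j k] by auto
  qed
  define pV where "pV j k q = (if j = 0 then 0 else V (fst q) * B (j - 1) k q)" for j k q
  define pW where "pW j k q = (if k = 0 then 0 else W (fst q) * B j (k - 1) q)" for j k q
  have [measurable]: "pV j k \<in> borel_measurable borel" "pW j k \<in> borel_measurable borel" for j k
    unfolding pV_def[abs_def] pW_def[abs_def] by (cases "j = 0"; cases "k = 0"; simp)+
  have past: "pV j k (x, t) + pW j k (x, t) = 0" if "t \<le> 0" for j k x t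
    using that by (simp add: pV_def pW_def B_past)
  have split: "B j k = nnconv r (\<lambda>q. pV j k q + pW j k q)" if "0 < j + k" for j k
    using that by (cases j; cases k) (simp_all add: pV_def pW_def word_conv.simps)
  have weight: "nnconv r (\<lambda>q. ennreal (snd q) * (U (fst q) * B j k q)) p =
      of_nat (Suc j) * nnconv r (\<lambda>q. U (fst q) * B (Suc j) k q) p
      + of_nat (Suc k) * nnconv r (\<lambda>q. U (fst q) * B j (Suc k) q) p"
    if "j + k = n" and [measurable]: "U \<in> borel_measurable borel" for j k U
  proof -
    have "nnconv r (\<lambda>q. ennreal (snd q) * (U (fst q) * B j k q)) =
        nnconv r (\<lambda>q. of_nat (Suc j) * (U (fst q) * B (Suc j) k q)
          + of_nat (Suc k) * (U (fst q) * B j (Suc k) q))"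
    proof (rule nnconv_cong_AE)
      show "AE q in lborel. ennreal (snd q) * (U (fst q) * B j k q) =
        of_nat (Suc j) * (U (fst q) * B (Suc j) k q) + of_nat (Suc k) * (U (fst q) * B j (Suc k) q)"
        using IH[OF that(1)]
      proof eventually_elim
        case (elim q)
        have "ennreal (snd q) * (U (fst q) * B j k q) = U (fst q) * (ennreal (snd q) * B j k q)"
          by (simp add: ac_simps)
        then show ?case
          unfolding elim by (simp add: distrib_left mult.left_commute del: of_nat_Suc)
      qed
    qed simp
    then show ?thesis
      by (simp add: nnconv_add_right nnconv_cmult_right del: of_nat_Suc)
  qed
  have 1: "ennreal (snd p) * B j k p = nnconv r (\<lambda>q. V (fst q) * B j k q) p
      + nnconv r (\<lambda>q. W (fst q) * B j k q) p
      + (nnconv r (\<lambda>q. ennreal (snd q) * pV j k q) p + nnconv r (\<lambda>q. ennreal (snd q) * pW j k q) p)"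
  proof -
    have "ennreal (snd p) * B j k p = nnconv r (B j k) p
        + nnconv r (\<lambda>q. ennreal (snd q) * (pV j k q + pW j k q)) p"
      unfolding split[OF Suc.prems] by (rule time_nnconv_r) (auto simp: past simp del: add_eq_0_iff_both_eq_0)
    then show ?thesis
      unfolding B_split[OF Suc.prems] by (simp add: distrib_left nnconv_add_right)
  qed
  have 2: "B (Suc j) k p = nnconv r (\<lambda>q. V (fst q) * B j k q) p + nnconv r (pW (Suc j) k) p"
    "B j (Suc k) p = nnconv r (pV j (Suc k)) p + nnconv r (\<lambda>q. W (fst q) * B j k q) p"
    by (simp_all add: split nnconv_add_right) (simp_all add: pV_def[abs_def] pW_def[abs_def])
  have 3: "nnconv r (\<lambda>q. ennreal (snd q) * pV j k q) p =
      of_nat j * nnconv r (\<lambda>q. V (fst q) * B j k q) p + of_nat (Suc k) * nnconv r (pV j (Suc k)) p"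
    using weight[of "j - 1" k V] Suc.hyps(2)
    by (cases j) (simp_all add: pV_def[abs_def] nnconv_def del: of_nat_Suc)
  have 4: "nnconv r (\<lambda>q. ennreal (snd q) * pW j k q) p =
      of_nat (Suc j) * nnconv r (pW (Suc j) k) p + of_nat k * nnconv r (\<lambda>q. W (fst q) * B j k q) p"
    using weight[of j "k - 1" W] Suc.hyps(2)
    by (cases k) (simp_all add: pW_def[abs_def] nnconv_def del: of_nat_Suc)
  \<comment> \<open>A letter term V B j k (or W B j k) occurs once from r * B j k and j (or k) times
    from the induction hypothesis, which gives the factors j + 1 and k + 1.\<close>
  show ?case
    unfolding 1 2 3 4 by (simp add: algebra_simps)
qed simp

text \<open>By \<open>B_time\<close>, finiteness of t B j k passes to both neighbouring indices; the
  step out of (0, 0), where that identity holds only almost everywhere, uses \<open>rr_le\<close>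
  instead. Finiteness at every point is wanted because \<open>Q_iter\<close> is evaluated
  pointwise.\<close>

lemma B_finite: "B j k p < \<infinity>"
proof (induction "j + k" arbitrary: j k)
  case 0 then show ?case using r_finite by (simp add: word_conv.simps)
next
  case (Suc n)
  have rr: "nnconv r r p < \<infinity>"
    using rr_le[of "fst p" "snd p"] r_finite[of p]
    by (metis ennreal_mult_less_top ennreal_less_top infinity_ennreal_def le_less_trans prod.collapse)
  have step: "B (Suc j) k p < \<infinity> \<and> B j (Suc k) p < \<infinity>" if "j + k = n" for j k
  proof (cases "n = 0")
    case True
    then show ?thesis
      using that rr B_time_00[of p] by (auto simp flip: B_time_00)
  next
    case False
    have "ennreal (snd p) * B j k p < \<infinity>"
      using Suc.hyps(1)[of j k] that by (auto simp: ennreal_mult_less_top)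
    then have "of_nat (Suc j) * B (Suc j) k p < \<infinity> \<and> of_nat (Suc k) * B j (Suc k) p < \<infinity>"
      using B_time[of j k p] that False by simp
    then show ?thesis
      by (auto simp: ennreal_mult_less_top simp del: of_nat_Suc)
  qed
  show ?case
  proof (cases j)
    case 0
    then show ?thesis using step[of 0 n] Suc by auto
  next
    case (Suc j')
    then show ?thesis using step[of j' k] Suc.hyps by auto
  qed
qed

end

section \<open>The perturbation series\<close>

text \<open>Think of \<open>b j k\<close> as A^j/j! C^k/k! with A + C = t. The formula is the
  binomial expansion of (t - C)^n/n! multiplied by C^k/k!; the binomial coefficient comes from
  merging C^i/i! with C^k/k!. The recursion alone determines it.\<close>

lemma alternating_series_shift:
  fixes b :: "nat \<Rightarrow> nat \<Rightarrow> real"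
  assumes rec: "\<And>j k. t * b j k = real (Suc j) * b (Suc j) k + real (Suc k) * b j (Suc k)"
  shows "b n k = (\<Sum>i\<le>n. (-1) ^ i * real ((k + i) choose i) * b 0 (k + i) * (t ^ (n - i) / fact (n - i)))"
proof (induction n arbitrary: k)
  case (Suc n)
  define c where "c i = (-1) ^ i * b 0 (k + i)" for i
  define d where "d m = t ^ m / fact m" for m
  have d: "t * d m = real (Suc m) * d (Suc m)" for m
    by (simp add: d_def del: of_nat_Suc)
  have 1: "t * b n k = (\<Sum>i\<le>n. real ((k + i) choose i) * c i * (real (Suc n - i) * d (Suc n - i)))"
    unfolding Suc sum_distrib_left
  proof (rule sum.cong)
    fix i assume "i \<in> {..n}"
    then have "real (Suc n - i) * d (Suc n - i) = t * d (n - i)"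
      using d[of "n - i"] by (simp add: Suc_diff_le)
    then show "t * ((-1) ^ i * real ((k + i) choose i) * b 0 (k + i) * (t ^ (n - i) / fact (n - i))) =
        real ((k + i) choose i) * c i * (real (Suc n - i) * d (Suc n - i))"
      by (simp add: c_def d_def algebra_simps)
  qed simp
  have "real (Suc k) * b n (Suc k) = (\<Sum>i\<le>n. - (real (Suc i) * real ((k + Suc i) choose Suc i) * c (Suc i) * d (n - i)))"
    unfolding Suc sum_distrib_left
  proof (rule sum.cong)
    fix i assume "i \<in> {..n}"
    have "Suc k * ((k + Suc i) choose i) = Suc i * ((k + Suc i) choose Suc i)"
      using Suc_times_binomial_add[of i k] by (simp add: add.commute)
    then have "real (Suc k) * real ((k + Suc i) choose i) = real (Suc i) * real ((k + Suc i) choose Suc i)"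
      by (metis of_nat_mult)
    then show "real (Suc k) * ((-1) ^ i * real ((Suc k + i) choose i) * b 0 (Suc k + i) * (t ^ (n - i) / fact (n - i))) =
        - (real (Suc i) * real ((k + Suc i) choose Suc i) * c (Suc i) * d (n - i))"
      by (simp add: c_def d_def)
  qed simp
  \<comment> \<open>Shift i + 1 to i; the added term i = 0 vanishes through the factor i. The
    weights n + 1 - i and i of the two sums then add up to the constant n + 1.\<close>
  also have "\<dots> = - (\<Sum>i\<le>Suc n. real i * real ((k + i) choose i) * c i * d (Suc n - i))"
    by (subst sum.atMost_Suc_shift) (simp add: sum_negf)
  finally have 2: "real (Suc k) * b n (Suc k) = - (\<Sum>i\<le>Suc n. real i * real ((k + i) choose i) * c i * d (Suc n - i))" .
  have "real (Suc n) * b (Suc n) k =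
      (\<Sum>i\<le>Suc n. real ((k + i) choose i) * c i * (real (Suc n - i) * d (Suc n - i)))
      + (\<Sum>i\<le>Suc n. real i * real ((k + i) choose i) * c i * d (Suc n - i))"
    using rec[of n k] 1 2 by simp
  also have "\<dots> = (\<Sum>i\<le>Suc n. real (Suc n) * (real ((k + i) choose i) * c i * d (Suc n - i)))"
    unfolding sum.distrib[symmetric]
  proof (rule sum.cong)
    fix i assume "i \<in> {..Suc n}"
    then have "real (Suc n) = real (Suc n - i) + real i" by simp
    then show "real ((k + i) choose i) * c i * (real (Suc n - i) * d (Suc n - i)) +
        real i * real ((k + i) choose i) * c i * d (Suc n - i) =
        real (Suc n) * (real ((k + i) choose i) * c i * d (Suc n - i))"
      by (simp only:) (simp add: algebra_simps del: of_nat_Suc of_nat_diff)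
  qed simp
  finally have "b (Suc n) k = (\<Sum>i\<le>Suc n. real ((k + i) choose i) * c i * d (Suc n - i))"
    unfolding sum_distrib_left[symmetric] by (simp del: of_nat_Suc sum.atMost_Suc)
  then show ?case
    unfolding c_def d_def by (simp add: ac_simps del: sum.atMost_Suc)
qed simp

context
  fixes b :: "nat \<Rightarrow> nat \<Rightarrow> real" and t :: real
  assumes b_nonneg: "\<And>j k. 0 \<le> b j k" and t_nonneg: "0 \<le> t"
    and b_rec: "\<And>j k. t * b j k = real (Suc j) * b (Suc j) k + real (Suc k) * b j (Suc k)"
begin

lemma row_ratio: "real (Suc k) * b 0 (Suc k) \<le> t * b 0 k"
  using b_rec[of 0 k] b_nonneg[of 1 k] by simp

lemma column_ratio: "real (Suc k) * b (Suc k) 0 \<le> t * b k 0"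
  using b_rec[of k 0] b_nonneg[of k 1] by simp

text \<open>The ratio condition bounds \<open>c k\<close> by c 0 t^k/k!, so an exponential series
  dominates for every u.\<close>

lemma summable_ratio:
  assumes c: "\<And>k. 0 \<le> c k" "\<And>k. real (Suc k) * c (Suc k) \<le> t * c k"
  shows "summable (\<lambda>k. norm (c k * u ^ k))"
proof -
  have bound: "c k \<le> c 0 * (t ^ k / fact k)" for k
  proof (induction k)
    case (Suc k)
    have "real (Suc k) * c (Suc k) \<le> t * (c 0 * (t ^ k / fact k))"
      using c(2)[of k] Suc t_nonneg by (meson mult_left_mono order_trans)
    then have "c (Suc k) \<le> t * (c 0 * (t ^ k / fact k)) / real (Suc k)"
      by (subst pos_le_divide_eq) (simp_all add: mult.commute)
    then show ?case
      by (simp add: mult_ac del: of_nat_Suc)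
  qed simp
  have "summable (\<lambda>k. c 0 * (inverse (fact k) * (t * \<bar>u\<bar>) ^ k))"
    by (intro summable_mult summable_exp)
  then show ?thesis
  proof (rule summable_comparison_test')
    show "norm (norm (c k * u ^ k)) \<le> c 0 * (inverse (fact k) * (t * \<bar>u\<bar>) ^ k)" for k
      using mult_right_mono[OF bound[of k], of "\<bar>u\<bar> ^ k"] c(1)[of k]
      by (simp add: abs_mult power_abs power_mult_distrib field_simps)
  qed
qed

lemma summable_row: "summable (\<lambda>k. norm (b 0 k * u ^ k))"
  using summable_ratio[of "b 0"] b_nonneg row_ratio by blast

lemma summable_column: "summable (\<lambda>k. norm (b k 0 * u ^ k))"
  using summable_ratio[of "\<lambda>k. b k 0"] b_nonneg column_ratio by blast

text \<open>This is E exp(-u A) = exp(-u t) E exp(u C): it trades an alternating series for one with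
  nonnegative coefficients. By \<open>alternating_series_shift\<close> with k = 0, the left side is
  the Cauchy product of the two factors on the right.\<close>

lemma alternating_column_eq:
  "(\<Sum>n. (-1) ^ n * u ^ n * b n 0) = exp (- (u * t)) * (\<Sum>k. b 0 k * u ^ k)"
proof -
  have "(\<lambda>n. \<Sum>i\<le>n. (b 0 i * u ^ i) * (inverse (fact (n - i)) *\<^sub>R (- (u * t)) ^ (n - i)))
      sums ((\<Sum>k. b 0 k * u ^ k) * (\<Sum>m. inverse (fact m) *\<^sub>R (- (u * t)) ^ m))"
    by (rule Cauchy_product_sums[OF summable_row summable_norm_exp])
  moreover have "(\<Sum>i\<le>n. (b 0 i * u ^ i) * (inverse (fact (n - i)) *\<^sub>R (- (u * t)) ^ (n - i))) =
      (-1) ^ n * u ^ n * b n 0" for n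
    unfolding alternating_series_shift[of t b n 0, OF b_rec] sum_distrib_left
  proof (rule sum.cong)
    fix i assume "i \<in> {..n}"
    then have n: "u ^ n = u ^ i * u ^ (n - i)" "(-1::real) ^ n * (-1) ^ i = (-1) ^ (n - i)"
      by (auto simp flip: power_add simp: power_add minus_one_power_iff)
    have "(- (u * t)) ^ (n - i) = (-1) ^ (n - i) * u ^ (n - i) * t ^ (n - i)"
      by (simp flip: power_mult_distrib)
    then show "(b 0 i * u ^ i) * (inverse (fact (n - i)) *\<^sub>R (- (u * t)) ^ (n - i)) =
        (-1) ^ n * u ^ n * ((-1) ^ i * real ((0 + i) choose i) * b 0 (0 + i) * (t ^ (n - i) / fact (n - i)))"
      unfolding n(1) n(2)[symmetric] by (simp add: field_simps)
  qed simp
  ultimately show ?thesis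
    by (simp add: sums_iff exp_def mult.commute)
qed

lemma alternating_column_nonneg: "0 \<le> u \<Longrightarrow> 0 \<le> (\<Sum>n. (-1) ^ n * u ^ n * b n 0)"
  unfolding alternating_column_eq
  by (intro mult_nonneg_nonneg suminf_nonneg summable_norm_cancel[OF summable_row]) (auto simp: b_nonneg)

text \<open>With S the series of nonnegative terms, the derivative of exp(-x t) S(x) is exp(-x t)
  (S' - t S), and \<open>row_ratio\<close> gives S' <= t S term by term.\<close>

lemma alternating_column_antimono:
  assumes "0 \<le> u" "u \<le> v"
  shows "(\<Sum>n. (-1) ^ n * v ^ n * b n 0) \<le> (\<Sum>n. (-1) ^ n * u ^ n * b n 0)"
  unfolding alternating_column_eq
proof (rule DERIV_nonpos_imp_nonincreasing[OF assms(2)])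
  fix x assume x: "u \<le> x" "x \<le> v"
  have sm: "summable (\<lambda>n. b 0 n * y ^ n)" for y
    by (rule summable_norm_cancel[OF summable_row])
  have d: "((\<lambda>y. \<Sum>n. b 0 n * y ^ n) has_real_derivative (\<Sum>n. diffs (b 0) n * x ^ n)) (at x)"
    by (rule termdiffs_strong_converges_everywhere[OF sm])
  have "summable (\<lambda>n. diffs (b 0) n * x ^ n)"
    using termdiff_converges_all[OF sm] .
  then have "(\<Sum>n. diffs (b 0) n * x ^ n) \<le> (\<Sum>n. t * (b 0 n * x ^ n))"
  proof (rule suminf_le[rotated])
    show "summable (\<lambda>n. t * (b 0 n * x ^ n))" by (intro summable_mult sm)
    show "diffs (b 0) n * x ^ n \<le> t * (b 0 n * x ^ n)" for n
      using mult_right_mono[OF row_ratio[of n], of "x ^ n"] x assms by (simp add: diffs_def mult.assoc)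
  qed
  also have "\<dots> = t * (\<Sum>n. b 0 n * x ^ n)"
    by (rule suminf_mult[OF sm])
  finally have "exp (- (x * t)) * ((\<Sum>n. diffs (b 0) n * x ^ n) - t * (\<Sum>n. b 0 n * x ^ n)) \<le> 0"
    by (simp add: mult_nonneg_nonpos)
  moreover have "((\<lambda>y. exp (- (y * t)) * (\<Sum>n. b 0 n * y ^ n)) has_real_derivative
      exp (- (x * t)) * ((\<Sum>n. diffs (b 0) n * x ^ n) - t * (\<Sum>n. b 0 n * x ^ n))) (at x)"
    by (rule derivative_eq_intros d refl | simp add: algebra_simps)+
  ultimately show "\<exists>y. ((\<lambda>u. exp (- (u * t)) * (\<Sum>k. b 0 k * u ^ k)) has_real_derivative y) (at x) \<and> y \<le> 0"
    by blast
qed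

end

section \<open>Sign, monotonicity and Duhamel equation of the perturbed kernel\<close>

context conv_semigroup
begin

definition Qs :: "real \<Rightarrow> real \<times> real \<Rightarrow> real" where
  "Qs u p = (\<Sum>n. (-1) ^ n * u ^ n * enn2real (B n 0 p))"

lemma measurable_Qs [measurable]: "Qs u \<in> borel_measurable borel"
  unfolding Qs_def by measurable

text \<open>At the exceptional points where \<open>r * r < t r\<close> the recursion of \<open>B_time\<close> fails at
  \<open>(0, 0)\<close> only; replacing \<open>r\<close> there by \<open>(r * r) / t\<close> repairs it and costs a nonnegative constant.\<close>

definition Bfix :: "real \<times> real \<Rightarrow> nat \<Rightarrow> nat \<Rightarrow> real" where
  "Bfix p j k = (if j + k = 0 then enn2real (nnconv r r p) / snd p else enn2real (B j k p))"

lemma Bfix_rec: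
  assumes "0 < snd p"
  shows "snd p * Bfix p j k = real (Suc j) * Bfix p (Suc j) k + real (Suc k) * Bfix p j (Suc k)"
proof (cases "j + k = 0")
  case True
  then have "enn2real (nnconv r r p) = Bfix p (Suc j) k + Bfix p j (Suc k)"
    unfolding B_time_00[symmetric] by (subst enn2real_plus) (use B_finite[of _ _ p] in \<open>auto simp: Bfix_def\<close>)
  then show ?thesis
    using assms True by (simp add: Bfix_def)
next
  case False
  have "enn2real (ennreal (snd p) * B j k p) =
      enn2real (of_nat (Suc j) * B (Suc j) k p) + enn2real (of_nat (Suc k) * B j (Suc k) p)"
    unfolding B_time[of j k p, OF False[unfolded neq0_conv]]
    by (subst enn2real_plus) (use B_finite[of _ _ p] in \<open>auto simp: ennreal_mult_less_top of_nat_less_top simp del: of_nat_Suc\<close>)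
  then show ?thesis
    using assms False by (auto simp: Bfix_def enn2real_mult enn2real_of_nat simp del: of_nat_Suc)
qed

lemma Bfix_nonneg: "0 < snd p \<Longrightarrow> 0 \<le> Bfix p j k"
  by (simp add: Bfix_def)

lemma Qs_past: "snd p \<le> 0 \<Longrightarrow> Qs u p = 0"
  using B_past[of "snd p" _ _ "fst p"] by (simp add: Qs_def)

lemma Bfix_00_le: "0 < snd p \<Longrightarrow> Bfix p 0 0 \<le> enn2real (r p)"
proof -
  assume p: "0 < snd p"
  have "enn2real (nnconv r r p) \<le> enn2real (ennreal (snd p) * r p)"
    using rr_le[of "fst p" "snd p"] r_finite[of p]
    by (intro enn2real_mono) (auto simp: ennreal_mult_less_top)
  then show ?thesis
    using p by (simp add: Bfix_def enn2real_mult field_simps)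
qed

lemma summable_Qs: "summable (\<lambda>n. norm (enn2real (B n 0 p) * u ^ n))"
proof (cases "0 < snd p")
  case True
  have "summable (\<lambda>n. norm (Bfix p n 0 * u ^ n))"
    using summable_column[of "Bfix p" "snd p"] Bfix_rec Bfix_nonneg True by simp
  then have "summable (\<lambda>n. norm (Bfix p (Suc n) 0 * u ^ Suc n))"
    by (subst summable_Suc_iff)
  then have "summable (\<lambda>n. norm (enn2real (B (Suc n) 0 p) * u ^ Suc n))"
    by (simp add: Bfix_def)
  then show ?thesis
    by (subst (asm) summable_Suc_iff)
next
  case False
  then show ?thesis
    using B_past[of "snd p" _ _ "fst p"] by simp
qed

text \<open>The correction does not depend on u and is nonnegative by \<open>Bfix_00_le\<close>, so
  sign and monotonicity in u pass from the repaired series to \<open>Qs\<close>.\<close>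

lemma Qs_eq:
  assumes "0 < snd p"
  shows "Qs u p = (enn2real (r p) - Bfix p 0 0) + (\<Sum>n. (-1) ^ n * u ^ n * Bfix p n 0)"
proof -
  have 1: "summable (\<lambda>n. (-1) ^ n * u ^ n * enn2real (B n 0 p))"
    using summable_Qs[of p u] by (rule summable_norm_cancel[OF summable_cong[THEN iffD1, rotated]])
      (simp add: abs_mult mult.commute power_abs)
  have "summable (\<lambda>n. norm (Bfix p n 0 * u ^ n))"
    using summable_column[of "Bfix p" "snd p"] Bfix_rec Bfix_nonneg assms by simp
  then have 2: "summable (\<lambda>n. (-1) ^ n * u ^ n * Bfix p n 0)"
    by (rule summable_norm_cancel[OF summable_cong[THEN iffD1, rotated]])
      (simp add: abs_mult mult.commute power_abs)
  show ?thesis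
    unfolding Qs_def suminf_split_head[OF 1, symmetric]
    using suminf_split_head[OF 1] suminf_split_head[OF 2]
    by (simp add: Bfix_def word_conv.simps(1))
qed

lemma Qs_nonneg: "0 \<le> u \<Longrightarrow> 0 \<le> Qs u p"
proof (cases "0 < snd p")
  case True
  then show "0 \<le> u \<Longrightarrow> 0 \<le> Qs u p"
    using alternating_column_nonneg[of "Bfix p" "snd p" u] Bfix_rec Bfix_nonneg Bfix_00_le
    by (simp add: Qs_eq)
qed (simp add: Qs_past)

lemma Qs_antimono: "0 \<le> u \<Longrightarrow> u \<le> v \<Longrightarrow> Qs v p \<le> Qs u p"
proof (cases "0 < snd p")
  case True
  then show "0 \<le> u \<Longrightarrow> u \<le> v \<Longrightarrow> Qs v p \<le> Qs u p"
    using alternating_column_antimono[of "Bfix p" "snd p" u v] Bfix_rec Bfix_nonneg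
    by (simp add: Qs_eq)
qed (simp add: Qs_past)

lemma Qs_0: "Qs 0 p = enn2real (r p)"
proof -
  have "Qs 0 p = (\<Sum>n\<in>{0}. (-1) ^ n * 0 ^ n * enn2real (B n 0 p))"
    unfolding Qs_def by (rule suminf_finite) auto
  then show ?thesis
    by (simp add: word_conv.simps(1))
qed

lemma Qs_le: "0 \<le> u \<Longrightarrow> ennreal (Qs u p) \<le> r p"
  using Qs_antimono[of 0 u p] r_finite[of p] by (auto simp: Qs_0 ennreal_le_iff2 intro: order_trans[OF ennreal_leI])

text \<open>One more letter V raises the index by one, so it sends the even part of the series to
  the odd part, and the odd part to the even part without its first term \<open>r\<close>. Splitting
  by parity keeps all sums in \<open>ennreal\<close>; the even part is added to both sides and,
  being finite, cancelled at the end.\<close>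

lemma Qs_Duhamel:
  assumes u: "0 \<le> u"
  shows "ennreal (Qs u p) + ennreal u * nnconv r (\<lambda>q. V (fst q) * ennreal (Qs u q)) p = r p"
proof -
  define c where "c n q = ennreal (u ^ n) * B n 0 q" for n q
  define Ev where "Ev q = (\<Sum>n. c (2 * n) q)" for q
  define Od where "Od q = (\<Sum>n. c (2 * n + 1) q)" for q
  have [measurable]: "c n \<in> borel_measurable borel" for n unfolding c_def by measurable
  have [measurable]: "Ev \<in> borel_measurable borel" "Od \<in> borel_measurable borel"
    unfolding Ev_def Od_def by measurable
  have cs: "ennreal u * nnconv r (\<lambda>q. V (fst q) * c n q) q = c (Suc n) q" for n q
  proof -
    have "nnconv r (\<lambda>q. V (fst q) * c n q) q = ennreal (u ^ n) * nnconv r (\<lambda>q. V (fst q) * B n 0 q) q"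
      unfolding c_def by (subst nnconv_cmult_right[symmetric]) (auto simp: ac_simps)
    then show ?thesis
      using u by (simp add: c_def word_conv.simps(2) ennreal_mult ac_simps)
  qed
  have conv: "ennreal u * nnconv r (\<lambda>q. V (fst q) * (\<Sum>n. c (f n) q)) q = (\<Sum>n. c (Suc (f n)) q)"
    for f :: "nat \<Rightarrow> nat" and q
  proof -
    have "nnconv r (\<lambda>q. V (fst q) * (\<Sum>n. c (f n) q)) q = nnconv r (\<lambda>q. \<Sum>n. V (fst q) * c (f n) q) q"
      by simp
    also have "\<dots> = (\<Sum>n. nnconv r (\<lambda>q. V (fst q) * c (f n) q) q)"
      by (rule nnconv_suminf_right) auto
    finally show ?thesis
      by (simp flip: cs)
  qed
  have rO: "ennreal u * nnconv r (\<lambda>q. V (fst q) * Ev q) q = Od q" for q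
    unfolding Ev_def conv Od_def by simp
  have rE: "r q + ennreal u * nnconv r (\<lambda>q. V (fst q) * Od q) q = Ev q" for q
  proof -
    have "Ev q = (\<Sum>n. c (2 * Suc n) q) + c 0 q"
      unfolding Ev_def by (subst suminf_offset[where i=1]) auto
    then show ?thesis
      unfolding Od_def conv by (simp add: c_def word_conv.simps(1) add.commute)
  qed
  have sm: "summable (\<lambda>n. u ^ n * enn2real (B n 0 q))" for q
    using summable_Qs[of q u] u by (simp add: abs_mult mult.commute)
  have c_real: "c n q = ennreal (u ^ n * enn2real (B n 0 q))" for n q
    using B_finite[of n 0 q] u by (simp add: c_def ennreal_mult)
  have QE: "ennreal (Qs u q) + Od q = Ev q \<and> Od q < \<infinity>" for q
  proof -
    let ?a = "\<lambda>n. u ^ n * enn2real (B n 0 q)"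
    have a: "0 \<le> ?a n" for n using u by simp
    have e: "summable (\<lambda>n. ?a (2 * n))" and o: "summable (\<lambda>n. ?a (2 * n + 1))"
      using summable_reindex[OF sm[of q], of "\<lambda>n. 2 * n"] summable_reindex[OF sm[of q], of "\<lambda>n. 2 * n + 1"] a
      by (auto simp: o_def inj_on_def)
    have "(\<lambda>n. (-1) ^ n * ?a n) sums Qs u q"
      unfolding Qs_def mult.assoc
      by (rule summable_sums, rule summable_norm_cancel) (use sm[of q] u in \<open>simp add: abs_mult\<close>)
    then have "(\<lambda>n. sum (\<lambda>n. (-1) ^ n * ?a n) {n * 2..<n * 2 + 2}) sums Qs u q"
      by (rule sums_group) simp
    moreover have "sum (\<lambda>n. (-1) ^ n * ?a n) {n * 2..<n * 2 + 2} = ?a (2 * n) - ?a (2 * n + 1)" for n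
    proof -
      have "{n * 2..<n * 2 + 2} = {2 * n, 2 * n + 1}" by auto
      then show ?thesis by simp
    qed
    ultimately have "Qs u q = (\<Sum>n. ?a (2 * n)) - (\<Sum>n. ?a (2 * n + 1))"
      using suminf_diff[OF e o] by (simp add: sums_iff)
    moreover have "Ev q = ennreal (\<Sum>n. ?a (2 * n))" "Od q = ennreal (\<Sum>n. ?a (2 * n + 1))"
      unfolding Ev_def Od_def c_real using e o u by (auto intro!: suminf_ennreal2)
    ultimately show ?thesis
      using Qs_nonneg[OF u, of q] suminf_nonneg[OF o a]
      by (simp add: ennreal_plus[symmetric] del: ennreal_plus)
  qed
  have "ennreal (Qs u p) + ennreal u * nnconv r (\<lambda>q. V (fst q) * ennreal (Qs u q)) p + Ev p =
     r p + Ev p"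
  proof -
    let ?Q = "nnconv r (\<lambda>q. V (fst q) * ennreal (Qs u q)) p"
      and ?O = "nnconv r (\<lambda>q. V (fst q) * Od q) p"
      and ?E = "nnconv r (\<lambda>q. V (fst q) * Ev q) p"
    have "?Q + ?O = nnconv r (\<lambda>q. V (fst q) * ennreal (Qs u q) + V (fst q) * Od q) p"
      by (rule nnconv_add_right[symmetric]) auto
    also have "\<dots> = ?E"
      using QE by (simp only: distrib_left[symmetric])
    finally have "ennreal u * ?Q + ennreal u * ?O = ennreal u * ?E"
      by (simp only: distrib_left[symmetric])
    then have uQ: "ennreal u * ?Q + ennreal u * ?O = Od p"
      by (simp only: rO)
    have "ennreal (Qs u p) + ennreal u * ?Q + Ev p = ennreal (Qs u p) + ennreal u * ?Q + (r p + ennreal u * ?O)"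
      by (simp only: rE)
    also have "\<dots> = r p + (ennreal (Qs u p) + (ennreal u * ?Q + ennreal u * ?O))"
      by (simp only: ac_simps)
    also have "\<dots> = r p + Ev p"
      using QE[of p] by (simp only: uQ)
    finally show ?thesis .
  qed
  moreover have "Ev p < \<infinity>"
    using QE[of p] by (metis ennreal_add_less_top ennreal_less_top infinity_ennreal_def)
  ultimately show ?thesis
    by (metis add.commute ennreal_add_left_cancel infinity_ennreal_def less_irrefl)
qed

end

section \<open>Transition densities as a space-time kernel\<close>

lemma integral_enn2real:
  assumes [measurable]: "h \<in> borel_measurable M" and "AE x in M. h x < \<infinity>"
  shows "(LINT x|M. enn2real (h x)) = enn2real (\<integral>\<^sup>+x. h x \<partial>M)"
proof -
  have "(LINT x|M. enn2real (h x)) = enn2real (\<integral>\<^sup>+x. ennreal (enn2real (h x)) \<partial>M)"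
    by (rule integral_eq_nn_integral) auto
  also have "(\<integral>\<^sup>+x. ennreal (enn2real (h x)) \<partial>M) = (\<integral>\<^sup>+x. h x \<partial>M)"
    by (rule nn_integral_cong_AE) (use assms(2) in auto)
  finally show ?thesis .
qed

lemma nn_integral_lborel_pair:
  fixes F :: "real \<times> real \<Rightarrow> ennreal"
  assumes "F \<in> borel_measurable borel"
  shows "(\<integral>\<^sup>+p. F p \<partial>lborel) = (\<integral>\<^sup>+t. \<integral>\<^sup>+x. F (x, t) \<partial>lborel \<partial>lborel)"
    and "(\<integral>\<^sup>+p. F p \<partial>lborel) = (\<integral>\<^sup>+x. \<integral>\<^sup>+t. F (x, t) \<partial>lborel \<partial>lborel)"
proof -
  have F: "F \<in> borel_measurable (lborel \<Otimes>\<^sub>M lborel)"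
    using assms by (simp add: lborel_prod)
  have F': "case_prod (\<lambda>x t. F (x, t)) \<in> borel_measurable (lborel \<Otimes>\<^sub>M lborel)"
    using F by simp
  show "(\<integral>\<^sup>+p. F p \<partial>lborel) = (\<integral>\<^sup>+t. \<integral>\<^sup>+x. F (x, t) \<partial>lborel \<partial>lborel)"
    using lborel_pair.nn_integral_snd[OF F'] by (simp add: lborel_prod)
  show "(\<integral>\<^sup>+p. F p \<partial>lborel) = (\<integral>\<^sup>+x. \<integral>\<^sup>+t. F (x, t) \<partial>lborel \<partial>lborel)"
    using lborel.nn_integral_fst[OF F] by (simp add: lborel_prod)
qed

text \<open>What the perturbation series needs of the process. \<open>\<rho>\<close> is arbitrary at
  nonpositive times, so each condition is restricted to positive times or cuts the others
  off.\<close>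

locale density_semigroup =
  fixes \<rho> :: "real \<Rightarrow> real \<Rightarrow> real" and \<Delta> :: "real set"
  assumes \<Delta>_borel [measurable]: "\<Delta> \<in> sets borel"
    and \<rho>_meas: "(\<lambda>p. indicator {0<..} (snd p) * \<rho> (fst p) (snd p)) \<in> borel_measurable borel"
    and \<rho>_nonneg: "0 < t \<Longrightarrow> 0 \<le> \<rho> x t"
    and \<rho>_conv_le: "0 < a \<Longrightarrow> 0 < b \<Longrightarrow>
      (\<integral>\<^sup>+\<xi>. ennreal (\<rho> (x - \<xi>) a) * ennreal (\<rho> \<xi> b) \<partial>lborel) \<le> ennreal (\<rho> x (a + b))"
    and \<rho>_conv_AE: "0 < a \<Longrightarrow> 0 < b \<Longrightarrow> AE x in lborel.
      (\<integral>\<^sup>+\<xi>. ennreal (\<rho> (x - \<xi>) a) * ennreal (\<rho> \<xi> b) \<partial>lborel) = ennreal (\<rho> x (a + b))"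
    and \<rho>_prob: "0 < t \<Longrightarrow> (\<integral>\<^sup>+x. ennreal (\<rho> x t) \<partial>lborel) = 1"
begin

definition r :: "real \<times> real \<Rightarrow> ennreal" where
  "r p = ennreal (indicator {0<..} (snd p) * \<rho> (fst p) (snd p))"

lemma measurable_r [measurable]: "r \<in> borel_measurable borel"
  unfolding r_def using \<rho>_meas by measurable

lemma r_pos: "0 < t \<Longrightarrow> r (x, t) = ennreal (\<rho> x t)"
  by (simp add: r_def)

lemma r_past: "t \<le> 0 \<Longrightarrow> r (x, t) = 0"
  by (simp add: r_def)

lemma nnconv_rr: "nnconv r r (x, t) =
    (\<integral>\<^sup>+\<tau>. indicator {0<..<t} \<tau> * (\<integral>\<^sup>+\<xi>. r (x - \<xi>, t - \<tau>) * r (\<xi>, \<tau>) \<partial>lborel) \<partial>lborel)"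
proof -
  have "nnconv r r (x, t) = (\<integral>\<^sup>+\<tau>. \<integral>\<^sup>+\<xi>. r (x - \<xi>, t - \<tau>) * r (\<xi>, \<tau>) \<partial>lborel \<partial>lborel)"
    unfolding nnconv_def by (subst nn_integral_lborel_pair(1)) auto
  also have "\<dots> = (\<integral>\<^sup>+\<tau>. indicator {0<..<t} \<tau> * (\<integral>\<^sup>+\<xi>. r (x - \<xi>, t - \<tau>) * r (\<xi>, \<tau>) \<partial>lborel) \<partial>lborel)"
    by (intro nn_integral_cong) (auto simp: indicator_def r_past not_less)
  finally show ?thesis .
qed

lemma nn_integral_const_interval:
  "(\<integral>\<^sup>+\<tau>. indicator {0<..<t::real} \<tau> * c \<partial>lborel) = ennreal t * c"
proof (cases "0 \<le> t")
  case True
  then show ?thesis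
    by (subst nn_integral_multc) simp_all
next
  case False
  then show ?thesis by (simp add: ennreal_neg)
qed

lemma rr_le: "nnconv r r (x, t) \<le> ennreal t * r (x, t)"
  unfolding nnconv_rr nn_integral_const_interval[symmetric]
  using \<rho>_conv_le[of "t - \<tau>" \<tau> x for \<tau>]
  by (intro nn_integral_mono) (auto simp: indicator_def r_pos)

text \<open>For each pair of times Chapman-Kolmogorov may fail on a null set of x depending on these
  times. Fubini for null sets is applied twice: to exchange tau and x at fixed t, and to collect all
  t into one null set of space-time.\<close>

lemma rr_AE: "AE p in lborel. nnconv r r p = ennreal (snd p) * r p"
proof -
  have "AE x in lborel. nnconv r r (x, t) = ennreal t * r (x, t)" for t
  proof -
    have "AE \<tau> in lborel. AE x in lborel. indicator {0<..<t} \<tau> * (\<integral>\<^sup>+\<xi>. r (x - \<xi>, t - \<tau>) * r (\<xi>, \<tau>) \<partial>lborel)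
        = indicator {0<..<t} \<tau> * r (x, t)"
    proof (rule AE_I2)
      fix \<tau> :: real
      show "AE x in lborel. indicator {0<..<t} \<tau> * (\<integral>\<^sup>+\<xi>. r (x - \<xi>, t - \<tau>) * r (\<xi>, \<tau>) \<partial>lborel)
        = indicator {0<..<t} \<tau> * r (x, t)"
      proof (cases "\<tau> \<in> {0<..<t}")
        case True
        then have "AE x in lborel. (\<integral>\<^sup>+\<xi>. ennreal (\<rho> (x - \<xi>) (t - \<tau>)) * ennreal (\<rho> \<xi> \<tau>) \<partial>lborel)
            = ennreal (\<rho> x t)"
          using \<rho>_conv_AE[of "t - \<tau>" \<tau>] by simp
        then show ?thesis
          using True by (simp add: r_pos)
      qed simp
    qed
    then have "AE x in lborel. AE \<tau> in lborel. indicator {0<..<t} \<tau> * (\<integral>\<^sup>+\<xi>. r (x - \<xi>, t - \<tau>) * r (\<xi>, \<tau>) \<partial>lborel)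
        = indicator {0<..<t} \<tau> * r (x, t)"
      by (subst (asm) lborel_pair.AE_commute) measurable
    then show ?thesis
    proof eventually_elim
      case (elim x)
      then have "nnconv r r (x, t) = (\<integral>\<^sup>+\<tau>. indicator {0<..<t} \<tau> * r (x, t) \<partial>lborel)"
        unfolding nnconv_rr by (rule nn_integral_cong_AE)
      then show ?case
        by (simp add: nn_integral_const_interval)
    qed
  qed
  then have "AE t in lborel. AE x in lborel. nnconv r r (x, t) = ennreal t * r (x, t)"
    by simp
  then have "AE x in lborel. AE t in lborel. nnconv r r (x, t) = ennreal t * r (x, t)"
    by (subst (asm) lborel_pair.AE_commute) measurable
  then have "AE p in lborel \<Otimes>\<^sub>M lborel. nnconv r r p = ennreal (snd p) * r p"
  proof (intro lborel_pair.AE_pair_measure)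
    have "{p \<in> space borel. nnconv r r p = ennreal (snd p) * r p} \<in> sets borel"
      by measurable
    then show "{p \<in> space (lborel \<Otimes>\<^sub>M lborel). nnconv r r p = ennreal (snd p) * r p}
        \<in> sets (lborel \<Otimes>\<^sub>M lborel)"
      unfolding lborel_prod by simp
  qed simp
  then show ?thesis
    unfolding lborel_prod .
qed

sublocale conv_semigroup r "indicator (- \<Delta>)" "indicator \<Delta>"
proof
  show "indicator (- \<Delta>) x + indicator \<Delta> x = (1 :: ennreal)" for x
    by (simp add: indicator_def)
  show "r p < \<infinity>" for p
    by (simp add: r_def)
qed (auto simp: r_past rr_le rr_AE)

text \<open>A divergent Bochner integral is 0 by convention, which agrees with
  \<open>enn2real\<close> of infinity for the inner integral. For the outer one, finiteness of
  \<open>B\<close> at (x, t) makes the inner integral finite for almost every tau.\<close>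

lemma Q_iter_eq: "0 < t \<Longrightarrow> Q_iter \<rho> \<Delta> n x t = enn2real (B n 0 (x, t))"
proof (induction n arbitrary: x t)
  case 0
  then show ?case
    by (simp add: word_conv.simps(1) r_pos \<rho>_nonneg)
next
  case (Suc n)
  define h where "h \<tau> \<xi> = r (x - \<xi>, t - \<tau>) * (indicator (- \<Delta>) \<xi> * B n 0 (\<xi>, \<tau>))" for \<tau> \<xi>
  have [measurable]: "case_prod h \<in> borel_measurable (borel \<Otimes>\<^sub>M borel)"
    unfolding h_def by measurable
  have h_fin: "h \<tau> \<xi> < \<infinity>" for \<tau> \<xi>
    using r_finite[of "(x - \<xi>, t - \<tau>)"] B_finite[of n 0 "(\<xi>, \<tau>)"]
    by (auto simp: h_def ennreal_mult_less_top indicator_def)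
  have B: "B (Suc n) 0 (x, t) = (\<integral>\<^sup>+\<tau>. \<integral>\<^sup>+\<xi>. h \<tau> \<xi> \<partial>lborel \<partial>lborel)"
    unfolding word_conv.simps(2) nnconv_def h_def by (subst nn_integral_lborel_pair(1)) auto
  have inner: "(LINT \<xi>|lborel. \<rho> (x - \<xi>) (t - \<tau>) * V_out \<Delta> \<xi> * Q_iter \<rho> \<Delta> n \<xi> \<tau>) =
      enn2real (\<integral>\<^sup>+\<xi>. h \<tau> \<xi> \<partial>lborel)" if "\<tau> \<in> {0<..<t}" for \<tau>
  proof -
    have "\<rho> (x - \<xi>) (t - \<tau>) * V_out \<Delta> \<xi> * Q_iter \<rho> \<Delta> n \<xi> \<tau> = enn2real (h \<tau> \<xi>)" for \<xi>
      using that Suc.IH[of \<tau> \<xi>] \<rho>_nonneg[of "t - \<tau>"]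
      by (auto simp: h_def V_out_def r_pos enn2real_mult)
    then show ?thesis
      using h_fin[of \<tau>] by (simp add: integral_enn2real)
  qed
  have outer: "indicator {0<..<t} \<tau> *\<^sub>R (LINT \<xi>|lborel. \<rho> (x - \<xi>) (t - \<tau>) * V_out \<Delta> \<xi> * Q_iter \<rho> \<Delta> n \<xi> \<tau>) =
      enn2real (\<integral>\<^sup>+\<xi>. h \<tau> \<xi> \<partial>lborel)" for \<tau>
  proof (cases "\<tau> \<in> {0<..<t}")
    case True
    then show ?thesis using inner by simp
  next
    case False
    then have "h \<tau> \<xi> = 0" for \<xi>
      by (cases "\<tau> \<le> 0") (auto simp: h_def r_past B_past)
    then show ?thesis using False by simp
  qed
  have "AE \<tau> in lborel. (\<integral>\<^sup>+\<xi>. h \<tau> \<xi> \<partial>lborel) \<noteq> \<infinity>"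
    using B_finite[of "Suc n" 0 "(x, t)"] unfolding B
    by (intro nn_integral_noteq_infinite) auto
  then have fin: "AE \<tau> in lborel. (\<integral>\<^sup>+\<xi>. h \<tau> \<xi> \<partial>lborel) < \<infinity>"
    by (simp add: less_top)
  then show ?case
    unfolding Q_iter.simps set_lebesgue_integral_def outer B
    using fin by (intro integral_enn2real) simp_all
qed

lemma Q_sum_eq: "0 < t \<Longrightarrow> Q_sum \<rho> \<Delta> x t u = Qs u (x, t)"
  by (simp add: Q_sum_def Qs_def Q_iter_eq)

end

section \<open>The resolvent of the killed process\<close>

lemma nn_integral_exp_half_line:
  assumes "0 < (s::real)"
  shows "(\<integral>\<^sup>+t. ennreal (exp (- s * t) * indicator {0<..} t) \<partial>lborel) = ennreal (1 / s)"
proof -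
  interpret prob_space "density lborel (exponential_density s)"
    by (rule prob_space_exponential_density[OF assms])
  have "1 = (\<integral>\<^sup>+t. ennreal (exponential_density s t) \<partial>lborel)"
    using emeasure_space_1 by (simp add: emeasure_density)
  also have "\<dots> = (\<integral>\<^sup>+t. ennreal s * ennreal (exp (- s * t) * indicator {0<..} t) \<partial>lborel)"
    using assms AE_lborel_singleton[of "0::real"]
    by (intro nn_integral_cong_AE) (auto simp: exponential_density_def indicator_def mult.commute simp flip: ennreal_mult')
  also have "\<dots> = ennreal s * (\<integral>\<^sup>+t. ennreal (exp (- s * t) * indicator {0<..} t) \<partial>lborel)"
    by (rule nn_integral_cmult) measurable
  finally have "ennreal (1 / s) * 1 = ennreal (1 / s) * (ennreal s * (\<integral>\<^sup>+t. ennreal (exp (- s * t) * indicator {0<..} t) \<partial>lborel))"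
    by simp
  moreover have "ennreal (1 / s) * ennreal s = 1"
    using assms by (simp flip: ennreal_mult)
  ultimately show ?thesis
    by (simp add: mult.assoc[symmetric])
qed

context density_semigroup
begin

context
  fixes s :: real
  assumes s: "0 < s"
begin

text \<open>The integral runs over all times. For functions vanishing at t <= 0 this is the usual
  transform, and the convolution theorem becomes a plain translation of t.\<close>

definition laplace :: "(real \<times> real \<Rightarrow> ennreal) \<Rightarrow> real \<Rightarrow> ennreal" where
  "laplace F x = (\<integral>\<^sup>+t. ennreal (exp (- s * t)) * F (x, t) \<partial>lborel)"

lemma measurable_laplace [measurable]:
  assumes [measurable]: "F \<in> borel_measurable borel"
  shows "laplace F \<in> borel_measurable borel"
  unfolding laplace_def[abs_def] by measurable

lemma laplace_mono: "(\<And>p. F p \<le> F' p) \<Longrightarrow> laplace F x \<le> laplace F' x"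
  unfolding laplace_def by (intro nn_integral_mono mult_left_mono) auto

lemma laplace_nnconv:
  assumes [measurable]: "F \<in> borel_measurable borel" "H \<in> borel_measurable borel"
  shows "laplace (nnconv F H) x = nnconv (laplace F) (laplace H) x"
proof -
  have shift: "(\<integral>\<^sup>+t. ennreal (exp (- s * t)) * (F (x - \<xi>, t - \<tau>) * H (\<xi>, \<tau>)) \<partial>lborel) =
      laplace F (x - \<xi>) * (ennreal (exp (- s * \<tau>)) * H (\<xi>, \<tau>))" for \<xi> \<tau>
  proof -
    have "(\<integral>\<^sup>+t. ennreal (exp (- s * t)) * (F (x - \<xi>, t - \<tau>) * H (\<xi>, \<tau>)) \<partial>lborel) =
        (\<integral>\<^sup>+t. ennreal (exp (- s * (\<tau> + t))) * (F (x - \<xi>, t) * H (\<xi>, \<tau>)) \<partial>lborel)"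
      by (subst nn_integral_translate[of _ \<tau>, symmetric]) simp_all
    also have "\<dots> = (\<integral>\<^sup>+t. (ennreal (exp (- s * t)) * F (x - \<xi>, t)) * (ennreal (exp (- s * \<tau>)) * H (\<xi>, \<tau>)) \<partial>lborel)"
    proof (rule nn_integral_cong)
      fix t
      have "exp (- s * (\<tau> + t)) = exp (- s * t) * exp (- s * \<tau>)"
        by (simp add: algebra_simps flip: exp_add)
      then show "ennreal (exp (- s * (\<tau> + t))) * (F (x - \<xi>, t) * H (\<xi>, \<tau>)) =
          (ennreal (exp (- s * t)) * F (x - \<xi>, t)) * (ennreal (exp (- s * \<tau>)) * H (\<xi>, \<tau>))"
        by (simp only: ennreal_mult exp_ge_zero ac_simps)
    qed
    finally show ?thesis
      by (simp add: nn_integral_multc laplace_def)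
  qed
  have "laplace (nnconv F H) x =
      (\<integral>\<^sup>+t. \<integral>\<^sup>+p. ennreal (exp (- s * t)) * (F (x - fst p, t - snd p) * H p) \<partial>lborel \<partial>lborel)"
    unfolding laplace_def nnconv_def by (simp add: nn_integral_cmult minus_prod_def)
  also have "\<dots> = (\<integral>\<^sup>+p. \<integral>\<^sup>+t. ennreal (exp (- s * t)) * (F (x - fst p, t - snd p) * H p) \<partial>lborel \<partial>lborel)"
    by (rule lborel_pair.Fubini') measurable
  also have "\<dots> = (\<integral>\<^sup>+\<xi>. \<integral>\<^sup>+\<tau>. laplace F (x - \<xi>) * (ennreal (exp (- s * \<tau>)) * H (\<xi>, \<tau>)) \<partial>lborel \<partial>lborel)"
    by (subst nn_integral_lborel_pair(2)) (measurable, simp only: fst_conv snd_conv shift)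
  also have "\<dots> = nnconv (laplace F) (laplace H) x"
    unfolding nnconv_def by (simp add: nn_integral_cmult) (simp add: laplace_def)
  finally show ?thesis .
qed

definition G :: "real \<Rightarrow> ennreal" where "G = laplace r"
definition Psi :: "real \<Rightarrow> real \<Rightarrow> ennreal" where "Psi u = laplace (\<lambda>p. ennreal (Qs u p))"

lemma measurable_G [measurable]: "G \<in> borel_measurable borel"
  unfolding G_def by measurable

lemma measurable_Psi [measurable]: "Psi u \<in> borel_measurable borel"
  unfolding Psi_def by measurable

lemma Psi_le: "0 \<le> u \<Longrightarrow> Psi u x \<le> G x"
  unfolding Psi_def G_def by (intro laplace_mono Qs_le)

lemma Psi_antimono: "0 \<le> u \<Longrightarrow> u \<le> v \<Longrightarrow> Psi v x \<le> Psi u x"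
  unfolding Psi_def by (intro laplace_mono ennreal_leI Qs_antimono)

lemma Psi_equation:
  assumes u: "0 \<le> u"
  shows "Psi u x + ennreal u * nnconv G (\<lambda>\<xi>. indicator (- \<Delta>) \<xi> * Psi u \<xi>) x = G x"
proof -
  let ?H = "\<lambda>p. indicator (- \<Delta>) (fst p) * ennreal (Qs u p)"
  have H: "laplace ?H = (\<lambda>\<xi>. indicator (- \<Delta>) \<xi> * Psi u \<xi>)"
    by (auto simp: fun_eq_iff laplace_def Psi_def indicator_def)
  have "G x = laplace (\<lambda>p. ennreal (Qs u p) + ennreal u * nnconv r ?H p) x"
    unfolding G_def using Qs_Duhamel[OF u] by simp
  also have "\<dots> = Psi u x + ennreal u * laplace (nnconv r ?H) x"
    unfolding laplace_def Psi_def
    by (simp add: distrib_left nn_integral_add mult.left_commute nn_integral_cmult)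
  also have "laplace (nnconv r ?H) x = nnconv G (\<lambda>\<xi>. indicator (- \<Delta>) \<xi> * Psi u \<xi>) x"
    by (subst laplace_nnconv) (auto simp: G_def H)
  finally show ?thesis ..
qed

lemma nn_integral_G: "(\<integral>\<^sup>+x. G x \<partial>lborel) = ennreal (1 / s)"
proof -
  have "(\<integral>\<^sup>+x. G x \<partial>lborel) = (\<integral>\<^sup>+t. \<integral>\<^sup>+x. ennreal (exp (- s * t)) * r (x, t) \<partial>lborel \<partial>lborel)"
    unfolding G_def laplace_def by (rule lborel_pair.Fubini') measurable
  also have "\<dots> = (\<integral>\<^sup>+t. ennreal (exp (- s * t) * indicator {0<..} t) \<partial>lborel)"
  proof (rule nn_integral_cong)
    fix t :: real
    have "(\<integral>\<^sup>+x. r (x, t) \<partial>lborel) = indicator {0<..} t"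
      using \<rho>_prob[of t] by (cases "0 < t") (auto simp: r_pos r_past not_less)
    then show "(\<integral>\<^sup>+x. ennreal (exp (- s * t)) * r (x, t) \<partial>lborel) = ennreal (exp (- s * t) * indicator {0<..} t)"
      by (simp add: nn_integral_cmult ennreal_mult ennreal_indicator)
  qed
  also have "\<dots> = ennreal (1 / s)"
    by (rule nn_integral_exp_half_line[OF s])
  finally show ?thesis .
qed

lemma AE_G_finite: "AE x in lborel. G x < \<infinity>"
  using nn_integral_noteq_infinite[of G lborel] nn_integral_G by (simp add: less_top)

text \<open>Integrating \<open>Psi_equation\<close> over x turns the convolution into a product with
  the mass 1/s of \<open>G\<close>, which cancels against the mass on the right. For u > 0 the mass
  of \<open>Psi u\<close> off \<Delta> is thus at most 1/u and dies out in the limit.\<close>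

lemma nn_integral_Psi_outside:
  assumes u: "0 \<le> u"
  shows "ennreal u * (\<integral>\<^sup>+\<xi>. indicator (- \<Delta>) \<xi> * Psi u \<xi> \<partial>lborel) \<le> 1"
proof -
  have "ennreal u * (ennreal (1 / s) * (\<integral>\<^sup>+\<xi>. indicator (- \<Delta>) \<xi> * Psi u \<xi> \<partial>lborel)) =
      (\<integral>\<^sup>+x. ennreal u * nnconv G (\<lambda>\<xi>. indicator (- \<Delta>) \<xi> * Psi u \<xi>) x \<partial>lborel)"
    by (simp add: nn_integral_cmult nn_integral_nnconv nn_integral_G)
  also have "\<dots> \<le> (\<integral>\<^sup>+x. G x \<partial>lborel)"
    by (intro nn_integral_mono) (metis Psi_equation[OF u] le_add2 le_iff_add add.commute)
  finally have "ennreal s * (ennreal u * (ennreal (1 / s) * (\<integral>\<^sup>+\<xi>. indicator (- \<Delta>) \<xi> * Psi u \<xi> \<partial>lborel)))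
      \<le> ennreal s * ennreal (1 / s)"
    unfolding nn_integral_G by (intro mult_left_mono) auto
  moreover have "ennreal s * ennreal (1 / s) = 1"
    using s by (simp flip: ennreal_mult)
  ultimately show ?thesis
    by (metis mult.assoc mult.commute mult_1)
qed

lemma psi_u_eq: "psi_u \<rho> \<Delta> x s u = enn2real (Psi u x)" if "0 \<le> u"
proof -
  have "indicator {0<..} t *\<^sub>R (exp (- s * t) * Q_sum \<rho> \<Delta> x t u) = exp (- s * t) * Qs u (x, t)" for t
    by (cases "0 < t") (auto simp: Q_sum_eq Qs_past)
  then have "psi_u \<rho> \<Delta> x s u = (LINT t|lborel. exp (- s * t) * Qs u (x, t))"
    by (simp only: psi_u_def set_lebesgue_integral_def)
  also have "\<dots> = enn2real (\<integral>\<^sup>+t. ennreal (exp (- s * t) * Qs u (x, t)) \<partial>lborel)"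
    by (rule integral_eq_nn_integral) (auto intro!: AE_I2 mult_nonneg_nonneg Qs_nonneg that)
  finally show ?thesis
    by (simp add: Psi_def laplace_def ennreal_mult Qs_nonneg that)
qed

text \<open>The limit exists at every point, also where \<open>G\<close> is infinite; this is what makes \<open>\<psi>\<close> Borel.\<close>

lemma psi_limit: "(\<lambda>n::nat. enn2real (Psi (real n) x)) \<longlonglongrightarrow> psi \<rho> \<Delta> x s"
proof -
  define f where "f u = psi_u \<rho> \<Delta> x s u" for u
  have ev: "\<forall>\<^sub>F u in at_top. 0 \<le> (u::real)"
    by (rule eventually_ge_at_top)
  have "\<exists>L. (f \<longlongrightarrow> L) at_top"
  proof (cases "\<exists>u0\<ge>0. Psi u0 x < \<infinity>")
    \<comment> \<open>\<open>Psi u x\<close> is infinite for all u >= 0; its real value is then 0 by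
      convention, and so is the limit.\<close>
    case False
    then have "f u = 0" if "0 \<le> u" for u
      using that by (auto simp: f_def psi_u_eq not_less top_unique)
    then have "(f \<longlongrightarrow> 0) at_top"
      by (intro tendsto_eventually) (use ev in eventually_elim, simp)
    then show ?thesis ..
  next
    case True
    then obtain u0 where u0: "0 \<le> u0" "Psi u0 x < \<infinity>" by blast
    \<comment> \<open>Monotonicity is claimed only from u0 on: an earlier infinite value would be
      read as 0.\<close>
    have anti: "f v \<le> f u" if "u0 \<le> u" "u \<le> v" for u v
      unfolding f_def using that u0 Psi_antimono[of u v x] Psi_antimono[of u0 u x]
      by (subst (1 2) psi_u_eq) (auto intro!: enn2real_mono)
    have pos: "0 \<le> f u" if "u0 \<le> u" for u
      using that u0 by (simp add: f_def psi_u_eq)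
    let ?L = "Inf (f ` {u0..})"
    have bdd: "bdd_below (f ` {u0..})"
      using pos by (auto intro!: bdd_belowI[of _ 0])
    have "(f \<longlongrightarrow> ?L) at_top"
    proof (rule decreasing_tendsto)
      show "\<forall>\<^sub>F u in at_top. ?L \<le> f u"
        using eventually_ge_at_top[of u0] by eventually_elim (auto intro!: cInf_lower bdd)
      fix y assume "?L < y"
      then obtain u1 where u1: "u0 \<le> u1" "f u1 < y"
        using bdd by (subst (asm) cInf_less_iff) auto
      show "\<forall>\<^sub>F u in at_top. f u < y"
        using eventually_ge_at_top[of u1] by eventually_elim (use u1 anti in fastforce)
    qed
    then show ?thesis ..
  qed
  then have "(f \<longlongrightarrow> psi \<rho> \<Delta> x s) at_top"
    unfolding psi_def f_def[symmetric] by (metis tendsto_Lim trivial_limit_at_top_linorder)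
  then have "(\<lambda>n. f (real n)) \<longlonglongrightarrow> psi \<rho> \<Delta> x s"
    by (rule filterlim_compose[OF _ filterlim_real_sequentially])
  then show ?thesis
    by (simp add: f_def psi_u_eq)
qed

lemma measurable_psi [measurable]: "(\<lambda>x. psi \<rho> \<Delta> x s) \<in> borel_measurable borel"
  by (rule borel_measurable_LIMSEQ_real[OF psi_limit]) measurable

lemma psi_nonneg: "0 \<le> psi \<rho> \<Delta> x s"
  by (rule LIMSEQ_le_const[OF psi_limit]) auto

lemma psi_le_Psi:
  assumes "G x < \<infinity>"
  shows "ennreal (psi \<rho> \<Delta> x s) \<le> Psi (real n) x"
proof -
  have fin: "Psi (real m) x < \<infinity>" for m
    using Psi_le[of "real m" x] assms by (auto intro: le_less_trans)
  have "psi \<rho> \<Delta> x s \<le> enn2real (Psi (real n) x)"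
    using Psi_antimono[of "real n" _ x] fin
    by (intro LIMSEQ_le_const2[OF psi_limit]) (auto intro!: exI[of _ n] enn2real_mono)
  then show ?thesis
    using fin[of n] by (metis ennreal_enn2real ennreal_leI infinity_ennreal_def)
qed

text \<open>\<open>psi\<close> lies almost everywhere below each \<open>Psi n\<close>, so n times
  its integral off \<Delta> is at most 1 for every n.\<close>

lemma psi_outside: "AE x in lborel. x \<notin> \<Delta> \<longrightarrow> psi \<rho> \<Delta> x s = 0"
proof -
  let ?I = "\<integral>\<^sup>+x. indicator (- \<Delta>) x * ennreal (psi \<rho> \<Delta> x s) \<partial>lborel"
  have le: "ennreal (real n) * ?I \<le> 1" for n
  proof -
    have "?I \<le> (\<integral>\<^sup>+x. indicator (- \<Delta>) x * Psi (real n) x \<partial>lborel)"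
      by (rule nn_integral_mono_AE)
        (use AE_G_finite in \<open>eventually_elim, auto intro!: mult_left_mono psi_le_Psi\<close>)
    then have "ennreal (real n) * ?I \<le> ennreal (real n) * (\<integral>\<^sup>+x. indicator (- \<Delta>) x * Psi (real n) x \<partial>lborel)"
      by (intro mult_left_mono) auto
    also have "\<dots> \<le> 1"
      by (rule nn_integral_Psi_outside) simp
    finally show ?thesis .
  qed
  have "?I = 0"
  proof (cases ?I)
    case (real c)
    have "real n * c \<le> 1" for n
      using le[of n] real by (simp flip: ennreal_mult ennreal_1)
    then have "\<not> 0 < c"
      by (metis reals_Archimedean3 not_less)
    then show ?thesis using real by simp
  next
    case top
    then show ?thesis using le[of 1] by (simp add: top_unique)
  qed
  then have "AE x in lborel. indicator (- \<Delta>) x * ennreal (psi \<rho> \<Delta> x s) = 0"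
    by (subst (asm) nn_integral_0_iff_AE) auto
  then show ?thesis
    by eventually_elim (use psi_nonneg in \<open>auto simp: ennreal_eq_0_iff intro: antisym\<close>)
qed

end

end

section \<open>Convolution with finite measures and Fourier transforms\<close>

lemma lborel_integral_translate:
  fixes f :: "real \<Rightarrow> 'b :: {banach, second_countable_topology}"
  shows "(LINT x|lborel. f (c + x)) = (LINT x|lborel. f x)"
  using lborel_integral_real_affine[of 1 f c] by simp

text \<open>Common frame for the measures that act by convolution: the exponential law, the law of
  the process at a fixed time, the two jump measures, and the measure with density
  \<open>Psi u\<close> off \<Delta>.\<close>

locale conv_measure = finite_measure N for N :: "real measure" +
  assumes sets_N [measurable_cong, simp]: "sets N = sets borel"
begin

sublocale P: pair_sigma_finite lborel N
  by standard

lemma space_N [simp]: "space N = UNIV"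
  using sets_eq_imp_space_eq[OF sets_N] by simp

definition mconv :: "(real \<Rightarrow> real) \<Rightarrow> real \<Rightarrow> real" where
  "mconv f x = (LINT y|N. f (x - y))"

lemma measurable_mconv [measurable]:
  assumes [measurable]: "f \<in> borel_measurable borel"
  shows "mconv f \<in> borel_measurable borel"
  unfolding mconv_def by measurable

lemma nn_integral_shift_swap:
  assumes [measurable]: "g \<in> borel_measurable borel" "h \<in> borel_measurable borel"
  shows "(\<integral>\<^sup>+x. \<integral>\<^sup>+y. g x * h (x - y) \<partial>N \<partial>lborel) = (\<integral>\<^sup>+x. \<integral>\<^sup>+y. g (x + y) * h x \<partial>N \<partial>lborel)"
proof -
  have "(\<integral>\<^sup>+x. \<integral>\<^sup>+y. g x * h (x - y) \<partial>N \<partial>lborel) = (\<integral>\<^sup>+y. \<integral>\<^sup>+x. g x * h (x - y) \<partial>lborel \<partial>N)"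
    by (rule P.Fubini'[symmetric]) measurable
  also have "\<dots> = (\<integral>\<^sup>+y. \<integral>\<^sup>+x. g (x + y) * h x \<partial>lborel \<partial>N)"
  proof (rule nn_integral_cong)
    fix y
    show "(\<integral>\<^sup>+x. g x * h (x - y) \<partial>lborel) = (\<integral>\<^sup>+x. g (x + y) * h x \<partial>lborel)"
      by (subst nn_integral_translate[of _ y, symmetric]) (simp_all add: add.commute)
  qed
  also have "\<dots> = (\<integral>\<^sup>+x. \<integral>\<^sup>+y. g (x + y) * h x \<partial>N \<partial>lborel)"
    by (rule P.Fubini') measurable
  finally show ?thesis .
qed

text \<open>Convolution with \<open>N\<close> and averaging of translates are adjoint. The
  hypothesis is the Tonelli bound itself rather than boundedness of \<open>\<phi>\<close>, because
  it has to cover a merely integrable second derivative. The last form keeps \<open>N\<close>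
  outside, for identities that are known for each translate.\<close>

lemma mconv_test:
  fixes \<phi> :: "real \<Rightarrow> complex" and f :: "real \<Rightarrow> real"
  assumes [measurable]: "\<phi> \<in> borel_measurable borel" "f \<in> borel_measurable borel"
    and fin: "(\<integral>\<^sup>+x. \<integral>\<^sup>+y. ennreal (norm (\<phi> (x + y))) * ennreal \<bar>f x\<bar> \<partial>N \<partial>lborel) < \<infinity>"
  shows "integrable lborel (\<lambda>x. \<phi> x * complex_of_real (mconv f x))"
    and "integrable lborel (\<lambda>x. complex_of_real (f x) * (CLINT y|N. \<phi> (x + y)))"
    and "(CLINT x|lborel. \<phi> x * complex_of_real (mconv f x)) =
      (CLINT x|lborel. complex_of_real (f x) * (CLINT y|N. \<phi> (x + y)))"
    and "(CLINT x|lborel. \<phi> x * complex_of_real (mconv f x)) =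
      (CLINT y|N. CLINT x|lborel. \<phi> (x + y) * complex_of_real (f x))"
proof -
  let ?p = "\<lambda>x y. \<phi> (x + y) * complex_of_real (f x)" and ?q = "\<lambda>x y. \<phi> x * complex_of_real (f (x - y))"
  have p: "integrable (lborel \<Otimes>\<^sub>M N) (case_prod ?p)"
  proof (rule integrableI_bounded)
    have "(\<integral>\<^sup>+z. ennreal (norm (case_prod ?p z)) \<partial>(lborel \<Otimes>\<^sub>M N)) =
        (\<integral>\<^sup>+x. \<integral>\<^sup>+y. ennreal (norm (\<phi> (x + y))) * ennreal \<bar>f x\<bar> \<partial>N \<partial>lborel)"
      by (subst nn_integral_fst[symmetric]) (auto simp: norm_mult ennreal_mult)
    then show "(\<integral>\<^sup>+z. ennreal (norm (case_prod ?p z)) \<partial>(lborel \<Otimes>\<^sub>M N)) < \<infinity>"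
      using fin by simp
  qed measurable
  have q: "integrable (lborel \<Otimes>\<^sub>M N) (case_prod ?q)"
  proof (rule integrableI_bounded)
    have "(\<integral>\<^sup>+z. ennreal (norm (case_prod ?q z)) \<partial>(lborel \<Otimes>\<^sub>M N)) =
        (\<integral>\<^sup>+x. \<integral>\<^sup>+y. ennreal (norm (\<phi> x)) * ennreal \<bar>f (x - y)\<bar> \<partial>N \<partial>lborel)"
      by (subst nn_integral_fst[symmetric]) (auto simp: norm_mult ennreal_mult)
    also have "\<dots> = (\<integral>\<^sup>+x. \<integral>\<^sup>+y. ennreal (norm (\<phi> (x + y))) * ennreal \<bar>f x\<bar> \<partial>N \<partial>lborel)"
      by (rule nn_integral_shift_swap) measurable
    finally show "(\<integral>\<^sup>+z. ennreal (norm (case_prod ?q z)) \<partial>(lborel \<Otimes>\<^sub>M N)) < \<infinity>"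
      using fin by simp
  qed measurable
  have q1: "(CLINT y|N. ?q x y) = \<phi> x * complex_of_real (mconv f x)" for x
    by (simp add: mconv_def)
  have p1: "(CLINT y|N. ?p x y) = complex_of_real (f x) * (CLINT y|N. \<phi> (x + y))" for x
    by (simp add: mult.commute)
  show "integrable lborel (\<lambda>x. \<phi> x * complex_of_real (mconv f x))"
    using P.integrable_fst[OF q] by (simp only: q1)
  show "integrable lborel (\<lambda>x. complex_of_real (f x) * (CLINT y|N. \<phi> (x + y)))"
    using P.integrable_fst[OF p] by (simp only: p1)
  have "(CLINT x|lborel. \<phi> x * complex_of_real (mconv f x)) = (CLINT x|lborel. CLINT y|N. ?q x y)"
    by (simp only: q1)
  also have "\<dots> = (CLINT y|N. CLINT x|lborel. ?q x y)"
    by (rule P.Fubini_integral[OF q, symmetric])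
  also have "\<dots> = (CLINT y|N. CLINT x|lborel. ?p x y)"
  proof (rule Bochner_Integration.integral_cong)
    fix y
    show "(CLINT x|lborel. ?q x y) = (CLINT x|lborel. ?p x y)"
      by (subst lborel_integral_translate[of _ y, symmetric]) (simp add: add.commute)
  qed simp
  finally show swapped: "(CLINT x|lborel. \<phi> x * complex_of_real (mconv f x)) = (CLINT y|N. CLINT x|lborel. ?p x y)" .
  also have "\<dots> = (CLINT x|lborel. CLINT y|N. ?p x y)"
    by (rule P.Fubini_integral[OF p])
  finally show "(CLINT x|lborel. \<phi> x * complex_of_real (mconv f x)) =
      (CLINT x|lborel. complex_of_real (f x) * (CLINT y|N. \<phi> (x + y)))"
    by (simp only: p1)
qed

lemma mconv_test_bounded:
  assumes "f \<in> borel_measurable borel" "integrable lborel f"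
    and \<phi> [measurable]: "\<phi> \<in> borel_measurable borel" "\<And>x. norm (\<phi> x) \<le> C"
  shows "(\<integral>\<^sup>+x. \<integral>\<^sup>+y. ennreal (norm (\<phi> (x + y) :: complex)) * ennreal \<bar>f x\<bar> \<partial>N \<partial>lborel) < \<infinity>"
proof -
  note [measurable] = assms(1)
  have "(\<integral>\<^sup>+x. \<integral>\<^sup>+y. ennreal (norm (\<phi> (x + y))) * ennreal \<bar>f x\<bar> \<partial>N \<partial>lborel) \<le>
      (\<integral>\<^sup>+x. \<integral>\<^sup>+y. ennreal C * ennreal \<bar>f x\<bar> \<partial>N \<partial>lborel)"
    by (intro nn_integral_mono mult_right_mono ennreal_leI \<phi>) auto
  also have "\<dots> = ennreal C * emeasure N UNIV * (\<integral>\<^sup>+x. ennreal \<bar>f x\<bar> \<partial>lborel)"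
    by (simp add: nn_integral_cmult nn_integral_multc ac_simps)
  also have "\<dots> < \<infinity>"
    using assms(2) emeasure_finite[of UNIV, unfolded less_top]
    by (auto simp: ennreal_mult_less_top integrable_iff_bounded)
  finally show ?thesis .
qed

lemma integrable_mconv:
  assumes "f \<in> borel_measurable borel" "integrable lborel f"
  shows "integrable lborel (mconv f)"
  using mconv_test(1)[of "\<lambda>_. 1" f, OF _ assms(1) mconv_test_bounded[OF assms, of _ 1]]
  by (simp add: complex_of_real_integrable_eq)

end

section \<open>Fourier transforms of integrable functions and their uniqueness\<close>

definition fourier :: "(real \<Rightarrow> real) \<Rightarrow> real \<Rightarrow> complex" where
  "fourier f z = (CLINT x|lborel. iexp (z * x) * complex_of_real (f x))"

lemma integrable_fourier:
  "integrable lborel f \<Longrightarrow> integrable lborel (\<lambda>x. iexp (z * x) * complex_of_real (f x))"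
  by (rule Bochner_Integration.integrable_bound[where f="\<lambda>x. complex_of_real (f x)"])
    (auto simp: norm_mult)

lemma fourier_add:
  "integrable lborel f \<Longrightarrow> integrable lborel g \<Longrightarrow> fourier (\<lambda>x. f x + g x) z = fourier f z + fourier g z"
  unfolding fourier_def
  by (subst Bochner_Integration.integral_add[symmetric]) (use integrable_fourier in \<open>auto simp: distrib_left simp del: of_real_mult\<close>)

lemma fourier_cmult: "fourier (\<lambda>x. c * f x) z = complex_of_real c * fourier f z"
  unfolding fourier_def by (simp add: mult.left_commute)

lemma (in conv_measure) fourier_mconv:
  assumes "f \<in> borel_measurable borel" "integrable lborel f"
  shows "fourier (mconv f) z = fourier f z * char N z"
proof -
  have "(CLINT x|lborel. iexp (z * x) * complex_of_real (mconv f x)) =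
      (CLINT x|lborel. complex_of_real (f x) * (CLINT y|N. iexp (z * (x + y))))"
    by (rule mconv_test(3)[OF _ assms(1) mconv_test_bounded[OF assms, of _ 1]]) auto
  also have "\<dots> = (CLINT x|lborel. iexp (z * x) * complex_of_real (f x) * char N z)"
    unfolding char_def
    by (intro Bochner_Integration.integral_cong refl)
      (simp add: distrib_left exp_add mult_ac flip: integral_mult_right_zero)
  finally show ?thesis
    unfolding fourier_def by simp
qed

text \<open>Positive and negative part have the same transform, hence, at z = 0, the same mass c.
  Unless c = 0, division by c yields probability densities with equal characteristic functions, and
  Levy's uniqueness theorem applies.\<close>

lemma fourier_unique:
  assumes [measurable]: "f \<in> borel_measurable borel" and int: "integrable lborel f" and 0: "\<And>z. fourier f z = 0"
  shows "AE x in lborel. f x = 0"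
proof -
  define fp where "fp x = max 0 (f x)" for x
  define fm where "fm x = max 0 (- f x)" for x
  have [measurable]: "fp \<in> borel_measurable borel" "fm \<in> borel_measurable borel"
    unfolding fp_def fm_def by measurable
  have ints: "integrable lborel fp" "integrable lborel fm"
    unfolding fp_def fm_def using int by auto
  have pos: "0 \<le> fp x" "0 \<le> fm x" for x
    by (auto simp: fp_def fm_def)
  have f: "f x = fp x + (-1) * fm x" for x
    by (auto simp: fp_def fm_def)
  have eq: "fourier fp z = fourier fm z" for z
  proof -
    have "fourier f z = fourier fp z + fourier (\<lambda>x. (-1) * fm x) z"
      unfolding f[abs_def] using ints by (intro fourier_add) auto
    then show ?thesis
      using 0[of z] fourier_cmult[of "-1" fm z] by simp
  qed
  define c where "c = (LINT x|lborel. fp x)"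
  have c: "(LINT x|lborel. fm x) = c"
    using eq[of 0] by (simp add: fourier_def c_def)
  have c0: "0 \<le> c"
    unfolding c_def by (rule integral_nonneg_AE) (auto simp: fp_def)
  show ?thesis
  proof (cases "c = 0")
    case True
    have "AE x in lborel. fp x = 0" "AE x in lborel. fm x = 0"
      using True c c_def ints
      by (auto simp: integral_nonneg_eq_0_iff_AE[symmetric] pos)
    then show ?thesis
      by eventually_elim (simp add: f)
  next
    case False
    define D where "D g = density lborel (\<lambda>x. ennreal (g x / c))" for g :: "real \<Rightarrow> real"
    have D: "real_distribution (D g) \<and> (\<forall>z. char (D g) z = fourier g z / c)"
      if [measurable]: "g \<in> borel_measurable borel" and "integrable lborel g" "\<And>x. 0 \<le> g x"
        "(LINT x|lborel. g x) = c" for g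
    proof -
      have "(\<integral>\<^sup>+x. ennreal (g x / c) \<partial>lborel) = ennreal (LINT x|lborel. g x / c)"
        using that c0 by (intro nn_integral_eq_integral) auto
      then have "emeasure (D g) (space (D g)) = 1"
        using that False by (simp add: D_def emeasure_density)
      then have "prob_space (D g)"
        by (rule prob_spaceI)
      then have "real_distribution (D g)"
        by (simp add: real_distribution_def real_distribution_axioms_def D_def)
      moreover have "char (D g) z = fourier g z / c" for z
        unfolding char_def D_def fourier_def using that c0
        by (subst integral_density) (auto simp: scaleR_conv_of_real mult.commute)
      ultimately show ?thesis by blast
    qed
    have "D fp = D fm"
      using D[of fp] D[of fm] ints c c_def eq
      by (intro Levy_uniqueness) (auto simp: fp_def fm_def)
    then have "AE x in lborel. ennreal (fp x / c) = ennreal (fm x / c)"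
      unfolding D_def by (intro sigma_finite_measure.density_unique[OF sigma_finite_lborel]) auto
    then show ?thesis
    proof eventually_elim
      case (elim x)
      then have "fp x / c = fm x / c"
        using pos c0 by (subst (asm) ennreal_inj) (auto intro: divide_nonneg_nonneg)
      then show ?case
        using False f[of x] by simp
    qed
  qed
qed

section \<open>The exponential kernel\<close>

abbreviation "Exp \<equiv> density lborel (\<lambda>x. ennreal (exponential_density 1 x))"

interpretation Exp: conv_measure Exp
proof -
  interpret prob_space Exp
    by (rule prob_space_exponential_density) simp
  show "conv_measure Exp"
    by unfold_locales simp
qed

lemma emeasure_Exp: "emeasure Exp UNIV = 1"
  using prob_space.emeasure_space_1[OF prob_space_exponential_density[of 1]] by simp

lemma exponential_density_bound: "0 \<le> exponential_density 1 x" "exponential_density 1 x \<le> 1"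
  by (auto simp: exponential_density_def)

lemma Exp_integral:
  fixes f :: "real \<Rightarrow> 'b::{banach, second_countable_topology}"
  assumes [measurable]: "f \<in> borel_measurable borel"
  shows "(LINT x|Exp. f x) = (LINT x|lborel. exponential_density 1 x *\<^sub>R f x)"
  by (rule integral_density) (auto simp: exponential_density_bound)

lemma integrable_exponential_density: "integrable lborel (exponential_density 1)"
  by (rule integrableI_bounded)
    (use emeasure_Exp in \<open>auto simp: emeasure_density exponential_density_bound\<close>)

text \<open>The kernel is at most 1, so convolution with it sends integrable functions to bounded
  ones. The bound on \<open>H\<close> comes from here.\<close>

lemma mconv_Exp_bound_integrable:
  assumes [measurable]: "f \<in> borel_measurable borel" and f: "integrable lborel f"
  shows "\<bar>Exp.mconv f x\<bar> \<le> (LINT y|lborel. \<bar>f y\<bar>)"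
proof -
  have i: "integrable lborel (\<lambda>y. f (x - y))"
    using lborel_integrable_real_affine[OF f, of "-1" x] by simp
  have "\<bar>Exp.mconv f x\<bar> \<le> (LINT y|lborel. \<bar>exponential_density 1 y * f (x - y)\<bar>)"
    unfolding Exp.mconv_def by (subst Exp_integral) (auto intro!: integral_abs_bound)
  also have "\<dots> \<le> (LINT y|lborel. \<bar>f (x - y)\<bar>)"
  proof (rule integral_mono')
    show "integrable lborel (\<lambda>y. \<bar>f (x - y)\<bar>)" using i by simp
    show "\<bar>exponential_density 1 y * f (x - y)\<bar> \<le> \<bar>f (x - y)\<bar>" for y
      using exponential_density_bound[of y] by (simp add: abs_mult mult_left_le_one_le)
  qed simp
  also have "\<dots> = (LINT y|lborel. \<bar>f y\<bar>)"
    using lborel_integral_real_affine[of "-1" "\<lambda>y. \<bar>f y\<bar>" x] by simp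
  finally show ?thesis .
qed

lemma exp_half_line:
  assumes c: "Re c < 0"
  shows "set_integrable lborel {0<..} (\<lambda>x. exp (c * complex_of_real x))"
    and "(CLINT x:{0<..}|lborel. exp (c * complex_of_real x)) = - 1 / c"
proof -
  have nz: "c \<noteq> 0" using c by auto
  have norm_exp: "norm (exp (c * complex_of_real x)) = exp (Re c * x)" for x
    by (simp add: norm_exp_eq_Re)
  have "integrable lborel (\<lambda>x. exp (Re c * x) * indicator {0<..} x)"
    using nn_integral_exp_half_line[of "- Re c"] c by (intro integrableI_bounded) auto
  then show int: "set_integrable lborel {0<..} (\<lambda>x. exp (c * complex_of_real x))"
    unfolding set_integrable_def
    by (rule Bochner_Integration.integrable_bound) (auto simp: indicator_def norm_exp)
  then have int: "set_integrable lborel (einterval 0 \<infinity>) (\<lambda>x. exp (c * complex_of_real x))"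
    by (simp add: einterval_def greaterThan_def zero_ereal_def)
  have "(CLINT x:{0<..}|lborel. exp (c * complex_of_real x)) = (LBINT x=0..\<infinity>. exp (c * complex_of_real x))"
    using interval_integral_to_infinity_eq[where a=0 and f="\<lambda>x. exp (c * complex_of_real x)" and M=lborel]
    by (simp add: zero_ereal_def)
  also have "\<dots> = 0 - 1 / c"
  proof (rule interval_integral_FTC_integrable[where F="\<lambda>x. exp (c * complex_of_real x) / c"])
    show "((\<lambda>x. exp (c * complex_of_real x) / c) has_vector_derivative exp (c * complex_of_real x)) (at x)" for x
    proof -
      have "((\<lambda>w. exp (c * w) / c) has_field_derivative exp (c * complex_of_real x)) (at (complex_of_real x))"
        using nz by (auto intro!: derivative_eq_intros)
      then show ?thesis
        using has_vector_derivative_real_field by blast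
    qed
    show "isCont (\<lambda>x. exp (c * complex_of_real x)) x" for x
      by (intro continuous_intros)
    have "((\<lambda>x. exp (c * complex_of_real x) / c) \<longlongrightarrow> exp (c * complex_of_real 0) / c) (at_right 0)"
      using nz by (intro tendsto_intros)
    then show "(((\<lambda>x. exp (c * complex_of_real x) / c) \<circ> real_of_ereal) \<longlongrightarrow> 1 / c) (at_right 0)"
      unfolding zero_ereal_def by (simp add: ereal_tendsto_simps)
    have "((\<lambda>x. exp (c * complex_of_real x) / c) \<longlongrightarrow> 0) at_top"
    proof (rule tendsto_norm_zero_cancel)
      have "((\<lambda>x. exp (Re c * x) / norm c) \<longlongrightarrow> 0 / norm c) at_top"
        using nz c by (intro tendsto_divide tendsto_const)
          (auto intro!: filterlim_compose[OF exp_at_bot] filterlim_tendsto_neg_mult_at_bot[OF tendsto_const] filterlim_ident)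
      then show "((\<lambda>x. norm (exp (c * complex_of_real x) / c)) \<longlongrightarrow> 0) at_top"
        by (simp add: norm_divide norm_exp del: norm_exp_eq_Re)
    qed
    then show "(((\<lambda>x. exp (c * complex_of_real x) / c) \<circ> real_of_ereal) \<longlongrightarrow> 0) (at_left \<infinity>)"
      by (simp add: ereal_tendsto_simps)
  qed (auto intro: int)
  finally show "(CLINT x:{0<..}|lborel. exp (c * complex_of_real x)) = - 1 / c"
    by simp
qed

lemma char_Exp: "char Exp z = 1 / (1 - \<i> * z)"
proof -
  let ?c = "\<i> * complex_of_real z - 1"
  have nz: "1 - \<i> * complex_of_real z \<noteq> 0" "?c \<noteq> 0"
    by (simp_all add: complex_eq_iff)
  have "char Exp z = (CLINT x|lborel. exponential_density 1 x *\<^sub>R iexp (z * x))"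
    unfolding char_def by (rule Exp_integral) measurable
  also have "\<dots> = (CLINT x:{0<..}|lborel. exp (?c * complex_of_real x))"
    unfolding set_lebesgue_integral_def
  proof (rule integral_cong_AE)
    show "AE x in lborel. exponential_density 1 x *\<^sub>R iexp (z * x) = indicator {0<..} x *\<^sub>R exp (?c * complex_of_real x)"
      using AE_lborel_singleton[of "0::real"]
    proof eventually_elim
      case (elim x)
      have "complex_of_real (exp (- x)) * iexp (z * x) = exp (?c * complex_of_real x)"
        by (simp add: exp_of_real[symmetric] exp_add[symmetric] algebra_simps del: exp_of_real)
      then show ?case
        using elim by (simp add: exponential_density_def indicator_def scaleR_conv_of_real)
    qed
  qed measurable
  also have "\<dots> = 1 / (1 - \<i> * z)"
    using nz by (subst exp_half_line(2)) (simp_all add: field_simps)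
  finally show ?thesis .
qed

lemma measure_Exp_atMost: "measure Exp {..a} = (if a < 0 then 0 else 1 - exp (- a))"
  using emeasure_erlang_density[of 1 0 a] erlang_CDF_nonneg[of 1 0 a]
  by (simp add: measure_def erlang_CDF_def)

text \<open>\<open>Exp\<close> is the resolvent at 1 of the translation semigroup: it inverts \<open>1 - d/dx\<close>.\<close>

lemma Exp_resolvent:
  fixes \<phi> \<psi> :: "real \<Rightarrow> complex"
  assumes \<psi>: "integrable lborel \<psi>" and [measurable]: "\<phi> \<in> borel_measurable borel"
    and bound: "\<And>x. norm (\<phi> x) \<le> C"
    and \<psi>x: "integrable Exp (\<lambda>w. \<psi> (x + w))"
    and \<phi>: "\<And>x. \<phi> x = - (CLINT t:{x..}|lborel. \<psi> t)"
  shows "(CLINT w|Exp. \<phi> (x + w) - \<psi> (x + w)) = \<phi> x"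
proof -
  have [measurable]: "\<psi> \<in> borel_measurable borel"
    using \<psi> by simp
  let ?h = "\<lambda>t w. indicator {..t - x} w *\<^sub>R \<psi> t"
  have [measurable]: "(\<lambda>(t, w). ?h t w) \<in> borel_measurable (lborel \<Otimes>\<^sub>M Exp)"
  proof -
    have "(\<lambda>(t, w). (if w \<le> t - x then 1 else 0) *\<^sub>R \<psi> t) \<in> borel_measurable (lborel \<Otimes>\<^sub>M Exp)"
      by measurable
    then show ?thesis
      by (rule measurable_cong[THEN iffD1, rotated]) (auto simp: indicator_def)
  qed
  have h: "integrable (lborel \<Otimes>\<^sub>M Exp) (\<lambda>(t, w). ?h t w)"
  proof (rule integrableI_bounded)
    have "(\<integral>\<^sup>+p. ennreal (norm (case p of (t, w) \<Rightarrow> ?h t w)) \<partial>(lborel \<Otimes>\<^sub>M Exp)) =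
        (\<integral>\<^sup>+t. \<integral>\<^sup>+w. ennreal (norm (?h t w)) \<partial>Exp \<partial>lborel)"
      by (subst Exp.nn_integral_fst[symmetric]) auto
    also have "\<dots> \<le> (\<integral>\<^sup>+t. \<integral>\<^sup>+w. ennreal (norm (\<psi> t)) \<partial>Exp \<partial>lborel)"
      by (intro nn_integral_mono) (auto simp: indicator_def)
    also have "\<dots> < \<infinity>"
      using \<psi> emeasure_Exp by (simp add: integrable_iff_bounded)
    finally show "(\<integral>\<^sup>+p. ennreal (norm (case p of (t, w) \<Rightarrow> ?h t w)) \<partial>(lborel \<Otimes>\<^sub>M Exp)) < \<infinity>" .
  qed measurable
  have "(CLINT w|Exp. \<phi> (x + w)) = (CLINT w|Exp. - (CLINT t|lborel. ?h t w))"
    unfolding \<phi> set_lebesgue_integral_def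
    by (intro Bochner_Integration.integral_cong refl arg_cong[where f=uminus]) (auto simp: indicator_def)
  also have "\<dots> = - (CLINT t|lborel. CLINT w|Exp. ?h t w)"
    using Exp.P.Fubini_integral[OF h] by simp
  also have "\<dots> = - (CLINT t|lborel. (if t < x then 0 else 1 - exp (x - t)) *\<^sub>R \<psi> t)"
  proof -
    have "(CLINT w|Exp. ?h t w) = measure Exp {..t - x} *\<^sub>R \<psi> t" for t
      by (subst integral_scaleR_left) (auto simp: integrable_indicator_iff less_top[symmetric])
    then show ?thesis
      unfolding measure_Exp_atMost by (simp only: diff_less_0_iff_less minus_diff_eq)
  qed
  \<comment> \<open>For t >= x the weight 1 - exp(x - t) is the indicator minus the exponential
    density at t - x: the first part gives back \<open>\<phi> x\<close>, the second the average of
    \<open>\<psi>\<close>.\<close>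
  also have "\<dots> = - (CLINT t|lborel. indicator {x..} t *\<^sub>R \<psi> t - exponential_density 1 (t - x) *\<^sub>R \<psi> t)"
    by (intro arg_cong[where f=uminus] Bochner_Integration.integral_cong refl)
      (auto simp: indicator_def exponential_density_def scaleR_diff_left)
  also have "\<dots> = - ((CLINT t|lborel. indicator {x..} t *\<^sub>R \<psi> t) - (CLINT t|lborel. exponential_density 1 (t - x) *\<^sub>R \<psi> t))"
  proof (intro arg_cong[where f=uminus] Bochner_Integration.integral_diff)
    show "integrable lborel (\<lambda>t. indicator {x..} t *\<^sub>R \<psi> t)"
      by (rule Bochner_Integration.integrable_bound[OF \<psi>]) (auto simp: indicator_def)
    show "integrable lborel (\<lambda>t. exponential_density 1 (t - x) *\<^sub>R \<psi> t)"
      by (rule Bochner_Integration.integrable_bound[OF \<psi>])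
        (use exponential_density_bound in \<open>auto simp: mult_left_le_one_le\<close>)
  qed
  also have "(CLINT t|lborel. exponential_density 1 (t - x) *\<^sub>R \<psi> t) = (CLINT w|Exp. \<psi> (x + w))"
    by (subst Exp_integral, measurable, subst lborel_integral_translate[of _ x, symmetric]) simp
  finally have "(CLINT w|Exp. \<phi> (x + w)) = \<phi> x + (CLINT w|Exp. \<psi> (x + w))"
    unfolding \<phi>[of x] set_lebesgue_integral_def by simp
  moreover have "integrable Exp (\<lambda>w. \<phi> (x + w))"
    by (rule Exp.integrable_const_bound[where B=C]) (auto simp: bound)
  ultimately show ?thesis
    using \<psi>x by simp
qed

section \<open>The resolvent identity for the free process\<close>

context conv_measure
begin

lemma AE_mconv_nn:
  assumes "f \<in> borel_measurable borel" "integrable lborel f" "\<And>x. 0 \<le> f x"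
  shows "AE x in lborel. (\<integral>\<^sup>+y. ennreal (f (x - y)) \<partial>N) = ennreal (mconv f x)"
proof -
  note [measurable] = assms(1)
  have "(\<integral>\<^sup>+x. \<integral>\<^sup>+y. ennreal (f (x - y)) \<partial>N \<partial>lborel) = (\<integral>\<^sup>+x. \<integral>\<^sup>+y. ennreal (norm (1::complex)) * ennreal \<bar>f x\<bar> \<partial>N \<partial>lborel)"
    using nn_integral_shift_swap[of "\<lambda>_. 1" "\<lambda>x. ennreal (f x)"] assms(3) by simp
  also have "\<dots> < \<infinity>"
    using mconv_test_bounded[OF assms(1,2), of "\<lambda>_. 1" 1] by simp
  finally have "AE x in lborel. (\<integral>\<^sup>+y. ennreal (f (x - y)) \<partial>N) \<noteq> \<infinity>"
    by (intro nn_integral_noteq_infinite) auto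
  then show ?thesis
  proof eventually_elim
    case (elim x)
    have "mconv f x = enn2real (\<integral>\<^sup>+y. ennreal (f (x - y)) \<partial>N)"
      unfolding mconv_def by (rule integral_eq_nn_integral) (auto simp: assms(3))
    then show ?case
      using elim by (simp add: less_top)
  qed
qed

lemma mconv_nonneg: "(\<And>x. 0 \<le> f x) \<Longrightarrow> 0 \<le> mconv f x"
  unfolding mconv_def by simp

end

lemma integrable_bounded_mult:
  fixes \<phi> :: "real \<Rightarrow> complex"
  assumes [measurable]: "\<phi> \<in> borel_measurable borel" and "\<And>x. norm (\<phi> x) \<le> C" "integrable lborel f"
  shows "integrable lborel (\<lambda>x. \<phi> x * complex_of_real (f x))"
proof (rule Bochner_Integration.integrable_bound[where f="\<lambda>x. C * f x"])
  show "AE x in lborel. norm (\<phi> x * complex_of_real (f x)) \<le> norm (C * f x)"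
    using assms(2) by (auto simp: norm_mult abs_mult intro!: mult_right_mono order_trans[OF assms(2) abs_ge_self])
qed (use assms in auto)

text \<open>Neither factor has to be bounded: since the density of \<open>Exp\<close> is at most 1,
  the average of |f| is at most its integral, and the double integral is at most the product of the
  two L1 norms.\<close>

lemma Exp_mconv_test_integrable:
  fixes \<phi> :: "real \<Rightarrow> complex"
  assumes \<phi>: "integrable lborel \<phi>" and f: "f \<in> borel_measurable borel" "integrable lborel f"
  shows "(\<integral>\<^sup>+x. \<integral>\<^sup>+y. ennreal (norm (\<phi> (x + y))) * ennreal \<bar>f x\<bar> \<partial>Exp \<partial>lborel) < \<infinity>"
proof -
  have [measurable]: "\<phi> \<in> borel_measurable borel" "f \<in> borel_measurable borel"
    using \<phi> f by auto
  have le: "(\<integral>\<^sup>+y. ennreal \<bar>f (x - y)\<bar> \<partial>Exp) \<le> (\<integral>\<^sup>+y. ennreal \<bar>f y\<bar> \<partial>lborel)" for x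
  proof -
    have "(\<integral>\<^sup>+y. ennreal \<bar>f (x - y)\<bar> \<partial>Exp) = (\<integral>\<^sup>+y. ennreal (exponential_density 1 y) * ennreal \<bar>f (x - y)\<bar> \<partial>lborel)"
      by (rule nn_integral_density) measurable
    also have "\<dots> \<le> (\<integral>\<^sup>+y. 1 * ennreal \<bar>f (x - y)\<bar> \<partial>lborel)"
      using exponential_density_bound by (intro nn_integral_mono mult_right_mono) auto
    also have "\<dots> = (\<integral>\<^sup>+y. ennreal \<bar>f y\<bar> \<partial>lborel)"
      using nn_integral_reflect[of "\<lambda>y. ennreal \<bar>f y\<bar>" x] by simp
    finally show ?thesis .
  qed
  have "(\<integral>\<^sup>+x. \<integral>\<^sup>+y. ennreal (norm (\<phi> (x + y))) * ennreal \<bar>f x\<bar> \<partial>Exp \<partial>lborel) =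
      (\<integral>\<^sup>+x. \<integral>\<^sup>+y. ennreal (norm (\<phi> x)) * ennreal \<bar>f (x - y)\<bar> \<partial>Exp \<partial>lborel)"
    by (rule Exp.nn_integral_shift_swap[symmetric]) measurable
  also have "\<dots> = (\<integral>\<^sup>+x. ennreal (norm (\<phi> x)) * (\<integral>\<^sup>+y. ennreal \<bar>f (x - y)\<bar> \<partial>Exp) \<partial>lborel)"
    by (intro nn_integral_cong nn_integral_cmult) measurable
  also have "\<dots> \<le> (\<integral>\<^sup>+x. ennreal (norm (\<phi> x)) * (\<integral>\<^sup>+y. ennreal \<bar>f y\<bar> \<partial>lborel) \<partial>lborel)"
    by (intro nn_integral_mono mult_left_mono le) auto
  also have "\<dots> = (\<integral>\<^sup>+x. ennreal (norm (\<phi> x)) \<partial>lborel) * (\<integral>\<^sup>+y. ennreal \<bar>f y\<bar> \<partial>lborel)"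
    by (rule nn_integral_multc) measurable
  also have "\<dots> < \<infinity>"
    using \<phi> f by (auto simp: integrable_iff_bounded ennreal_mult_less_top)
  finally show ?thesis .
qed

text \<open>The last two conditions express \<open>F1 = F'\<close> and \<open>F2 = F1'\<close> in integrated form.\<close>

definition exp_test :: "real \<Rightarrow> (real \<Rightarrow> complex) \<Rightarrow> (real \<Rightarrow> complex) \<Rightarrow> (real \<Rightarrow> complex) \<Rightarrow> bool" where
  "exp_test C F F1 F2 \<longleftrightarrow>
     integrable lborel F \<and> integrable lborel F1 \<and> integrable lborel F2 \<and>
     (\<forall>x. norm (F x) \<le> C) \<and> (\<forall>x. norm (F1 x) \<le> C) \<and>
     (\<forall>x. (CLINT w|Exp. F (x + w) - F1 (x + w)) = F x) \<and>
     (\<forall>x. (CLINT w|Exp. F1 (x + w) - F2 (x + w)) = F1 x)"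

lemma integrable_translate:
  fixes f :: "real \<Rightarrow> 'b::{banach, second_countable_topology}"
  shows "integrable lborel f \<Longrightarrow> integrable lborel (\<lambda>x. f (c + x))"
  using lborel_integrable_real_affine[of f 1 c] by simp

lemma exp_test_translate:
  assumes "exp_test C F F1 F2"
  shows "exp_test C (\<lambda>x. F (c + x)) (\<lambda>x. F1 (c + x)) (\<lambda>x. F2 (c + x))"
  using assms by (auto simp: exp_test_def integrable_translate add.assoc[symmetric])

lemma integrable_Exp:
  fixes f :: "real \<Rightarrow> complex"
  assumes "integrable lborel f"
  shows "integrable Exp (\<lambda>w. f (x + w))"
proof -
  have [measurable]: "f \<in> borel_measurable borel" using assms by auto
  show ?thesis
  proof (subst integrable_density)
    show "integrable lborel (\<lambda>w. exponential_density 1 w *\<^sub>R f (x + w))"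
      by (rule Bochner_Integration.integrable_bound[OF integrable_translate[OF assms, of x]])
        (use exponential_density_bound in \<open>auto simp: mult_left_le_one_le\<close>)
  qed (auto simp: exponential_density_bound)
qed

text \<open>\<open>fourier_g\<close> says that the transform of \<open>g\<close> is 1/(s +
  exponent). The exponent is written with two finite measures: z^2 times the transform of
  \<open>K\<close> stands for the compensated small jumps, which thereby act on F'', and
  \<open>J\<close> carries the large jumps.\<close>

locale resolvent_density = K: conv_measure K + J: conv_measure J
  for K J :: "real measure" +
  fixes g :: "real \<Rightarrow> real" and A \<gamma> s :: real
  assumes g_meas [measurable]: "g \<in> borel_measurable borel" and g_int: "integrable lborel g"
    and g_nonneg: "0 \<le> g x" and A_nonneg: "0 \<le> A" and s_nonneg: "0 \<le> s"
    and fourier_g: "fourier g z * (s + A / 2 * z\<^sup>2 - \<i> * \<gamma> * z + z\<^sup>2 * char K z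
      + measure J UNIV - char J z) = 1"
begin

definition H :: "real \<Rightarrow> real" where
  "H x = A / 2 * g x + K.mconv g x"

text \<open>Divided by \<open>(1 - i z)\<^sup>2\<close>, the equation \<open>fourier_g\<close> becomes \<open>H = - m * Exp\<close> with integrable \<open>m\<close>,
  whence \<open>H\<close> is bounded.\<close>

definition m1 :: "real \<Rightarrow> real" where
  "m1 x = (\<gamma> - s - measure J UNIV) * g x + J.mconv g x + H x"

text \<open>With a = 1 - i z one has i z = 1 - a and z^2 = -(1 - a)^2. Sorting
  \<open>fourier_g\<close> by powers of a gives, for the transforms, a^2 H = -(1 + m1 + a m2):
  \<open>m1\<close> collects the terms of order 0, \<open>m2\<close> those of order 1. After
  division by a^2, one factor 1/a stays outside and the rest is \<open>m\<close>.\<close>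

definition m2 :: "real \<Rightarrow> real" where
  "m2 x = (-2) * H x + (- \<gamma>) * g x"

definition m :: "real \<Rightarrow> real" where
  "m x = exponential_density 1 x + Exp.mconv m1 x + m2 x"

lemma measurable_Hm [measurable]:
  "H \<in> borel_measurable borel" "m1 \<in> borel_measurable borel"
  "m2 \<in> borel_measurable borel" "m \<in> borel_measurable borel"
proof -
  show [measurable]: "H \<in> borel_measurable borel"
    unfolding H_def[abs_def] by measurable
  show [measurable]: "m1 \<in> borel_measurable borel"
    unfolding m1_def[abs_def] by measurable
  show [measurable]: "m2 \<in> borel_measurable borel"
    unfolding m2_def[abs_def] by measurable
  show "m \<in> borel_measurable borel"
    unfolding m_def[abs_def] by measurable
qed

lemma int_Kg: "integrable lborel (K.mconv g)"
  by (rule K.integrable_mconv[OF g_meas g_int])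

lemma int_Jg: "integrable lborel (J.mconv g)"
  by (rule J.integrable_mconv[OF g_meas g_int])

lemma integrable_H: "integrable lborel H"
  unfolding H_def[abs_def] using g_int int_Kg by auto

lemma integrable_m1: "integrable lborel m1"
  unfolding m1_def[abs_def] using g_int integrable_H int_Jg by auto

lemma integrable_m2: "integrable lborel m2"
  unfolding m2_def[abs_def] using g_int integrable_H by auto

lemma integrable_m: "integrable lborel m"
  unfolding m_def[abs_def]
  using integrable_exponential_density integrable_m2 Exp.integrable_mconv[OF _ integrable_m1] by auto

lemma fourier_exponential: "fourier (exponential_density 1) z = 1 / (1 - \<i> * z)"
  unfolding char_Exp[symmetric] char_def fourier_def
  by (subst Exp_integral) (auto simp: scaleR_conv_of_real mult.commute)

text \<open>Both sides are integrable, so comparing transforms is enough. Multiplied by (1 - i z)^2,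
  which never vanishes, the transform of H + Exp * m becomes 1 minus the left side of
  \<open>fourier_g\<close>.\<close>

lemma H_eq: "AE x in lborel. H x = - Exp.mconv m x"
proof -
  have int: "integrable lborel (Exp.mconv m)"
    by (intro Exp.integrable_mconv integrable_m) measurable
  have "fourier (\<lambda>x. H x + Exp.mconv m x) z = 0" for z
  proof -
    let ?a = "1 - \<i> * complex_of_real z" and ?G = "fourier g z"
    have a: "?a \<noteq> 0" by (simp add: complex_eq_iff)
    have H: "fourier H z = ?G * (A / 2 + char K z)"
    proof -
      have "fourier H z = fourier (\<lambda>x. A / 2 * g x) z + fourier (K.mconv g) z"
        unfolding H_def[abs_def] using g_int int_Kg by (intro fourier_add) auto
      then show ?thesis
        unfolding fourier_cmult by (simp add: K.fourier_mconv g_int algebra_simps)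
    qed
    have m1: "fourier m1 z = (\<gamma> - s - measure J UNIV) * ?G + ?G * char J z + fourier H z"
      unfolding m1_def[abs_def] using g_int int_Jg integrable_H
      by (simp add: fourier_add fourier_cmult J.fourier_mconv)
    have m2: "fourier m2 z = -2 * fourier H z - \<gamma> * ?G"
    proof -
      have "fourier m2 z = fourier (\<lambda>x. (-2) * H x) z + fourier (\<lambda>x. (- \<gamma>) * g x) z"
        unfolding m2_def[abs_def] using g_int integrable_H by (intro fourier_add) auto
      then show ?thesis
        unfolding fourier_cmult by simp
    qed
    have m: "fourier m z = 1 / ?a + fourier m1 z * (1 / ?a) + fourier m2 z"
      unfolding m_def[abs_def]
      using integrable_exponential_density integrable_m2 Exp.integrable_mconv[OF _ integrable_m1] integrable_m1
      by (simp add: fourier_add Exp.fourier_mconv char_Exp fourier_exponential)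
    have "?a\<^sup>2 * (fourier H z + fourier m z * (1 / ?a)) =
        ?a\<^sup>2 * fourier H z + 1 + fourier m1 z + ?a * fourier m2 z"
    proof -
      have "b\<^sup>2 * (h + (1 / b + p * (1 / b) + q) * (1 / b)) = b\<^sup>2 * h + 1 + p + b * q"
        if "b \<noteq> 0" for b h p q :: complex
        using that by (simp add: field_simps power2_eq_square)
      from this[OF a] show ?thesis
        unfolding m .
    qed
    also have "\<dots> = 1 - ?G * (s + A / 2 * z\<^sup>2 - \<i> * \<gamma> * z + z\<^sup>2 * char K z + measure J UNIV - char J z)"
      unfolding m1 m2 H by (simp add: power2_eq_square algebra_simps)
    also have "\<dots> = 0"
      using fourier_g[of z] by (simp add: algebra_simps)
    finally show ?thesis
      using a integrable_H int integrable_m by (simp add: fourier_add Exp.fourier_mconv char_Exp)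
  qed
  then have "AE x in lborel. H x + Exp.mconv m x = 0"
    using integrable_H int by (intro fourier_unique) auto
  then show ?thesis
    by eventually_elim simp
qed

definition Hbound :: real where "Hbound = (LINT x|lborel. \<bar>m x\<bar>)"

lemma H_bounded: "AE x in lborel. H x \<le> Hbound"
  using H_eq
  by eventually_elim (use mconv_Exp_bound_integrable[OF _ integrable_m] in \<open>force simp: Hbound_def abs_le_iff\<close>)

text \<open>The resolvent equation itself controls \<open>L F\<close> for a merely integrable \<open>F''\<close>.\<close>

lemma second_order_bound:
  assumes [measurable]: "q \<in> borel_measurable borel"
  shows "(\<integral>\<^sup>+x. ennreal (g x) * (ennreal (A / 2) * q x + (\<integral>\<^sup>+v. q (x + v) \<partial>K)) \<partial>lborel)
    \<le> ennreal Hbound * (\<integral>\<^sup>+x. q x \<partial>lborel)"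
proof -
  have pointwise: "ennreal (g x) * (ennreal (A / 2) * q x + (\<integral>\<^sup>+v. q (x + v) \<partial>K)) =
      q x * ennreal (A / 2 * g x) + (\<integral>\<^sup>+v. q (x + v) * ennreal (g x) \<partial>K)" for x
  proof -
    have "ennreal (A / 2 * g x) = ennreal (A / 2) * ennreal (g x)"
      using A_nonneg g_nonneg by (intro ennreal_mult) auto
    then show ?thesis
      by (simp only: nn_integral_multc measurable_compose[OF _ assms] distrib_left mult_ac)
        (simp add: nn_integral_cmult)
  qed
  have "(\<integral>\<^sup>+x. ennreal (g x) * (ennreal (A / 2) * q x + (\<integral>\<^sup>+v. q (x + v) \<partial>K)) \<partial>lborel) =
      (\<integral>\<^sup>+x. q x * ennreal (A / 2 * g x) \<partial>lborel) + (\<integral>\<^sup>+x. \<integral>\<^sup>+v. q (x + v) * ennreal (g x) \<partial>K \<partial>lborel)"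
    unfolding pointwise by (rule nn_integral_add) measurable
  also have "(\<integral>\<^sup>+x. \<integral>\<^sup>+v. q (x + v) * ennreal (g x) \<partial>K \<partial>lborel) = (\<integral>\<^sup>+x. \<integral>\<^sup>+v. q x * ennreal (g (x - v)) \<partial>K \<partial>lborel)"
    by (rule K.nn_integral_shift_swap[symmetric]) measurable
  also have "\<dots> = (\<integral>\<^sup>+x. q x * ennreal (K.mconv g x) \<partial>lborel)"
  proof (rule nn_integral_cong_AE)
    show "AE x in lborel. (\<integral>\<^sup>+v. q x * ennreal (g (x - v)) \<partial>K) = q x * ennreal (K.mconv g x)"
      using K.AE_mconv_nn[OF g_meas g_int g_nonneg] by eventually_elim (simp add: nn_integral_cmult)
  qed
  also have "(\<integral>\<^sup>+x. q x * ennreal (A / 2 * g x) \<partial>lborel) + (\<integral>\<^sup>+x. q x * ennreal (K.mconv g x) \<partial>lborel) =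
      (\<integral>\<^sup>+x. q x * ennreal (H x) \<partial>lborel)"
    using A_nonneg g_nonneg K.mconv_nonneg[OF g_nonneg]
    by (subst nn_integral_add[symmetric]) (auto intro!: nn_integral_cong simp: H_def distrib_left)
  also have "\<dots> \<le> (\<integral>\<^sup>+x. q x * ennreal Hbound \<partial>lborel)"
    by (rule nn_integral_mono_AE) (use H_bounded in \<open>eventually_elim, auto intro!: mult_left_mono ennreal_leI\<close>)
  also have "\<dots> = ennreal Hbound * (\<integral>\<^sup>+x. q x \<partial>lborel)"
    by (simp add: nn_integral_multc mult.commute)
  finally show ?thesis .
qed

text \<open>This is (s - L) F with the jump integral expressed through \<open>K\<close> and
  \<open>J\<close>. \<open>F1\<close> and \<open>F2\<close> are separate arguments because F''
  exists only almost everywhere and is known through integrals.\<close>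

definition resolvent_op ::
  "(real \<Rightarrow> complex) \<Rightarrow> (real \<Rightarrow> complex) \<Rightarrow> (real \<Rightarrow> complex) \<Rightarrow> real \<Rightarrow> complex" where
  "resolvent_op F F1 F2 x = of_real s * F x - (of_real (A / 2) * F2 x + of_real \<gamma> * F1 x
     + (CLINT v|K. F2 (x + v)) + ((CLINT y|J. F (x + y)) - of_real (measure J UNIV) * F x))"

lemma resolvent_op_translate:
  "resolvent_op (\<lambda>x. F (c + x)) (\<lambda>x. F1 (c + x)) (\<lambda>x. F2 (c + x)) x = resolvent_op F F1 F2 (c + x)"
  by (simp add: resolvent_op_def add.assoc)

context
  fixes F F1 F2 :: "real \<Rightarrow> complex" and C :: real
  assumes test: "exp_test C F F1 F2"
begin

lemma intF: "integrable lborel F" "integrable lborel F1" "integrable lborel F2"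
  and boundF: "norm (F x) \<le> C" "norm (F1 x) \<le> C"
  and ExpF: "(CLINT w|Exp. F (x + w) - F1 (x + w)) = F x" "(CLINT w|Exp. F1 (x + w) - F2 (x + w)) = F1 x"
  using test by (auto simp: exp_test_def)

lemma measF [measurable]: "F \<in> borel_measurable borel" "F1 \<in> borel_measurable borel" "F2 \<in> borel_measurable borel"
  using intF by auto

lemma F2_bound: "(\<integral>\<^sup>+x. ennreal (g x) * (ennreal (A / 2) * ennreal (norm (F2 x))
    + (\<integral>\<^sup>+v. ennreal (norm (F2 (x + v))) \<partial>K)) \<partial>lborel) < \<infinity>"
proof -
  have "(\<integral>\<^sup>+x. ennreal (norm (F2 x)) \<partial>lborel) < \<infinity>"
    using intF(3) by (simp add: integrable_iff_bounded)
  then have "ennreal Hbound * (\<integral>\<^sup>+x. ennreal (norm (F2 x)) \<partial>lborel) < \<infinity>"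
    by (simp add: ennreal_mult_less_top)
  then show ?thesis
    using second_order_bound[of "\<lambda>x. ennreal (norm (F2 x))"] by (auto intro: le_less_trans)
qed

lemma F2_fin: "(\<integral>\<^sup>+x. \<integral>\<^sup>+v. ennreal (norm (F2 (x + v))) * ennreal \<bar>g x\<bar> \<partial>K \<partial>lborel) < \<infinity>"
proof -
  have "(\<integral>\<^sup>+x. \<integral>\<^sup>+v. ennreal (norm (F2 (x + v))) * ennreal \<bar>g x\<bar> \<partial>K \<partial>lborel) \<le>
     (\<integral>\<^sup>+x. ennreal (g x) * (ennreal (A / 2) * ennreal (norm (F2 x))
    + (\<integral>\<^sup>+v. ennreal (norm (F2 (x + v))) \<partial>K)) \<partial>lborel)"
    using g_nonneg by (intro nn_integral_mono) (auto simp: nn_integral_cmult distrib_left mult.commute)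
  then show ?thesis
    using F2_bound by (rule le_less_trans)
qed

lemma F2_Ag: "integrable lborel (\<lambda>x. F2 x * complex_of_real (A / 2 * g x))"
proof (rule integrableI_bounded)
  have "(\<integral>\<^sup>+x. ennreal (norm (F2 x * complex_of_real (A / 2 * g x))) \<partial>lborel) \<le>
     (\<integral>\<^sup>+x. ennreal (g x) * (ennreal (A / 2) * ennreal (norm (F2 x))
    + (\<integral>\<^sup>+v. ennreal (norm (F2 (x + v))) \<partial>K)) \<partial>lborel)"
    using g_nonneg A_nonneg
    by (intro nn_integral_mono) (auto simp: norm_mult distrib_left mult_ac ennreal_mult[symmetric] simp flip: of_real_mult)
  then show "(\<integral>\<^sup>+x. ennreal (norm (F2 x * complex_of_real (A / 2 * g x))) \<partial>lborel) < \<infinity>"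
    using F2_bound by (rule le_less_trans)
qed measurable

lemmas F2_K = K.mconv_test[OF measF(3) g_meas F2_fin]

lemmas F_J = J.mconv_test[OF measF(1) g_meas J.mconv_test_bounded[OF g_meas g_int measF(1) boundF(1)]]

lemma F2_H: "integrable lborel (\<lambda>x. F2 x * complex_of_real (H x))"
  "(CLINT x|lborel. F2 x * complex_of_real (H x)) =
    (CLINT x|lborel. F2 x * complex_of_real (A / 2 * g x)) + (CLINT x|lborel. F2 x * complex_of_real (K.mconv g x))"
proof -
  have eq: "F2 x * complex_of_real (H x) = F2 x * complex_of_real (A / 2 * g x) + F2 x * complex_of_real (K.mconv g x)" for x
    by (simp add: H_def distrib_left)
  show "integrable lborel (\<lambda>x. F2 x * complex_of_real (H x))"
    unfolding eq using F2_Ag F2_K(1) by (rule Bochner_Integration.integrable_add)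
  show "(CLINT x|lborel. F2 x * complex_of_real (H x)) =
    (CLINT x|lborel. F2 x * complex_of_real (A / 2 * g x)) + (CLINT x|lborel. F2 x * complex_of_real (K.mconv g x))"
    unfolding eq using F2_Ag F2_K(1) by (rule Bochner_Integration.integral_add)
qed

text \<open>The weak form of the resolvent equation. \<open>H_eq\<close> is tested against T = F - 2
  F' + F'', that is (1 - d/dx)^2 F; averaging T under \<open>Exp\<close> gives F - F', and averaging
  once more gives F. Of the three terms of \<open>m\<close>, the exponential density paired with F -
  F' produces F 0, \<open>Exp.mconv m1\<close> produces the integral of F m1, and \<open>m2\<close>
  stays paired with F - F'.\<close>

lemma F2_H_eq: "(CLINT x|lborel. F2 x * complex_of_real (H x)) =
  (CLINT x|lborel. of_real (s + measure J UNIV) * (F x * complex_of_real (g x)) - F x * complex_of_real (J.mconv g x)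
     - of_real \<gamma> * (F1 x * complex_of_real (g x))) - F 0"
proof -
  let ?T = "\<lambda>x. F x - 2 * F1 x + F2 x"
  have iT: "integrable lborel ?T"
    using intF by auto
  have ExpT: "(CLINT w|Exp. ?T (x + w)) = F x - F1 x" for x
  proof -
    have "(CLINT w|Exp. ?T (x + w)) = (CLINT w|Exp. (F (x + w) - F1 (x + w)) - (F1 (x + w) - F2 (x + w)))"
      by (intro Bochner_Integration.integral_cong refl) simp
    also have "\<dots> = F x - F1 x"
      using intF by (subst Bochner_Integration.integral_diff) (auto simp: integrable_Exp ExpF)
    finally show ?thesis .
  qed
  have bD: "norm (F x - F1 x) \<le> 2 * C" for x
    using norm_triangle_ineq4[of "F x" "F1 x"] boundF[of x] by simp
  note T = Exp.mconv_test[OF _ _ Exp_mconv_test_integrable[OF iT _ integrable_m]]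
  have T1: "integrable lborel (\<lambda>x. ?T x * complex_of_real (Exp.mconv m x))"
    by (rule T(1)) measurable
  have T3: "(CLINT x|lborel. ?T x * complex_of_real (Exp.mconv m x)) = (CLINT x|lborel. complex_of_real (m x) * (F x - F1 x))"
    by (subst T(3)) (simp_all add: ExpT)
  have iD: "integrable lborel (\<lambda>x. (F x - F1 x) * complex_of_real (f x))" if "integrable lborel f" for f
    by (rule integrable_bounded_mult[OF _ bD that]) measurable
  have iF: "integrable lborel (\<lambda>x. F x * complex_of_real (f x))" if "integrable lborel f" for f
    by (rule integrable_bounded_mult[OF _ boundF(1) that]) measurable
  have iF1: "integrable lborel (\<lambda>x. F1 x * complex_of_real (f x))" if "integrable lborel f" for f
    by (rule integrable_bounded_mult[OF _ boundF(2) that]) measurable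
  have int_m1c: "integrable lborel (Exp.mconv m1)"
    by (intro Exp.integrable_mconv integrable_m1) measurable
  have e: "(CLINT x|lborel. (F x - F1 x) * complex_of_real (exponential_density 1 x)) = F 0"
    using ExpF(1)[of 0] by (subst (asm) Exp_integral) (auto simp: scaleR_conv_of_real mult.commute)
  have m1: "(CLINT x|lborel. (F x - F1 x) * complex_of_real (Exp.mconv m1 x)) = (CLINT x|lborel. F x * complex_of_real (m1 x))"
    using Exp.mconv_test(3)[of "\<lambda>x. F x - F1 x" m1, OF _ _ Exp.mconv_test_bounded[OF _ integrable_m1 _ bD]]
    by (simp add: ExpF mult.commute)
  have "(CLINT x|lborel. complex_of_real (m x) * (F x - F1 x)) =
      (CLINT x|lborel. (F x - F1 x) * complex_of_real (exponential_density 1 x)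
        + (F x - F1 x) * complex_of_real (Exp.mconv m1 x) + (F x - F1 x) * complex_of_real (m2 x))"
    by (intro Bochner_Integration.integral_cong refl) (simp add: m_def algebra_simps)
  also have "\<dots> = F 0 + (CLINT x|lborel. F x * complex_of_real (m1 x)) + (CLINT x|lborel. (F x - F1 x) * complex_of_real (m2 x))"
    using iD[OF integrable_exponential_density] iD[OF int_m1c] iD[OF integrable_m2] e m1 by simp
  finally have mD: "(CLINT x|lborel. complex_of_real (m x) * (F x - F1 x)) =
      F 0 + (CLINT x|lborel. F x * complex_of_real (m1 x)) + (CLINT x|lborel. (F x - F1 x) * complex_of_real (m2 x))" .
  have TH: "(CLINT x|lborel. ?T x * complex_of_real (H x)) = - (CLINT x|lborel. ?T x * complex_of_real (Exp.mconv m x))"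
  proof -
    have "(CLINT x|lborel. ?T x * complex_of_real (H x)) = (CLINT x|lborel. - (?T x * complex_of_real (Exp.mconv m x)))"
      by (rule integral_cong_AE) (measurable, use H_eq in \<open>eventually_elim, simp\<close>)
    then show ?thesis by simp
  qed
  have "(CLINT x|lborel. ?T x * complex_of_real (H x)) =
      (CLINT x|lborel. F x * complex_of_real (H x)) - 2 * (CLINT x|lborel. F1 x * complex_of_real (H x))
      + (CLINT x|lborel. F2 x * complex_of_real (H x))"
  proof -
    have "(CLINT x|lborel. ?T x * complex_of_real (H x)) =
      (CLINT x|lborel. F x * complex_of_real (H x) - 2 * (F1 x * complex_of_real (H x)) + F2 x * complex_of_real (H x))"
      by (intro Bochner_Integration.integral_cong refl) (simp add: algebra_simps)
    then show ?thesis
      using iF[OF integrable_H] iF1[OF integrable_H] F2_H(1) by simp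
  qed
  then have "(CLINT x|lborel. F2 x * complex_of_real (H x)) =
     - (CLINT x|lborel. F x * complex_of_real (H x)) + 2 * (CLINT x|lborel. F1 x * complex_of_real (H x))
     - F 0 - (CLINT x|lborel. F x * complex_of_real (m1 x)) - (CLINT x|lborel. (F x - F1 x) * complex_of_real (m2 x))"
    unfolding TH T3 mD by (simp add: algebra_simps)
  also have "\<dots> = (CLINT x|lborel. - (F x * complex_of_real (H x)) + 2 * (F1 x * complex_of_real (H x))
      - F x * complex_of_real (m1 x) - (F x - F1 x) * complex_of_real (m2 x)) - F 0"
    using iF[OF integrable_H] iF1[OF integrable_H] iF[OF integrable_m1] iD[OF integrable_m2] by simp
  also have "(CLINT x|lborel. - (F x * complex_of_real (H x)) + 2 * (F1 x * complex_of_real (H x))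
      - F x * complex_of_real (m1 x) - (F x - F1 x) * complex_of_real (m2 x)) =
      (CLINT x|lborel. of_real (s + measure J UNIV) * (F x * complex_of_real (g x)) - F x * complex_of_real (J.mconv g x)
     - of_real \<gamma> * (F1 x * complex_of_real (g x)))"
    by (intro Bochner_Integration.integral_cong refl) (simp add: m1_def m2_def algebra_simps)
  finally show ?thesis .
qed

text \<open>Adjointness moves \<open>K\<close> and \<open>J\<close> from \<open>g\<close> to the
  test functions; what remains is \<open>F2_H_eq\<close>.\<close>

lemma resolvent_identity:
  "integrable lborel (\<lambda>x. complex_of_real (g x) * resolvent_op F F1 F2 x)"
  "(CLINT x|lborel. complex_of_real (g x) * resolvent_op F F1 F2 x) = F 0"
proof -
  have iF: "integrable lborel (\<lambda>x. F x * complex_of_real (f x))" if "integrable lborel f" for f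
    by (rule integrable_bounded_mult[OF _ boundF(1) that]) measurable
  have iF1: "integrable lborel (\<lambda>x. F1 x * complex_of_real (f x))" if "integrable lborel f" for f
    by (rule integrable_bounded_mult[OF _ boundF(2) that]) measurable
  let ?a = "\<lambda>x. of_real (s + measure J UNIV) * (F x * complex_of_real (g x))"
  let ?b = "\<lambda>x. complex_of_real (g x) * (CLINT y|J. F (x + y))"
  let ?b' = "\<lambda>x. F x * complex_of_real (J.mconv g x)"
  let ?c = "\<lambda>x. of_real \<gamma> * (F1 x * complex_of_real (g x))"
  let ?d = "\<lambda>x. F2 x * complex_of_real (A / 2 * g x)"
  let ?e = "\<lambda>x. complex_of_real (g x) * (CLINT v|K. F2 (x + v))"
  have eq: "complex_of_real (g x) * resolvent_op F F1 F2 x = ?a x - ?b x - ?c x - ?d x - ?e x" for x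
    by (simp add: resolvent_op_def algebra_simps)
  have ints: "integrable lborel ?a" "integrable lborel ?b" "integrable lborel ?b'" "integrable lborel ?c"
    "integrable lborel ?d" "integrable lborel ?e"
    using iF[OF g_int] iF1[OF g_int] F2_Ag F2_K(2) F_J(1,2) by auto
  show "integrable lborel (\<lambda>x. complex_of_real (g x) * resolvent_op F F1 F2 x)"
    unfolding eq using ints by (intro Bochner_Integration.integrable_diff)
  have "(CLINT x|lborel. complex_of_real (g x) * resolvent_op F F1 F2 x) =
     integral\<^sup>L lborel ?a - integral\<^sup>L lborel ?b - integral\<^sup>L lborel ?c - integral\<^sup>L lborel ?d - integral\<^sup>L lborel ?e"
    unfolding eq using ints
    by (simp only: Bochner_Integration.integral_diff Bochner_Integration.integrable_diff)
  also have "\<dots> = F 0"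
  proof -
    have "(CLINT x|lborel. ?a x - ?b' x - ?c x) = integral\<^sup>L lborel ?a - integral\<^sup>L lborel ?b' - integral\<^sup>L lborel ?c"
      using ints by (simp only: Bochner_Integration.integral_diff Bochner_Integration.integrable_diff)
    then show ?thesis
      using F2_H_eq F2_H(2) F2_K(3) F_J(3) by (simp only:) (simp add: algebra_simps)
  qed
  finally show "(CLINT x|lborel. complex_of_real (g x) * resolvent_op F F1 F2 x) = F 0" .
qed

text \<open>If the \<open>K\<close>-integral of |F2| diverges, the right side is infinite. Otherwise
  the triangle inequality applies; the mass of \<open>J\<close> counts twice, for the average of F
  and for the subtracted multiple of F.\<close>

lemma resolvent_op_bound:
  "ennreal (norm (resolvent_op F F1 F2 x)) \<le> ennreal ((s + 2 * measure J UNIV + \<bar>\<gamma>\<bar>) * C)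
    + (ennreal (A / 2) * ennreal (norm (F2 x)) + (\<integral>\<^sup>+v. ennreal (norm (F2 (x + v))) \<partial>K))"
proof (cases "(\<integral>\<^sup>+v. ennreal (norm (F2 (x + v))) \<partial>K) < \<infinity>")
  case True
  then obtain k where k: "(\<integral>\<^sup>+v. ennreal (norm (F2 (x + v))) \<partial>K) = ennreal k" "0 \<le> k"
    by (cases "\<integral>\<^sup>+v. ennreal (norm (F2 (x + v))) \<partial>K") auto
  have "integrable K (\<lambda>v. F2 (x + v))"
    using True by (intro integrableI_bounded) auto
  then have "ennreal (norm (CLINT v|K. F2 (x + v))) \<le> ennreal k"
    unfolding k(1)[symmetric] by (rule integral_norm_bound_ennreal)
  then have K: "norm (CLINT v|K. F2 (x + v)) \<le> k"
    using k by simp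
  have J: "norm (CLINT y|J. F (x + y)) \<le> measure J UNIV * C"
  proof -
    have "0 \<le> C"
      using boundF(1)[of 0] norm_ge_zero order_trans by blast
    then have "norm (CLINT y|J. F (x + y)) \<le> (LINT y|J. C)"
      by (intro Bochner_Integration.integral_norm_bound_integral J.integrable_const_bound[where B=C])
        (auto simp: boundF)
    then show ?thesis by simp
  qed
  have triangle: "norm (a - (b + c + k + (j - f))) \<le> norm a + norm b + norm c + norm k + norm j + norm f"
    for a b c k j f :: complex
    using norm_triangle_ineq4[of a "b + c + k + (j - f)"] norm_triangle_ineq[of "b + c + k" "j - f"]
      norm_triangle_ineq[of "b + c" k] norm_triangle_ineq[of b c] norm_triangle_ineq4[of j f]
    by linarith
  have "norm (resolvent_op F F1 F2 x) \<le> norm (of_real s * F x) + norm (of_real (A / 2) * F2 x)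
      + norm (of_real \<gamma> * F1 x) + norm (CLINT v|K. F2 (x + v)) + norm (CLINT y|J. F (x + y))
      + norm (of_real (measure J UNIV) * F x)"
    unfolding resolvent_op_def by (rule triangle)
  also have "\<dots> \<le> s * C + A / 2 * norm (F2 x) + \<bar>\<gamma>\<bar> * C + k + measure J UNIV * C + measure J UNIV * C"
    using A_nonneg s_nonneg boundF[of x]
    by (intro add_mono K J) (auto simp: norm_mult intro!: mult_left_mono)
  also have "\<dots> = (s + 2 * measure J UNIV + \<bar>\<gamma>\<bar>) * C + (A / 2 * norm (F2 x) + k)"
    by (simp add: algebra_simps)
  finally have "ennreal (norm (resolvent_op F F1 F2 x)) \<le> ennreal ((s + 2 * measure J UNIV + \<bar>\<gamma>\<bar>) * C + (A / 2 * norm (F2 x) + k))"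
    by (rule ennreal_leI)
  also have "\<dots> = ennreal ((s + 2 * measure J UNIV + \<bar>\<gamma>\<bar>) * C) + (ennreal (A / 2) * ennreal (norm (F2 x)) + ennreal k)"
  proof -
    have "0 \<le> (s + 2 * measure J UNIV + \<bar>\<gamma>\<bar>) * C"
      using s_nonneg order_trans[OF norm_ge_zero boundF(1)] by auto
    moreover have "0 \<le> A / 2 * norm (F2 x)" "0 \<le> A / 2 * norm (F2 x) + k"
      using A_nonneg k by auto
    moreover have "ennreal (A / 2 * norm (F2 x)) = ennreal (A / 2) * ennreal (norm (F2 x))"
      using A_nonneg by (intro ennreal_mult) auto
    ultimately show ?thesis
      using k(2) by (simp only: ennreal_plus)
  qed
  finally show ?thesis
    unfolding k(1) .
qed (auto simp: not_less top_unique)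

text \<open>The bound does not depend on the translation c, because the L1 norm of \<open>F2\<close>
  is translation invariant. It can therefore be integrated over c against a finite measure, which
  provides the Tonelli bound for the killing term.\<close>

lemma resolvent_op_uniform:
  "(\<integral>\<^sup>+x. ennreal (g x) * ennreal (norm (resolvent_op F F1 F2 (c + x))) \<partial>lborel) \<le>
    ennreal ((s + 2 * measure J UNIV + \<bar>\<gamma>\<bar>) * C) * (\<integral>\<^sup>+x. ennreal (g x) \<partial>lborel)
    + ennreal Hbound * (\<integral>\<^sup>+x. ennreal (norm (F2 x)) \<partial>lborel)"
proof -
  let ?C = "ennreal ((s + 2 * measure J UNIV + \<bar>\<gamma>\<bar>) * C)"
  have "(\<integral>\<^sup>+x. ennreal (g x) * ennreal (norm (resolvent_op F F1 F2 (c + x))) \<partial>lborel) \<le>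
    (\<integral>\<^sup>+x. ?C * ennreal (g x) + ennreal (g x) * (ennreal (A / 2) * ennreal (norm (F2 (c + x)))
      + (\<integral>\<^sup>+v. ennreal (norm (F2 (c + (x + v)))) \<partial>K)) \<partial>lborel)"
  proof (rule nn_integral_mono)
    fix x
    have "ennreal (g x) * ennreal (norm (resolvent_op F F1 F2 (c + x))) \<le>
        ennreal (g x) * (?C + (ennreal (A / 2) * ennreal (norm (F2 (c + x)))
          + (\<integral>\<^sup>+v. ennreal (norm (F2 (c + x + v))) \<partial>K)))"
      by (intro mult_left_mono resolvent_op_bound) auto
    then show "ennreal (g x) * ennreal (norm (resolvent_op F F1 F2 (c + x))) \<le>
        ?C * ennreal (g x) + ennreal (g x) * (ennreal (A / 2) * ennreal (norm (F2 (c + x)))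
          + (\<integral>\<^sup>+v. ennreal (norm (F2 (c + (x + v)))) \<partial>K))"
      by (simp only: distrib_left mult.commute add.assoc)
  qed
  also have "\<dots> = ?C * (\<integral>\<^sup>+x. ennreal (g x) \<partial>lborel) + (\<integral>\<^sup>+x. ennreal (g x) * (ennreal (A / 2) * ennreal (norm (F2 (c + x)))
      + (\<integral>\<^sup>+v. ennreal (norm (F2 (c + (x + v)))) \<partial>K)) \<partial>lborel)"
    by (subst nn_integral_add) (auto simp: nn_integral_cmult)
  also have "\<dots> \<le> ?C * (\<integral>\<^sup>+x. ennreal (g x) \<partial>lborel) + ennreal Hbound * (\<integral>\<^sup>+x. ennreal (norm (F2 (c + x))) \<partial>lborel)"
    by (intro add_left_mono second_order_bound) measurable
  also have "(\<integral>\<^sup>+x. ennreal (norm (F2 (c + x))) \<partial>lborel) = (\<integral>\<^sup>+x. ennreal (norm (F2 x)) \<partial>lborel)"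
    using nn_integral_translate[of "\<lambda>x. ennreal (norm (F2 x))" c] by simp
  finally show ?thesis .
qed

end

end

section \<open>Densities of a Levy process\<close>

lemma AE_sequence_tendsto:
  fixes x :: real
  assumes "AE y in lborel. P y"
  shows "\<exists>X. (\<forall>n::nat. P (X n)) \<and> X \<longlonglongrightarrow> x"
proof -
  have "\<exists>y. P y \<and> x < y \<and> y < x + 1 / real (Suc n)" for n
  proof (rule ccontr)
    assume "\<not> ?thesis"
    then have "AE y in lborel. y \<notin> {x<..<x + 1 / real (Suc n)}"
      using assms by (auto elim!: eventually_mono)
    then have "{x<..<x + 1 / real (Suc n)} \<in> null_sets lborel"
      by (subst AE_iff_null_sets) auto
    then show False
      by (simp add: null_sets_def)
  qed
  then obtain X where X: "\<And>n. P (X n) \<and> x < X n \<and> X n < x + 1 / real (Suc n)"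
    by metis
  have "X \<longlonglongrightarrow> x"
  proof (rule tendsto_sandwich)
    show "\<forall>\<^sub>F n in sequentially. x \<le> X n" "\<forall>\<^sub>F n in sequentially. X n \<le> x + 1 / real (Suc n)"
      using X by (auto intro!: always_eventually less_imp_le)
    have "(\<lambda>n. x + 1 / real (Suc n)) \<longlonglongrightarrow> x + 0"
      by (intro tendsto_intros LIMSEQ_Suc[OF lim_1_over_n])
    then show "(\<lambda>n. x + 1 / real (Suc n)) \<longlonglongrightarrow> x"
      by simp
  qed simp
  then show ?thesis using X by blast
qed

text \<open>The process enters through its one-dimensional laws; the semigroup structure is read off
  from the factor t in the exponent.\<close>

locale levy_density =
  fixes M :: "'a measure" and X :: "real \<Rightarrow> 'a \<Rightarrow> real" and \<rho> :: "real \<Rightarrow> real \<Rightarrow> real" and \<Lambda> :: "real \<Rightarrow> complex"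
  assumes M_prob: "prob_space M"
    and X_meas [measurable]: "0 \<le> t \<Longrightarrow> X t \<in> borel_measurable M"
    and char_X: "0 \<le> t \<Longrightarrow> char (distr M borel (X t)) z = exp (- of_real t * \<Lambda> z)"
    and cont_density: "continuous_density M X \<rho>"
begin

abbreviation law :: "real \<Rightarrow> real measure" where "law t \<equiv> distr M borel (X t)"

lemma \<rho>_cont: "0 < t \<Longrightarrow> continuous_on UNIV (\<lambda>x. \<rho> x t)"
  and \<rho>_nonneg: "0 < t \<Longrightarrow> 0 \<le> \<rho> x t"
  and law_eq: "0 < t \<Longrightarrow> law t = density lborel (\<lambda>x. ennreal (\<rho> x t))"
proof -
  assume t: "0 < t"
  then have "distributed M lborel (X t) (\<lambda>x. ennreal (\<rho> x t))"
    using cont_density by (auto simp: continuous_density_def)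
  then have "distr M lborel (X t) = density lborel (\<lambda>x. ennreal (\<rho> x t))"
    by (rule distributed_distr_eq_density)
  moreover have "distr M lborel (X t) = law t"
    by (rule distr_cong) auto
  ultimately show "law t = density lborel (\<lambda>x. ennreal (\<rho> x t))"
    by simp
qed (use cont_density in \<open>auto simp: continuous_density_def\<close>)

lemma \<rho>_meas_x: "0 < t \<Longrightarrow> (\<lambda>x. \<rho> x t) \<in> borel_measurable borel"
  by (rule borel_measurable_continuous_onI[OF \<rho>_cont])

lemma real_distribution_law: "0 \<le> t \<Longrightarrow> real_distribution (law t)"
  by (intro prob_space.real_distribution_distr[OF M_prob] X_meas)

lemma \<rho>_prob: "0 < t \<Longrightarrow> (\<integral>\<^sup>+x. ennreal (\<rho> x t) \<partial>lborel) = 1"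
proof -
  assume t: "0 < t"
  interpret real_distribution "law t" using t by (intro real_distribution_law) simp
  show ?thesis
    using emeasure_space_1 \<rho>_meas_x[OF t] unfolding law_eq[OF t]
    by (simp add: emeasure_density)
qed

lemma \<rho>_int: "0 < t \<Longrightarrow> integrable lborel (\<lambda>x. \<rho> x t)"
  using \<rho>_meas_x[of t] \<rho>_prob[of t] \<rho>_nonneg[of t] by (intro integrableI_nonneg) auto

lemma fourier_\<rho>: "0 < t \<Longrightarrow> fourier (\<lambda>x. \<rho> x t) z = exp (- of_real t * \<Lambda> z)"
proof -
  assume t: "0 < t"
  have "char (law t) z = fourier (\<lambda>x. \<rho> x t) z"
    unfolding law_eq[OF t] char_def fourier_def using \<rho>_meas_x[OF t] \<rho>_nonneg[OF t]
    by (subst integral_density) (auto simp: scaleR_conv_of_real mult.commute)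
  then show ?thesis
    using char_X[of t z] t by simp
qed

lemma Re_exponent: "0 \<le> Re (\<Lambda> z)"
proof -
  interpret real_distribution "law 1" by (rule real_distribution_law) simp
  have "norm (exp (- \<Lambda> z)) \<le> 1"
    using cmod_char_le_1[of z] char_X[of 1 z] by simp
  then show ?thesis
    by (simp add: norm_exp_eq_Re)
qed

text \<open>Both sides have the transform exp(-(a + b) \<Lambda>). Fourier uniqueness for integrable
  functions gives equality almost everywhere, and no more at this stage.\<close>

lemma \<rho>_conv_AE:
  assumes "0 < a" "0 < b"
  shows "AE x in lborel. (\<integral>\<^sup>+\<xi>. ennreal (\<rho> (x - \<xi>) a) * ennreal (\<rho> \<xi> b) \<partial>lborel) = ennreal (\<rho> x (a + b))"
proof -
  interpret L: real_distribution "law b" using assms by (intro real_distribution_law) simp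
  interpret L: conv_measure "law b" by unfold_locales simp
  have [measurable]: "(\<lambda>x. \<rho> x a) \<in> borel_measurable borel" "(\<lambda>x. \<rho> x b) \<in> borel_measurable borel"
    "(\<lambda>x. \<rho> x (a + b)) \<in> borel_measurable borel"
    using assms by (auto intro!: \<rho>_meas_x)
  let ?h = "L.mconv (\<lambda>x. \<rho> x a)"
  have int: "integrable lborel ?h"
    using assms \<rho>_int by (intro L.integrable_mconv) auto
  have "fourier (\<lambda>x. ?h x + (-1) * \<rho> x (a + b)) z = 0" for z
  proof -
    have "fourier (\<lambda>x. ?h x + (-1) * \<rho> x (a + b)) z = fourier ?h z + fourier (\<lambda>x. (-1) * \<rho> x (a + b)) z"
      using assms int \<rho>_int[of "a + b"] by (intro fourier_add) auto
    also have "\<dots> = 0"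
      unfolding fourier_cmult using assms \<rho>_int[of a]
      by (simp add: L.fourier_mconv fourier_\<rho> char_X exp_add[symmetric] algebra_simps)
    finally show ?thesis .
  qed
  then have "AE x in lborel. ?h x + (-1) * \<rho> x (a + b) = 0"
    using assms int \<rho>_int[of "a + b"] by (intro fourier_unique) auto
  moreover have "AE x in lborel. (\<integral>\<^sup>+y. ennreal (\<rho> (x - y) a) \<partial>law b) = ennreal (?h x)"
    using assms \<rho>_int \<rho>_nonneg by (intro L.AE_mconv_nn) auto
  ultimately show ?thesis
  proof eventually_elim
    case (elim x)
    have "(\<integral>\<^sup>+y. ennreal (\<rho> (x - y) a) \<partial>law b) = (\<integral>\<^sup>+\<xi>. ennreal (\<rho> (x - \<xi>) a) * ennreal (\<rho> \<xi> b) \<partial>lborel)"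
      unfolding law_eq[OF assms(2)] by (subst nn_integral_density) (auto simp: mult.commute)
    then show ?case
      using elim by simp
  qed
qed

text \<open>By Fatou the left side is lower semicontinuous in \<open>x\<close>, so the almost everywhere equality
  gives an inequality at every point.\<close>

lemma \<rho>_conv_le:
  assumes "0 < a" "0 < b"
  shows "(\<integral>\<^sup>+\<xi>. ennreal (\<rho> (x - \<xi>) a) * ennreal (\<rho> \<xi> b) \<partial>lborel) \<le> ennreal (\<rho> x (a + b))"
proof -
  have [measurable]: "(\<lambda>x. \<rho> x a) \<in> borel_measurable borel" "(\<lambda>x. \<rho> x b) \<in> borel_measurable borel"
    using assms by (auto intro!: \<rho>_meas_x)
  obtain Y where Y: "\<And>n::nat. (\<integral>\<^sup>+\<xi>. ennreal (\<rho> (Y n - \<xi>) a) * ennreal (\<rho> \<xi> b) \<partial>lborel) = ennreal (\<rho> (Y n) (a + b))"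
    "Y \<longlonglongrightarrow> x"
    using AE_sequence_tendsto[OF \<rho>_conv_AE[OF assms]] by blast
  have lim: "(\<lambda>n. ennreal (\<rho> (Y n - \<xi>) a) * ennreal (\<rho> \<xi> b)) \<longlonglongrightarrow> ennreal (\<rho> (x - \<xi>) a) * ennreal (\<rho> \<xi> b)" for \<xi>
  proof (rule tendsto_mult_ennreal)
    have "(\<lambda>n. \<rho> (Y n - \<xi>) a) \<longlonglongrightarrow> \<rho> (x - \<xi>) a"
      by (rule continuous_on_tendsto_compose[OF \<rho>_cont[OF assms(1)]]) (auto intro!: tendsto_intros Y)
    then show "(\<lambda>n. ennreal (\<rho> (Y n - \<xi>) a)) \<longlonglongrightarrow> ennreal (\<rho> (x - \<xi>) a)"
      by (rule tendsto_ennrealI)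
  qed auto
  have lim': "(\<lambda>n. ennreal (\<rho> (Y n) (a + b))) \<longlonglongrightarrow> ennreal (\<rho> x (a + b))"
    using assms by (intro tendsto_ennrealI continuous_on_tendsto_compose[OF \<rho>_cont _ ] Y) auto
  have "(\<integral>\<^sup>+\<xi>. ennreal (\<rho> (x - \<xi>) a) * ennreal (\<rho> \<xi> b) \<partial>lborel) =
      (\<integral>\<^sup>+\<xi>. liminf (\<lambda>n. ennreal (\<rho> (Y n - \<xi>) a) * ennreal (\<rho> \<xi> b)) \<partial>lborel)"
    using lim_imp_Liminf[OF _ lim] by simp
  also have "\<dots> \<le> liminf (\<lambda>n. \<integral>\<^sup>+\<xi>. ennreal (\<rho> (Y n - \<xi>) a) * ennreal (\<rho> \<xi> b) \<partial>lborel)"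
    by (rule nn_integral_liminf) measurable
  also have "\<dots> = ennreal (\<rho> x (a + b))"
    unfolding Y(1) using lim' by (intro lim_imp_Liminf) auto
  finally show ?thesis .
qed

text \<open>Joint continuity in time and space. The moving argument is absorbed by passing to X t -
  x, so that the distribution function is always evaluated at 0; Levy's continuity theorem then
  applies, since the limit law has a density and hence no atom there.\<close>

lemma cdf_tendsto:
  assumes t: "0 < t" and u: "\<And>n::nat. 0 < u n" "u \<longlonglongrightarrow> t" and y: "y \<longlonglongrightarrow> x"
  shows "(\<lambda>n. cdf (law (u n)) (y n)) \<longlonglongrightarrow> cdf (law t) x"
proof -
  let ?D = "\<lambda>t x. distr M borel (\<lambda>\<omega>. X t \<omega> - x)"
  have D: "real_distribution (?D v x)" if "0 < v" for v x
    using that by (intro prob_space.real_distribution_distr[OF M_prob]) auto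
  have charD: "char (?D v x) z = iexp (- (z * x)) * exp (- of_real v * \<Lambda> z)" if "0 < v" for v x z
  proof -
    have "char (?D v x) z = (CLINT \<omega>|M. iexp (- (z * x)) * iexp (z * X v \<omega>))"
      unfolding char_def using that
      by (subst integral_distr) (auto intro!: Bochner_Integration.integral_cong simp: exp_add[symmetric] algebra_simps)
    also have "\<dots> = iexp (- (z * x)) * char (law v) z"
      unfolding char_def using that by (subst integral_distr) auto
    finally show ?thesis
      using that by (simp add: char_X)
  qed
  have cdfD: "cdf (?D v x) 0 = cdf (law v) x" if "0 < v" for v x
    unfolding cdf_def using that by (subst (1 2) measure_distr) (auto intro!: arg_cong[where f="measure M"])
  have "weak_conv_m (\<lambda>n. ?D (u n) (y n)) (?D t x)"
  proof (rule levy_continuity)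
    show "(\<lambda>n. char (?D (u n) (y n)) z) \<longlonglongrightarrow> char (?D t x) z" for z
      unfolding charD[OF t] charD[OF u(1)] by (intro tendsto_intros u y)
  qed (auto intro!: D t u)
  moreover have "isCont (cdf (?D t x)) 0"
  proof -
    interpret D: real_distribution "?D t x" by (rule D[OF t])
    have "measure (?D t x) {0} = measure (law t) {x}"
      using t by (subst (1 2) measure_distr) (auto intro!: arg_cong[where f="measure M"])
    also have "\<dots> = 0"
    proof -
      have [measurable]: "(\<lambda>x. \<rho> x t) \<in> borel_measurable borel" by (rule \<rho>_meas_x[OF t])
      have "emeasure (law t) {x} = 0"
        unfolding law_eq[OF t]
        by (subst emeasure_density) (auto intro!: nn_integral_null_set[THEN trans])
      then show ?thesis by (simp add: measure_def)
    qed
    finally show ?thesis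
      by (simp add: D.isCont_cdf)
  qed
  ultimately have "(\<lambda>n. cdf (?D (u n) (y n)) 0) \<longlonglongrightarrow> cdf (?D t x) 0"
    by (simp add: weak_conv_m_def weak_conv_def)
  then show ?thesis
    by (simp add: cdfD t u)
qed

lemma cdf_derivative:
  assumes t: "0 < t"
  shows "(\<lambda>n. (cdf (law t) (x + 1 / real (Suc n)) - cdf (law t) x) * real (Suc n)) \<longlonglongrightarrow> \<rho> x t"
proof -
  interpret L: real_distribution "law t" using t by (intro real_distribution_law) simp
  have [measurable]: "(\<lambda>x. \<rho> x t) \<in> borel_measurable borel" by (rule \<rho>_meas_x[OF t])
  have c: "continuous_on S (\<lambda>x. \<rho> x t)" for S
    using \<rho>_cont[OF t] continuous_on_subset by blast
  have diff: "cdf (law t) y - cdf (law t) x = integral {x..y} (\<lambda>z. \<rho> z t)" if "x \<le> y" for y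
  proof (cases "x = y")
    case False
    then have "cdf (law t) y - cdf (law t) x = measure (law t) {x<..y}"
      using that by (subst L.cdf_diff_eq) auto
    also have "\<dots> = enn2real (\<integral>\<^sup>+z. ennreal (indicator {x..y} z * \<rho> z t) \<partial>lborel)"
      unfolding law_eq[OF t] measure_def using AE_lborel_singleton[of x]
      by (subst emeasure_density) (auto intro!: arg_cong[where f=enn2real] nn_integral_cong_AE
          elim!: eventually_mono simp: indicator_def)
    also have "\<dots> = (LINT z:{x..y}|lborel. \<rho> z t)"
      unfolding set_lebesgue_integral_def
      by (subst integral_eq_nn_integral) (auto simp: \<rho>_nonneg[OF t])
    also have "\<dots> = integral {x..y} (\<lambda>z. \<rho> z t)"
      by (rule set_borel_integral_eq_integral) (rule borel_integrable_atLeastAtMost', rule c)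
    finally show ?thesis .
  qed simp
  have "((\<lambda>y. integral {x..y} (\<lambda>z. \<rho> z t)) has_real_derivative \<rho> x t) (at x within {x..x + 1})"
    by (rule integral_has_real_derivative) (auto intro: c)
  then have "((\<lambda>y. (integral {x..y} (\<lambda>z. \<rho> z t) - integral {x..x} (\<lambda>z. \<rho> z t)) / (y - x)) \<longlongrightarrow> \<rho> x t) (at x within {x..x + 1})"
    by (simp add: has_field_derivative_iff)
  moreover have "(\<lambda>n. x + 1 / real (Suc n)) \<longlonglongrightarrow> x"
    using tendsto_add[OF tendsto_const[of x] LIMSEQ_Suc[OF lim_1_over_n]] by simp
  ultimately have "((\<lambda>y. (integral {x..y} (\<lambda>z. \<rho> z t) - integral {x..x} (\<lambda>z. \<rho> z t)) / (y - x)) \<circ> (\<lambda>n. x + 1 / real (Suc n))) \<longlonglongrightarrow> \<rho> x t"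
    unfolding tendsto_at_iff_sequentially by (auto simp: divide_le_eq)
  then show ?thesis
    by (simp add: o_def diff divide_inverse del: of_nat_Suc)
qed

text \<open>Continuity in x for each separate t does not give joint measurability. The distribution
  function is jointly continuous by \<open>cdf_tendsto\<close>, and \<open>\<rho>\<close> is the
  limit of its difference quotients in x.\<close>

lemma \<rho>_meas: "(\<lambda>p. indicator {0<..} (snd p) * \<rho> (fst p) (snd p)) \<in> borel_measurable borel"
proof -
  let ?S = "{p :: real \<times> real. 0 < snd p}"
  define c where "c p = indicator ?S p *\<^sub>R cdf (law (snd p)) (fst p)" for p
  have "open ?S"
    by (intro open_Collect_less continuous_intros)
  moreover have "continuous_on ?S (\<lambda>p. cdf (law (snd p)) (fst p))"
    unfolding continuous_on_sequentially
  proof safe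
    fix u :: "nat \<Rightarrow> real \<times> real" and x t :: real
    assume "\<forall>n. u n \<in> ?S" "0 < snd (x, t)" "u \<longlonglongrightarrow> (x, t)"
    then show "((\<lambda>p. cdf (law (snd p)) (fst p)) \<circ> u) \<longlonglongrightarrow> cdf (law (snd (x, t))) (fst (x, t))"
      using tendsto_fst[of u "(x, t)"] tendsto_snd[of u "(x, t)"]
      by (auto simp: o_def intro!: cdf_tendsto)
  qed
  ultimately have [measurable]: "c \<in> borel_measurable borel"
    unfolding c_def[abs_def] by (intro borel_measurable_continuous_on_indicator) auto
  show ?thesis
  proof (rule borel_measurable_LIMSEQ_real)
    show "(\<lambda>n. (c (fst p + 1 / real (Suc n), snd p) - c p) * real (Suc n)) \<longlonglongrightarrow> indicator {0<..} (snd p) * \<rho> (fst p) (snd p)" for p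
    proof (cases "0 < snd p")
      case True
      then show ?thesis
        using cdf_derivative[of "snd p" "fst p"] by (simp add: c_def)
    qed (simp add: c_def)
    show "(\<lambda>p. (c (fst p + 1 / real (Suc n), snd p) - c p) * real (Suc n)) \<in> borel_measurable borel" for n
      by measurable
  qed
qed

lemma density_semigroup: "\<Delta> \<in> sets borel \<Longrightarrow> density_semigroup \<rho> \<Delta>"
  by unfold_locales (auto intro: \<rho>_meas \<rho>_nonneg \<rho>_conv_le \<rho>_conv_AE \<rho>_prob)

end

section \<open>The limit of strong killing\<close>

context density_semigroup
begin

lemma integrable_g:
  assumes s: "0 < s"
  shows "integrable lborel (\<lambda>x. enn2real (G s x))"
proof (rule integrableI_nonneg)
  have "(\<integral>\<^sup>+x. ennreal (enn2real (G s x)) \<partial>lborel) = (\<integral>\<^sup>+x. G s x \<partial>lborel)"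
    by (rule nn_integral_cong_AE) (use AE_G_finite[OF s] in auto)
  then show "(\<integral>\<^sup>+x. ennreal (enn2real (G s x)) \<partial>lborel) < \<infinity>"
    using nn_integral_G[OF s] by simp
qed (use measurable_G[OF s] in auto)

lemma psi_identity:
  assumes s: "0 < s" and RD: "resolvent_density K J (\<lambda>x. enn2real (G s x)) A \<gamma> s"
    and test: "exp_test C F F1 F2" and off: "\<And>x. x \<notin> \<Delta> \<Longrightarrow> F x = 0"
  shows "(CLINT x|lborel. resolvent_density.resolvent_op K J A \<gamma> s F F1 F2 x * of_real (psi \<rho> \<Delta> x s)) = F 0"
proof -
  define g where "g x = enn2real (G s x)" for x
  interpret R: resolvent_density K J g A \<gamma> s
    using RD unfolding g_def .
  \<comment> \<open>Outside their contexts these rules carry premises such as \<open>0 < s\<close>;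
    discharged instances replace them.\<close>
  note [measurable del] = R.measF measurable_G measurable_Psi measurable_psi
  note [measurable] = measurable_G[OF s] measurable_Psi[OF s] measurable_psi[OF s] R.measF[OF test]
  define R where "R = R.resolvent_op F F1 F2"
  have R_meas [measurable]: "R \<in> borel_measurable borel"
    unfolding R_def R.resolvent_op_def[abs_def] by measurable
  have G_eq: "AE x in lborel. G s x = ennreal (g x)"
    using AE_G_finite[OF s] by eventually_elim (simp add: g_def)
  have Psi_real: "AE x in lborel. enn2real (Psi s u x) \<le> g x" if "0 \<le> u" for u
    using AE_G_finite[OF s] by eventually_elim (auto simp: g_def intro!: enn2real_mono Psi_le[OF s that])
  have Rg: "integrable lborel (\<lambda>x. R x * complex_of_real (g x))"
      "(CLINT x|lborel. R x * complex_of_real (g x)) = F 0"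
    using R.resolvent_identity[OF test] by (simp_all add: R_def mult.commute)
  have step: "(CLINT x|lborel. R x * complex_of_real (enn2real (Psi s u x))) = F 0" if u: "0 \<le> u" for u
  proof -
    \<comment> \<open>The measure with density \<open>w\<close> is finite, so
      \<open>Psi_equation\<close> takes the form Psi u = g - u (N * g) almost everywhere, a
      convolution of \<open>g\<close> with a finite measure.\<close>
    define w where "w \<xi> = indicator (- \<Delta>) \<xi> * Psi s u \<xi>" for \<xi>
    have [measurable]: "w \<in> borel_measurable borel"
      unfolding w_def[abs_def] by measurable
    define N where "N = density lborel w"
    have N_mass: "emeasure N UNIV < \<infinity>"
    proof -
      have "emeasure N UNIV = (\<integral>\<^sup>+x. w x \<partial>lborel)"
        by (simp add: N_def emeasure_density)
      also have "\<dots> \<le> (\<integral>\<^sup>+x. G s x \<partial>lborel)"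
        using Psi_le[OF s u] by (intro nn_integral_mono) (auto simp: w_def indicator_def)
      finally show ?thesis
        using nn_integral_G[OF s] by (auto intro: le_less_trans)
    qed
    interpret N: conv_measure N
    proof (intro conv_measure.intro conv_measure_axioms.intro finite_measureI)
      show "emeasure N (space N) \<noteq> \<infinity>"
        using N_mass by (simp add: N_def)
    qed (simp add: N_def)
    have conv: "AE x in lborel. nnconv (G s) w x = ennreal (N.mconv g x)"
    proof -
      have "nnconv (G s) w x = (\<integral>\<^sup>+y. ennreal (g (x - y)) \<partial>N)" for x
      proof -
        have "nnconv (G s) w x = (\<integral>\<^sup>+y. w y * ennreal (g (x - y)) \<partial>lborel)"
          unfolding nnconv_def
          by (rule nn_integral_cong_AE) (use AE_reflect[OF G_eq, of x] in \<open>eventually_elim, simp add: mult.commute\<close>)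
        also have "\<dots> = (\<integral>\<^sup>+y. ennreal (g (x - y)) \<partial>N)"
          unfolding N_def by (rule nn_integral_density[symmetric]) measurable
        finally show ?thesis .
      qed
      then show ?thesis
        using N.AE_mconv_nn[OF R.g_meas R.g_int R.g_nonneg] by simp
    qed
    have Psi_eq: "AE x in lborel. enn2real (Psi s u x) = g x - u * N.mconv g x"
      using conv AE_G_finite[OF s]
    proof eventually_elim
      case (elim x)
      have "Psi s u x + ennreal u * ennreal (N.mconv g x) = G s x"
        using Psi_equation[OF s u, of x] elim(1) unfolding w_def[abs_def] by simp
      moreover have "Psi s u x < \<infinity>"
        using Psi_le[OF s u, of x] elim(2) by (rule le_less_trans)
      ultimately have "enn2real (Psi s u x) + u * N.mconv g x = enn2real (G s x)"
        using u N.mconv_nonneg[of g x, OF R.g_nonneg]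
        by (metis enn2real_ennreal enn2real_plus ennreal_less_top ennreal_mult infinity_ennreal_def mult_nonneg_nonneg)
      then show ?case
        by (simp add: g_def)
    qed
    let ?B = "ennreal ((s + 2 * measure J UNIV + \<bar>\<gamma>\<bar>) * C) * (\<integral>\<^sup>+x. ennreal (g x) \<partial>lborel)
      + ennreal R.Hbound * (\<integral>\<^sup>+x. ennreal (norm (F2 x)) \<partial>lborel)"
    have fin: "(\<integral>\<^sup>+x. \<integral>\<^sup>+y. ennreal (norm (R (x + y))) * ennreal \<bar>g x\<bar> \<partial>N \<partial>lborel) < \<infinity>"
    proof -
      have "(\<integral>\<^sup>+x. \<integral>\<^sup>+y. ennreal (norm (R (x + y))) * ennreal \<bar>g x\<bar> \<partial>N \<partial>lborel) =
          (\<integral>\<^sup>+y. \<integral>\<^sup>+x. ennreal (norm (R (x + y))) * ennreal \<bar>g x\<bar> \<partial>lborel \<partial>N)"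
        by (rule N.P.Fubini'[symmetric]) measurable
      also have "\<dots> \<le> (\<integral>\<^sup>+y. ?B \<partial>N)"
        using R.resolvent_op_uniform[OF test] R.g_nonneg
        by (intro nn_integral_mono) (simp add: R_def mult.commute add.commute)
      also have "\<dots> = ?B * emeasure N UNIV"
        by simp
      also have "\<dots> < \<infinity>"
      proof -
        have "(\<integral>\<^sup>+x. ennreal (g x) \<partial>lborel) < \<infinity>" "(\<integral>\<^sup>+x. ennreal (norm (F2 x)) \<partial>lborel) < \<infinity>"
          using R.g_int R.intF(3)[OF test] R.g_nonneg by (auto simp: integrable_iff_bounded)
        then show ?thesis
          using N_mass by (auto simp: ennreal_mult_less_top)
      qed
      finally show ?thesis .
    qed
    have RN: "integrable lborel (\<lambda>x. R x * complex_of_real (N.mconv g x))"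
      by (rule N.mconv_test(1)[OF R_meas R.g_meas fin])
    have "(CLINT x|lborel. R x * complex_of_real (N.mconv g x)) = (CLINT y|N. CLINT x|lborel. R (x + y) * complex_of_real (g x))"
      by (rule N.mconv_test(4)[OF R_meas R.g_meas fin])
    \<comment> \<open>The resolvent identity is applied to the test function translated by y, whose
      value at 0 is F y. The result vanishes because \<open>N\<close> is carried by the complement
      of \<Delta>.\<close>
    also have "\<dots> = (CLINT y|N. F y)"
    proof (rule Bochner_Integration.integral_cong[OF refl])
      fix y
      show "(CLINT x|lborel. R (x + y) * complex_of_real (g x)) = F y"
        using R.resolvent_identity(2)[OF exp_test_translate[OF test, of y]]
        unfolding R.resolvent_op_translate by (simp add: R_def mult.commute add.commute)
    qed
    also have "\<dots> = 0"
    proof (rule integral_eq_zero_AE)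
      show "AE y in N. F y = 0"
        unfolding N_def by (subst AE_density) (auto simp: w_def indicator_def off)
    qed
    finally have RN0: "(CLINT x|lborel. R x * complex_of_real (N.mconv g x)) = 0" .
    have "(CLINT x|lborel. R x * complex_of_real (enn2real (Psi s u x))) =
        (CLINT x|lborel. R x * complex_of_real (g x) - of_real u * (R x * complex_of_real (N.mconv g x)))"
      by (rule integral_cong_AE) (measurable, use Psi_eq in \<open>eventually_elim, simp only: of_real_diff of_real_mult right_diff_distrib mult.left_commute\<close>)
    also have "\<dots> = F 0"
      using Rg RN RN0 by simp
    finally show ?thesis .
  qed
  \<comment> \<open>The majorant |R g| does not depend on n and is integrable by
    \<open>resolvent_identity\<close>; the integrands converge at every x by
    \<open>psi_limit\<close>.\<close>
  have "(\<lambda>n. CLINT x|lborel. R x * complex_of_real (enn2real (Psi s (real n) x)))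
      \<longlonglongrightarrow> (CLINT x|lborel. R x * complex_of_real (psi \<rho> \<Delta> x s))"
  proof (rule integral_dominated_convergence[where w="\<lambda>x. norm (R x * complex_of_real (g x))"])
    show "integrable lborel (\<lambda>x. norm (R x * complex_of_real (g x)))"
      using Rg(1) by (rule integrable_norm)
    show "AE x in lborel. (\<lambda>n. R x * complex_of_real (enn2real (Psi s (real n) x))) \<longlonglongrightarrow> R x * complex_of_real (psi \<rho> \<Delta> x s)"
      by (intro AE_I2 tendsto_intros psi_limit s)
    show "AE x in lborel. norm (R x * complex_of_real (enn2real (Psi s (real n) x))) \<le> norm (R x * complex_of_real (g x))" for n
      using Psi_real[of "real n"] R.g_nonneg
      by (auto simp: norm_mult elim!: eventually_mono intro!: mult_left_mono)
  qed measurable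
  then have "(\<lambda>n::nat. F 0) \<longlonglongrightarrow> (CLINT x|lborel. R x * complex_of_real (psi \<rho> \<Delta> x s))"
    by (simp only: step of_nat_0_le_iff)
  then show ?thesis
    using LIMSEQ_unique[OF _ tendsto_const] unfolding R_def by blast
qed

end

text \<open>Fubini reduces the transform to the integral of exp(-t (s + \<Lambda> z)) over t > 0. By
  \<open>Re_exponent\<close> the real part of s + \<Lambda> z is at least s, so the integral
  converges and the denominator is not 0.\<close>

lemma (in levy_density) fourier_G:
  assumes "density_semigroup \<rho> \<Delta>" and s: "0 < s"
  shows "fourier (\<lambda>x. enn2real (density_semigroup.G \<rho> s x)) z * (s + \<Lambda> z) = 1"
proof -
  interpret D: density_semigroup \<rho> \<Delta> by fact
  let ?\<rho> = "\<lambda>p. indicator {0<..} (snd p) * \<rho> (fst p) (snd p)"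
  define k where "k x t = exp (- s * t) * ?\<rho> (x, t)" for x t
  have k_meas [measurable]: "case_prod k \<in> borel_measurable (borel \<Otimes>\<^sub>M borel)"
  proof -
    have "(\<lambda>p. exp (- s * snd p) * ?\<rho> p) \<in> borel_measurable borel"
      by (intro borel_measurable_times \<rho>_meas) measurable
    then show ?thesis
      by (simp add: k_def case_prod_beta' borel_prod)
  qed
  have k_nonneg: "0 \<le> k x t" for x t
    by (auto simp: k_def indicator_def \<rho>_nonneg)
  have G_k: "D.G s x = (\<integral>\<^sup>+t. ennreal (k x t) \<partial>lborel)" for x
    unfolding D.G_def[OF s] D.laplace_def[OF s] D.r_def
    by (intro nn_integral_cong) (simp add: k_def ennreal_mult')
  have g_k: "enn2real (D.G s x) = (LINT t|lborel. k x t)" for x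
    unfolding G_k by (rule integral_eq_nn_integral[symmetric]) (auto simp: k_nonneg)
  let ?h = "\<lambda>x t. iexp (z * x) * complex_of_real (k x t)"
  have int: "integrable (lborel \<Otimes>\<^sub>M lborel) (case_prod ?h)"
  proof (rule integrableI_bounded)
    have "(\<integral>\<^sup>+p. ennreal (norm (case_prod ?h p)) \<partial>(lborel \<Otimes>\<^sub>M lborel)) = (\<integral>\<^sup>+x. \<integral>\<^sup>+t. ennreal (k x t) \<partial>lborel \<partial>lborel)"
      by (subst lborel.nn_integral_fst[symmetric]) (auto simp: norm_mult k_nonneg)
    also have "\<dots> = ennreal (1 / s)"
      using D.nn_integral_G[OF s] by (simp add: G_k)
    finally show "(\<integral>\<^sup>+p. ennreal (norm (case_prod ?h p)) \<partial>(lborel \<Otimes>\<^sub>M lborel)) < \<infinity>"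
      by simp
  qed measurable
  let ?c = "- (s + \<Lambda> z)"
  have c: "Re ?c < 0"
    using s Re_exponent[of z] by simp
  have "fourier (\<lambda>x. enn2real (D.G s x)) z = (CLINT x|lborel. CLINT t|lborel. ?h x t)"
    unfolding fourier_def g_k by (simp flip: integral_complex_of_real)
  also have "\<dots> = (CLINT t|lborel. CLINT x|lborel. ?h x t)"
    by (rule lborel_pair.Fubini_integral[OF int, symmetric])
  also have "\<dots> = (CLINT t:{0<..}|lborel. exp (?c * complex_of_real t))"
    unfolding set_lebesgue_integral_def
  proof (rule Bochner_Integration.integral_cong[OF refl])
    fix t :: real
    show "(CLINT x|lborel. ?h x t) = indicator {0<..} t *\<^sub>R exp (?c * complex_of_real t)"
    proof (cases "0 < t")
      case True
      have "(CLINT x|lborel. ?h x t) = (CLINT x|lborel. exp (- s * t) *\<^sub>R (iexp (z * x) * complex_of_real (\<rho> x t)))"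
        using True by (intro Bochner_Integration.integral_cong) (auto simp: k_def scaleR_conv_of_real)
      also have "\<dots> = exp (- s * t) *\<^sub>R fourier (\<lambda>x. \<rho> x t) z"
        unfolding fourier_def by simp
      finally show ?thesis
        using True by (simp add: fourier_\<rho> scaleR_conv_of_real exp_of_real[symmetric] exp_add[symmetric] algebra_simps del: exp_of_real)
    qed (simp add: k_def)
  qed
  also have "\<dots> = 1 / (s + \<Lambda> z)"
    unfolding exp_half_line(2)[OF c] by (rule minus_divide_divide)
  finally have "fourier (\<lambda>x. enn2real (D.G s x)) z = 1 / (s + \<Lambda> z)" .
  moreover have "s + \<Lambda> z \<noteq> 0"
    using c by (metis less_irrefl minus_zero zero_complex.sel(1))
  ultimately show ?thesis
    by simp
qed

section \<open>Jump measures\<close>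

text \<open>Writing F1 as an integral of F2 and F as an integral of F1 gives a double integral over
  the triangle 0 <= v <= \<theta> <= 1, and Fubini produces the weight 1 - v. Rescaling by y makes
  the formula the same for both signs of y; F2 may be discontinuous.\<close>

lemma taylor_integral:
  fixes F F1 F2 :: "real \<Rightarrow> complex"
  assumes F: "\<And>x. (F has_vector_derivative F1 x) (at x)"
    and F1_cont: "continuous_on UNIV F1"
    and [measurable]: "F2 \<in> borel_measurable borel"
    and F2: "\<And>u v. set_integrable lborel {u..v} F2"
    and F1: "\<And>u v. u \<le> v \<Longrightarrow> F1 v - F1 u = (CLINT t:{u..v}|lborel. F2 t)"
  shows "F (x + y) - F x - of_real y * F1 x =
    y\<^sup>2 *\<^sub>R (CLINT \<theta>|lborel. ((1 - \<theta>) * indicator {0..1} \<theta>) *\<^sub>R F2 (x + y * \<theta>))"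
proof (cases "y = 0")
  case False
  have 1: "y *\<^sub>R (F1 (x + y * \<theta>) - F1 x) = y\<^sup>2 *\<^sub>R (CLINT v|lborel. indicator {0..\<theta>} v *\<^sub>R F2 (x + y * v))"
    if "0 \<le> \<theta>" for \<theta>
  proof (cases "0 < y")
    case True
    then have "F1 (x + y * \<theta>) - F1 x = (CLINT t|lborel. indicator {x..x + y * \<theta>} t *\<^sub>R F2 t)"
      using F1[of x "x + y * \<theta>"] that by (simp add: set_lebesgue_integral_def)
    also have "\<dots> = y *\<^sub>R (CLINT v|lborel. indicator {x..x + y * \<theta>} (x + y * v) *\<^sub>R F2 (x + y * v))"
      using True by (subst lborel_integral_real_affine[of y _ x]) auto
    also have "(\<lambda>v. indicator {x..x + y * \<theta>} (x + y * v) :: real) = indicator {0..\<theta>}"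
      using True by (auto simp: indicator_def fun_eq_iff zero_le_mult_iff)
    finally show ?thesis
      by (simp add: power2_eq_square)
  next
    case neg: False
    with False have y: "y < 0" by simp
    then have "F1 x - F1 (x + y * \<theta>) = (CLINT t|lborel. indicator {x + y * \<theta>..x} t *\<^sub>R F2 t)"
      using F1[of "x + y * \<theta>" x] that by (simp add: set_lebesgue_integral_def mult_nonpos_nonneg)
    also have "\<dots> = (- y) *\<^sub>R (CLINT v|lborel. indicator {x + y * \<theta>..x} (x + y * v) *\<^sub>R F2 (x + y * v))"
      using y by (subst lborel_integral_real_affine[of y _ x]) auto
    also have "(\<lambda>v. indicator {x + y * \<theta>..x} (x + y * v) :: real) = indicator {0..\<theta>}"
      using y by (auto simp: indicator_def fun_eq_iff mult_le_0_iff)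
    finally have "F1 (x + y * \<theta>) - F1 x = y *\<^sub>R (CLINT v|lborel. indicator {0..\<theta>} v *\<^sub>R F2 (x + y * v))"
      by (simp add: algebra_simps)
    then show ?thesis
      by (simp add: power2_eq_square)
  qed
  let ?h = "\<lambda>\<theta> v. indicator {0..1} \<theta> *\<^sub>R indicator {0..\<theta>} v *\<^sub>R F2 (x + y * v)"
  have h_eq: "?h = (\<lambda>\<theta> v. (if 0 \<le> v \<and> v \<le> \<theta> \<and> \<theta> \<le> 1 then 1 else 0 :: real) *\<^sub>R F2 (x + y * v))"
    by (auto simp: fun_eq_iff indicator_def)
  have int01: "integrable lborel (\<lambda>v. indicator {0..1} v *\<^sub>R F2 (x + y * v))"
  proof -
    have "integrable lborel (\<lambda>t. indicator {min x (x + y)..max x (x + y)} t *\<^sub>R F2 t)"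
      using F2 unfolding set_integrable_def .
    then have "integrable lborel (\<lambda>v. indicator {min x (x + y)..max x (x + y)} (x + y * v) *\<^sub>R F2 (x + y * v))"
      by (rule lborel_integrable_real_affine) (rule False)
    moreover have "(\<lambda>v. indicator {min x (x + y)..max x (x + y)} (x + y * v) :: real) = indicator {0..1}"
      using False by (cases "0 < y") (auto simp: indicator_def fun_eq_iff zero_le_mult_iff mult_le_0_iff
          min_def max_def)
    ultimately show ?thesis
      by metis
  qed
  have hm [measurable]: "case_prod ?h \<in> borel_measurable (borel \<Otimes>\<^sub>M borel)"
    unfolding h_eq by measurable
  have int: "integrable (lborel \<Otimes>\<^sub>M lborel) (case_prod ?h)"
  proof (rule integrableI_bounded)
    have "(\<integral>\<^sup>+p. ennreal (norm (case_prod ?h p)) \<partial>(lborel \<Otimes>\<^sub>M lborel)) = (\<integral>\<^sup>+\<theta>. \<integral>\<^sup>+v. ennreal (norm (?h \<theta> v)) \<partial>lborel \<partial>lborel)"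
      by (subst lborel.nn_integral_fst[symmetric]) (use hm in auto)
    also have "\<dots> \<le> (\<integral>\<^sup>+\<theta>. indicator {0..1} \<theta> * (\<integral>\<^sup>+v. ennreal (norm (indicator {0..1} v *\<^sub>R F2 (x + y * v))) \<partial>lborel) \<partial>(lborel :: real measure))"
      by (intro nn_integral_mono) (auto simp: indicator_def intro!: nn_integral_mono)
    also have "\<dots> = (\<integral>\<^sup>+v. ennreal (norm (indicator {0..1} v *\<^sub>R F2 (x + y * v))) \<partial>lborel)"
      by (subst nn_integral_multc) auto
    also have "\<dots> < \<infinity>"
      using int01 by (simp only: integrable_iff_bounded)
    finally show "(\<integral>\<^sup>+p. ennreal (norm (case_prod ?h p)) \<partial>(lborel \<Otimes>\<^sub>M lborel)) < \<infinity>" .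
  qed (use hm in simp)
  have "F (x + y) - F x - of_real y * F1 x = (F (x + y * 1) - (1 * y) *\<^sub>R F1 x) - (F (x + y * 0) - (0 * y) *\<^sub>R F1 x)"
    by (simp add: scaleR_conv_of_real)
  also have "\<dots> = (CLINT \<theta>|lborel. indicator {0..1} \<theta> *\<^sub>R (y *\<^sub>R (F1 (x + y * \<theta>) - F1 x)))"
  proof (rule integral_FTC_Icc[symmetric, where F="\<lambda>\<theta>. F (x + y * \<theta>) - (\<theta> * y) *\<^sub>R F1 x"])
    fix \<theta> :: real
    have "((\<lambda>\<theta>. F (x + y * \<theta>)) has_vector_derivative y *\<^sub>R F1 (x + y * \<theta>)) (at \<theta> within {0..1})"
      by (rule vector_diff_chain_within[OF _ has_vector_derivative_at_within[OF F], unfolded o_def])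
        (auto intro!: derivative_eq_intros)
    then show "((\<lambda>\<theta>. F (x + y * \<theta>) - (\<theta> * y) *\<^sub>R F1 x) has_vector_derivative y *\<^sub>R (F1 (x + y * \<theta>) - F1 x)) (at \<theta> within {0..1})"
      by (auto intro!: derivative_eq_intros simp: scaleR_diff_right)
  qed (auto intro!: continuous_intros continuous_on_compose2[OF F1_cont])
  also have "\<dots> = y\<^sup>2 *\<^sub>R (CLINT \<theta>|lborel. CLINT v|lborel. ?h \<theta> v)"
    by (subst Bochner_Integration.integral_scaleR_right[symmetric], intro Bochner_Integration.integral_cong refl)
      (auto simp: 1 indicator_def)
  also have "(CLINT \<theta>|lborel. CLINT v|lborel. ?h \<theta> v) = (CLINT v|lborel. CLINT \<theta>|lborel. ?h \<theta> v)"
    by (rule lborel_pair.Fubini_integral[OF int, symmetric])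
  also have "\<dots> = (CLINT v|lborel. ((1 - v) * indicator {0..1} v) *\<^sub>R F2 (x + y * v))"
  proof (rule Bochner_Integration.integral_cong[OF refl])
    fix v :: real
    have "(CLINT \<theta>|lborel. ?h \<theta> v) = (CLINT \<theta>|lborel. (indicator {v..1} \<theta> * indicator {0..1} v) *\<^sub>R F2 (x + y * v))"
      by (intro Bochner_Integration.integral_cong) (auto simp: indicator_def)
    also have "\<dots> = ((1 - v) * indicator {0..1} v) *\<^sub>R F2 (x + y * v)"
      by (cases "v \<in> {0..1}") auto
    finally show "(CLINT \<theta>|lborel. ?h \<theta> v) = ((1 - v) * indicator {0..1} v) *\<^sub>R F2 (x + y * v)" .
  qed
  finally show ?thesis .
qed simp

text \<open>By Taylor's formula with integral remainder, integrating \<open>F''(x + v)\<close> against this measure gives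
  the compensated small jump part of the generator.\<close>

definition small_jumps :: "real measure \<Rightarrow> real measure" where
  "small_jumps \<nu> = distr (density \<nu> (\<lambda>y. ennreal (y\<^sup>2 * indicator {-1..1} y))
     \<Otimes>\<^sub>M density lborel (\<lambda>\<theta>. ennreal ((1 - \<theta>) * indicator {0..1} \<theta>))) borel (\<lambda>(y, \<theta>). y * \<theta>)"

definition large_jumps :: "real measure \<Rightarrow> real measure" where
  "large_jumps \<nu> = density \<nu> (\<lambda>y. ennreal (1 - indicator {-1..1} y))"

locale levy_jumps =
  fixes A \<gamma> :: real and \<nu> :: "real measure"
  assumes triplet: "levy_triplet A \<gamma> \<nu>"
begin

lemma sets_\<nu> [measurable_cong, simp]: "sets \<nu> = sets borel"
  using triplet by (simp add: levy_triplet_def)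

lemma space_\<nu> [simp]: "space \<nu> = UNIV"
  using sets_eq_imp_space_eq[OF sets_\<nu>] by simp

text \<open>The factor 2 fits both jump weights: y^2 <= 2 y^2/(1 + y^2) for |y| <= 1, and 1 <= 2
  y^2/(1 + y^2) for |y| > 1.\<close>

lemma \<nu>_bound:
  assumes "c \<in> borel_measurable borel" "\<And>y. 0 \<le> c y" "\<And>y. c y \<le> 2 * (y\<^sup>2 / (1 + y\<^sup>2))"
  shows "emeasure (density \<nu> (\<lambda>y. ennreal (c y))) UNIV \<noteq> \<infinity>" "integrable \<nu> c"
proof -
  note [measurable] = assms(1)
  have "integrable \<nu> (\<lambda>y. 2 * (y\<^sup>2 / (1 + y\<^sup>2)))"
    using triplet by (intro integrable_mult_right) (simp add: levy_triplet_def)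
  then show int: "integrable \<nu> c"
    by (rule Bochner_Integration.integrable_bound) (use assms in \<open>auto intro!: AE_I2 order_trans[OF assms(3)]\<close>)
  then have "(\<integral>\<^sup>+y. ennreal (c y) \<partial>\<nu>) < \<infinity>"
    using assms(2) by (simp add: integrable_iff_bounded)
  then show "emeasure (density \<nu> (\<lambda>y. ennreal (c y))) UNIV \<noteq> \<infinity>"
    by (subst emeasure_density) auto
qed

lemma small_bound: "y\<^sup>2 * indicator {-1..1} y \<le> 2 * (y\<^sup>2 / (1 + y\<^sup>2))" for y :: real
proof (cases "y \<in> {-1..1}")
  case True
  then have "y\<^sup>2 \<le> 1"
    by (simp add: abs_square_le_1 abs_le_iff)
  then have "y\<^sup>2 * (1 + y\<^sup>2) \<le> y\<^sup>2 * 2"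
    by (intro mult_left_mono) auto
  moreover have "0 < 1 + y\<^sup>2"
    by (simp add: add_pos_nonneg)
  ultimately show ?thesis
    using True by (simp add: pos_le_divide_eq mult.commute)
qed simp

lemma large_bound: "1 - indicator {-1..1} y \<le> 2 * (y\<^sup>2 / (1 + y\<^sup>2))" for y :: real
proof (cases "y \<in> {-1..1}")
  case False
  then have "1 \<le> y\<^sup>2"
    using abs_square_le_1[of y] by (auto simp: abs_le_iff not_le)
  moreover have "0 < 1 + y\<^sup>2"
    by (simp add: add_pos_nonneg)
  ultimately show ?thesis
    using False by (simp add: pos_le_divide_eq)
qed simp

lemma finite_small: "finite_measure (density \<nu> (\<lambda>y. ennreal (y\<^sup>2 * indicator {-1..1} y)))"
  using \<nu>_bound(1)[of "\<lambda>y. y\<^sup>2 * indicator {-1..1} y", OF _ _ small_bound] by (intro finite_measureI) auto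

lemma finite_triangle: "finite_measure (density lborel (\<lambda>\<theta>::real. ennreal ((1 - \<theta>) * indicator {0..1} \<theta>)))"
proof (rule finite_measureI)
  have "emeasure (density lborel (\<lambda>\<theta>::real. ennreal ((1 - \<theta>) * indicator {0..1} \<theta>))) UNIV =
      (\<integral>\<^sup>+\<theta>. ennreal ((1 - \<theta>) * indicator {0..1} \<theta>) \<partial>lborel)"
    by (simp add: emeasure_density)
  also have "\<dots> \<le> (\<integral>\<^sup>+\<theta>. indicator {0..1::real} \<theta> \<partial>lborel)"
    by (intro nn_integral_mono) (auto simp: indicator_def)
  also have "\<dots> < \<infinity>"
    by simp
  finally show "emeasure (density lborel (\<lambda>\<theta>::real. ennreal ((1 - \<theta>) * indicator {0..1} \<theta>)))
      (space (density lborel (\<lambda>\<theta>. ennreal ((1 - \<theta>) * indicator {0..1} \<theta>)))) \<noteq> \<infinity>"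
    by simp
qed

lemma conv_small_jumps: "conv_measure (small_jumps \<nu>)"
proof (intro conv_measure.intro conv_measure_axioms.intro)
  interpret S: finite_measure "density \<nu> (\<lambda>y. ennreal (y\<^sup>2 * indicator {-1..1} y))" by (rule finite_small)
  interpret T: finite_measure "density lborel (\<lambda>\<theta>::real. ennreal ((1 - \<theta>) * indicator {0..1} \<theta>))" by (rule finite_triangle)
  show "finite_measure (small_jumps \<nu>)"
    unfolding small_jumps_def
    by (intro finite_measure.finite_measure_distr finite_measure_pair_measure S.finite_measure_axioms T.finite_measure_axioms) measurable
qed (simp add: small_jumps_def)

lemma conv_large_jumps: "conv_measure (large_jumps \<nu>)"
proof (intro conv_measure.intro conv_measure_axioms.intro)
  show "finite_measure (large_jumps \<nu>)"
    unfolding large_jumps_def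
    using \<nu>_bound(1)[of "\<lambda>y. 1 - indicator {-1..1} y", OF _ _ large_bound]
    by (intro finite_measureI) (auto simp: indicator_def)
qed (simp add: large_jumps_def)

text \<open>\<open>\<nu>\<close> itself may fail to be \<sigma>-finite. Fubini is carried out for
  the finite measure with density y^2 on [-1, 1], and the density is unfolded afterwards.\<close>

lemma small_jumps_integral:
  fixes h :: "real \<Rightarrow> complex"
  assumes [measurable]: "h \<in> borel_measurable borel" and h: "integrable (small_jumps \<nu>) h"
  defines "t \<equiv> \<lambda>y. (y\<^sup>2 * indicator {-1..1} y) *\<^sub>R (CLINT \<theta>|lborel. ((1 - \<theta>) * indicator {0..1} \<theta>) *\<^sub>R h (y * \<theta>))"
  shows "(CLINT v|small_jumps \<nu>. h v) = (CLINT y|\<nu>. t y)" "integrable \<nu> t"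
proof -
  let ?S = "density \<nu> (\<lambda>y. ennreal (y\<^sup>2 * indicator {-1..1} y))"
  let ?T = "density lborel (\<lambda>\<theta>::real. ennreal ((1 - \<theta>) * indicator {0..1} \<theta>))"
  interpret S: finite_measure ?S by (rule finite_small)
  interpret T: finite_measure ?T by (rule finite_triangle)
  interpret P: pair_sigma_finite ?S ?T ..
  have 1: "integrable (?S \<Otimes>\<^sub>M ?T) (\<lambda>(y, \<theta>). h (y * \<theta>))"
    using h unfolding small_jumps_def by (subst (asm) integrable_distr_eq) (auto simp: case_prod_beta')
  have T: "(CLINT \<theta>|?T. h (y * \<theta>)) = (CLINT \<theta>|lborel. ((1 - \<theta>) * indicator {0..1} \<theta>) *\<^sub>R h (y * \<theta>))" for y
    by (rule integral_density) (auto simp: indicator_def)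
  have 2: "integrable ?S (\<lambda>y. CLINT \<theta>|lborel. ((1 - \<theta>) * indicator {0..1} \<theta>) *\<^sub>R h (y * \<theta>))"
    using P.integrable_fst[OF 1] unfolding T .
  then show "integrable \<nu> t"
    unfolding t_def by (subst (asm) integrable_density) (auto simp: indicator_def)
  have "(CLINT v|small_jumps \<nu>. h v) = (CLINT p|(?S \<Otimes>\<^sub>M ?T). (\<lambda>(y, \<theta>). h (y * \<theta>)) p)"
    unfolding small_jumps_def by (subst integral_distr) (auto simp: case_prod_beta')
  also have "\<dots> = (CLINT y|?S. CLINT \<theta>|?T. h (y * \<theta>))"
    using P.integral_fst[OF 1] by simp
  also have "\<dots> = (CLINT y|\<nu>. t y)"
    unfolding T t_def by (rule integral_density) (auto simp: indicator_def)
  finally show "(CLINT v|small_jumps \<nu>. h v) = (CLINT y|\<nu>. t y)" .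
qed

lemma large_jumps_integral:
  fixes h :: "real \<Rightarrow> complex"
  assumes [measurable]: "h \<in> borel_measurable borel" and h: "\<And>y. norm (h y) \<le> C"
  shows "(CLINT y|large_jumps \<nu>. h y) = (CLINT y|\<nu>. (1 - indicator {-1..1} y) *\<^sub>R h y)"
    "integrable \<nu> (\<lambda>y. (1 - indicator {-1..1} y :: real) *\<^sub>R h y)"
proof -
  interpret J: conv_measure "large_jumps \<nu>" by (rule conv_large_jumps)
  have "integrable (large_jumps \<nu>) h"
    by (rule J.integrable_const_bound[where B=C]) (auto simp: h)
  then show "integrable \<nu> (\<lambda>y. (1 - indicator {-1..1} y :: real) *\<^sub>R h y)"
    unfolding large_jumps_def by (subst (asm) integrable_density) (auto simp: indicator_def)
  show "(CLINT y|large_jumps \<nu>. h y) = (CLINT y|\<nu>. (1 - indicator {-1..1} y) *\<^sub>R h y)"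
    unfolding large_jumps_def by (rule integral_density) (auto simp: indicator_def)
qed

text \<open>On [-1, 1] Taylor's formula turns the compensated increment into the integrand of
  \<open>small_jumps_integral\<close>; outside, the compensator vanishes and a bounded increment is
  integrated against a finite measure. Integrability is demanded at the given x, because for a
  merely integrable F2 it can fail on a null set of x.\<close>

lemma jump_integral:
  fixes F F1 F2 :: "real \<Rightarrow> complex"
  assumes F: "\<And>x. (F has_vector_derivative F1 x) (at x)"
    and F1_cont: "continuous_on UNIV F1"
    and [measurable]: "F2 \<in> borel_measurable borel"
    and F2: "\<And>u v. set_integrable lborel {u..v} F2"
    and F1: "\<And>u v. u \<le> v \<Longrightarrow> F1 v - F1 u = (CLINT t:{u..v}|lborel. F2 t)"
    and bound: "\<And>x. norm (F x) \<le> C"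
    and int: "integrable (small_jumps \<nu>) (\<lambda>v. F2 (x + v))"
  shows "(CLINT y|\<nu>. F (x + y) - F x - of_real (y * indicator {-1..1} y) * F1 x) =
    (CLINT v|small_jumps \<nu>. F2 (x + v)) + ((CLINT y|large_jumps \<nu>. F (x + y))
      - of_real (measure (large_jumps \<nu>) UNIV) * F x)"
proof -
  interpret J: conv_measure "large_jumps \<nu>" by (rule conv_large_jumps)
  have [measurable]: "F \<in> borel_measurable borel"
    using F by (intro borel_measurable_continuous_onI continuous_at_imp_continuous_on)
      (auto intro: has_vector_derivative_continuous)
  let ?s = "\<lambda>y. (y\<^sup>2 * indicator {-1..1} y) *\<^sub>R (CLINT \<theta>|lborel. ((1 - \<theta>) * indicator {0..1} \<theta>) *\<^sub>R F2 (x + y * \<theta>))"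
  let ?l = "\<lambda>y. (1 - indicator {-1..1} y :: real) *\<^sub>R (F (x + y) - F x)"
  have pw: "F (x + y) - F x - of_real (y * indicator {-1..1} y) * F1 x = ?s y + ?l y" for y
    using taylor_integral[OF F F1_cont _ F2 F1, of x y] by (auto simp: indicator_def)
  have s: "(CLINT v|small_jumps \<nu>. F2 (x + v)) = (CLINT y|\<nu>. ?s y)" "integrable \<nu> ?s"
    using small_jumps_integral[OF _ int] by simp_all
  have bl: "norm (F (x + y) - F x) \<le> 2 * C" for y
    using norm_triangle_ineq4[of "F (x + y)" "F x"] bound[of x] bound[of "x + y"] by simp
  have l: "(CLINT y|large_jumps \<nu>. F (x + y) - F x) = (CLINT y|\<nu>. ?l y)" "integrable \<nu> ?l"
    using large_jumps_integral[of "\<lambda>y. F (x + y) - F x", OF _ bl] by simp_all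
  have "(CLINT y|large_jumps \<nu>. F (x + y) - F x) = (CLINT y|large_jumps \<nu>. F (x + y)) - of_real (measure (large_jumps \<nu>) UNIV) * F x"
    by (subst Bochner_Integration.integral_diff)
      (auto intro!: J.integrable_const_bound[where B=C] simp: bound scaleR_conv_of_real)
  then show ?thesis
    unfolding pw using s l by simp
qed

text \<open>The exponent is minus the generator applied to exp(i z x) at x = 0, so
  \<open>jump_integral\<close> applies with F'' = -z^2 exp(i z x).\<close>

lemma levy_exponent_jumps:
  "levy_exponent A \<gamma> \<nu> z = A / 2 * z\<^sup>2 - \<i> * \<gamma> * z + z\<^sup>2 * char (small_jumps \<nu>) z
      + measure (large_jumps \<nu>) UNIV - char (large_jumps \<nu>) z"
proof -
  interpret K: conv_measure "small_jumps \<nu>" by (rule conv_small_jumps)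
  let ?F = "\<lambda>x. iexp (z * x)" and ?F1 = "\<lambda>x. \<i> * z * iexp (z * x)" and ?F2 = "\<lambda>x. - (z\<^sup>2) * iexp (z * x)"
  have d: "(?F has_vector_derivative ?F1 x) (at x)" "(?F1 has_vector_derivative ?F2 x) (at x within S)" for x S
  proof -
    have "((\<lambda>w. exp (\<i> * (complex_of_real z * w))) has_field_derivative \<i> * z * exp (\<i> * (complex_of_real z * of_real x))) (at (of_real x))"
      by (auto intro!: derivative_eq_intros)
    then show "(?F has_vector_derivative ?F1 x) (at x)"
      using has_vector_derivative_real_field by fastforce
    have "((\<lambda>w. \<i> * z * exp (\<i> * (complex_of_real z * w))) has_field_derivative - (complex_of_real (z\<^sup>2)) * exp (\<i> * (complex_of_real z * of_real x))) (at (of_real x))"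
      by (auto intro!: derivative_eq_intros simp: power2_eq_square mult_ac)
    then show "(?F1 has_vector_derivative ?F2 x) (at x within S)"
      using has_vector_derivative_real_field by fastforce
  qed
  have "(CLINT y|\<nu>. ?F (0 + y) - ?F 0 - of_real (y * indicator {-1..1} y) * ?F1 0) =
    (CLINT v|small_jumps \<nu>. ?F2 (0 + v)) + ((CLINT y|large_jumps \<nu>. ?F (0 + y))
      - of_real (measure (large_jumps \<nu>) UNIV) * ?F 0)"
  proof (rule jump_integral[OF d(1)])
    show "?F1 v - ?F1 u = (CLINT t:{u..v}|lborel. ?F2 t)" if "u \<le> v" for u v
      unfolding set_lebesgue_integral_def
      by (rule integral_FTC_Icc[symmetric, OF that d(2)]) (intro continuous_intros)
    show "set_integrable lborel {u..v} ?F2" for u v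
      by (intro borel_integrable_atLeastAtMost' continuous_intros)
    show "integrable (small_jumps \<nu>) (\<lambda>v. ?F2 (0 + v))"
      by (rule K.integrable_const_bound[where B="z\<^sup>2"]) (auto simp: norm_mult norm_power)
    show "norm (?F x) \<le> 1" for x
      by simp
  qed (auto intro!: continuous_intros)
  moreover have "(CLINT y|\<nu>. ?F (0 + y) - ?F 0 - of_real (y * indicator {-1..1} y) * ?F1 0) =
      (CLINT x|\<nu>. iexp (x * z) - 1 - \<i> * of_real (x * z * indicator {-1..1} x))"
    by (intro Bochner_Integration.integral_cong refl) (simp add: mult_ac)
  ultimately have jumps: "(CLINT x|\<nu>. iexp (x * z) - 1 - \<i> * of_real (x * z * indicator {-1..1} x)) =
      - (z\<^sup>2) * char (small_jumps \<nu>) z + (char (large_jumps \<nu>) z - measure (large_jumps \<nu>) UNIV)"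
    unfolding char_def by simp
  show ?thesis
    unfolding levy_exponent_def jumps by (simp add: algebra_simps)
qed

end

lemmas sets_\<nu> = levy_jumps.sets_\<nu>[OF levy_jumps.intro]
  and \<nu>_bound = levy_jumps.\<nu>_bound[OF levy_jumps.intro]
  and conv_small_jumps = levy_jumps.conv_small_jumps[OF levy_jumps.intro]
  and conv_large_jumps = levy_jumps.conv_large_jumps[OF levy_jumps.intro]
  and jump_integral = levy_jumps.jump_integral[OF levy_jumps.intro]
  and levy_exponent_jumps = levy_jumps.levy_exponent_jumps[OF levy_jumps.intro]

section \<open>The class of test functions\<close>

lemma has_vector_derivative_union:
  assumes "(f has_vector_derivative d) (at x within S)" "(f has_vector_derivative d) (at x within T)"
  shows "(f has_vector_derivative d) (at x within (S \<union> T))"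
  using assms
  unfolding has_vector_derivative_def has_derivative_within
  by (auto simp: at_within_union intro: filterlim_sup)

locale segment_family =
  fixes n :: nat and a b :: "nat \<Rightarrow> real" and \<Delta> :: "real set"
  assumes n: "1 \<le> n"
    and ab: "\<And>k. 1 \<le> k \<Longrightarrow> k \<le> n \<Longrightarrow> a k < b k"
    and ba: "\<And>k. 1 \<le> k \<Longrightarrow> k < n \<Longrightarrow> b k < a (Suc k)"
    and \<Delta>: "\<Delta> = segments n a b"
begin

lemma ordered: "1 \<le> j \<Longrightarrow> j < k \<Longrightarrow> k \<le> n \<Longrightarrow> b j < a k"
proof (induction k)
  case (Suc k)
  show ?case
  proof (cases "j = k")
    case True
    then show ?thesis using ba[of k] Suc.prems by simp
  next
    case False
    then have "b j < a k" using Suc by simp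
    also have "a k < b k" using Suc.prems False by (intro ab) auto
    also have "b k < a (Suc k)" using Suc.prems False by (intro ba) auto
    finally show ?thesis .
  qed
qed simp

lemma unique_segment:
  assumes "j \<in> {1..n}" "k \<in> {1..n}" "x \<in> {a j..b j}" "x \<in> {a k..b k}"
  shows "j = k"
  proof (rule ccontr)
  assume "j \<noteq> k"
  then have "b j < a k \<or> b k < a j"
    using ordered[of j k] ordered[of k j] assms(1,2) by (cases "j < k") simp_all
  then show False
    using assms(3,4) by auto
qed

lemma indicator_\<Delta>: "indicator \<Delta> x = (\<Sum>k\<in>{1..n}. indicator {a k..b k} x :: real)"
proof (cases "x \<in> \<Delta>")
  case True
  then obtain k where k: "k \<in> {1..n}" "x \<in> {a k..b k}"
    by (auto simp: \<Delta> segments_def)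
  have "(\<Sum>j\<in>{1..n}. indicator {a j..b j} x :: real) = (\<Sum>j\<in>{1..n}. if j = k then 1 else 0)"
  proof (rule sum.cong[OF refl])
    fix j assume "j \<in> {1..n}"
    then have "x \<in> {a j..b j} \<longleftrightarrow> j = k"
      using k unique_segment[of j k x] by blast
    then show "indicator {a j..b j} x = (if j = k then 1 else 0 :: real)"
      by (simp add: indicator_def)
  qed
  then show ?thesis
    using True k by simp
next
  case False
  then show ?thesis
    by (auto simp: \<Delta> segments_def indicator_def)
qed

lemma compact_\<Delta>: "compact \<Delta>"
  unfolding \<Delta> segments_def by (intro compact_UN) auto

lemma closed_\<Delta>: "closed \<Delta>"
  by (rule compact_imp_closed[OF compact_\<Delta>])

lemma \<Delta>_borel [measurable]: "\<Delta> \<in> sets borel"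
  using closed_\<Delta> by auto

lemma emeasure_\<Delta>: "emeasure lborel \<Delta> < \<infinity>"
  using emeasure_bounded_finite[OF compact_imp_bounded[OF compact_\<Delta>]] by simp

definition endpoints :: "real set" where "endpoints = a ` {1..n} \<union> b ` {1..n}"

lemma finite_endpoints: "finite endpoints"
  by (simp add: endpoints_def)

lemma interior_\<Delta>:
  assumes "x \<in> \<Delta>" "x \<notin> endpoints"
  obtains k where "k \<in> {1..n}" "x \<in> {a k<..<b k}" "{a k<..<b k} \<subseteq> \<Delta>"
proof -
  from assms(1) obtain k where k: "k \<in> {1..n}" "x \<in> {a k..b k}"
    by (auto simp: \<Delta> segments_def)
  then have "x \<in> {a k<..<b k}"
    using assms(2) by (auto simp: endpoints_def less_le)
  moreover have "{a k<..<b k} \<subseteq> \<Delta>"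
    using k by (auto simp: \<Delta> segments_def)
  ultimately show thesis using k that by blast
qed

lemma at_within_\<Delta>: "x \<in> \<Delta> \<Longrightarrow> x \<notin> endpoints \<Longrightarrow> at x within \<Delta> = at x"
  by (erule interior_\<Delta>, assumption) (rule at_within_open_subset, auto)

end

section \<open>Extension by zero of a function of class \<open>C_Delta\<close>\<close>

locale C_Delta_function = segment_family n a b \<Delta> for n a b \<Delta> +
  fixes p :: real and f :: "real \<Rightarrow> complex"
  assumes p: "1 < p" and f: "f \<in> C_Delta p n a b"
begin

abbreviation g1 :: "real \<Rightarrow> complex" where "g1 \<equiv> deriv_on \<Delta> f"
abbreviation g2 :: "real \<Rightarrow> complex" where "g2 \<equiv> deriv_on \<Delta> g1"

definition F :: "real \<Rightarrow> complex" where "F = trunc \<Delta> f"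
definition F1 :: "real \<Rightarrow> complex" where "F1 = trunc \<Delta> g1"
definition F2 :: "real \<Rightarrow> complex" where "F2 = trunc \<Delta> g2"

lemma C_Delta_facts:
  "\<forall>x\<in>\<Delta>. f differentiable (at x within \<Delta>)" "in_Lp p \<Delta> g2"
  "\<forall>k\<in>{1..n}. \<forall>x\<in>{a k..b k}. g1 x = g1 (a k) + (CLINT y:{a k..x}|lborel. g2 y)"
  "\<forall>k\<in>{1..n}. f (a k) = 0 \<and> f (b k) = 0 \<and> g1 (a k) = 0 \<and> g1 (b k) = 0"
  using f unfolding C_Delta_def Let_def \<Delta>[symmetric] mem_Collect_eq by blast+

lemma f_diff: "x \<in> \<Delta> \<Longrightarrow> f differentiable (at x within \<Delta>)"
  using C_Delta_facts(1) by blast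

lemmas g2_Lp = C_Delta_facts(2)

lemma g1_integral:
  "k \<in> {1..n} \<Longrightarrow> x \<in> {a k..b k} \<Longrightarrow> g1 x = g1 (a k) + (CLINT y:{a k..x}|lborel. g2 y)"
  using C_Delta_facts(3) by blast

lemma ends:
  "k \<in> {1..n} \<Longrightarrow> f (a k) = 0" "k \<in> {1..n} \<Longrightarrow> f (b k) = 0"
  "k \<in> {1..n} \<Longrightarrow> g1 (a k) = 0" "k \<in> {1..n} \<Longrightarrow> g1 (b k) = 0"
  using C_Delta_facts(4) by blast+

lemma F_outside: "x \<notin> \<Delta> \<Longrightarrow> F x = 0" "x \<notin> \<Delta> \<Longrightarrow> F1 x = 0" "x \<notin> \<Delta> \<Longrightarrow> F2 x = 0"
  by (auto simp: F_def F1_def F2_def trunc_def)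

lemma F_endpoint: "x \<in> endpoints \<Longrightarrow> F x = 0" "x \<in> endpoints \<Longrightarrow> F1 x = 0"
  using ends by (auto simp: endpoints_def F_def F1_def trunc_def)

text \<open>At an endpoint the derivative from inside is 0 by the boundary conditions, and the
  extension is 0 outside, so the two sides glue. The endpoint belongs to \<Delta>, hence
  \<open>insert x\<close> on the outer side.\<close>

lemma F_deriv: "(F has_vector_derivative F1 x) (at x)"
proof (cases "x \<in> \<Delta>")
  case False
  have "((\<lambda>_. 0) has_vector_derivative 0) (at x)"
    by simp
  then have "(F has_vector_derivative 0) (at x)"
    by (rule has_vector_derivative_transform_within_open[where S="- \<Delta>"])
      (use False closed_\<Delta> F_outside in auto)
  then show ?thesis
    using False by (simp add: F_outside)
next
  case True
  have "(f has_vector_derivative g1 x) (at x within \<Delta>)"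
    using f_diff[OF True] unfolding deriv_on_def by (simp add: vector_derivative_works)
  then have within: "(F has_vector_derivative F1 x) (at x within \<Delta>)"
    using True by (auto simp: F1_def trunc_def F_def intro: has_vector_derivative_transform[rotated 2])
  show ?thesis
  proof (cases "x \<in> endpoints")
    case False
    then show ?thesis
      using within True by (simp add: at_within_\<Delta>)
  next
    case endpoint: True
    have "((\<lambda>_. 0) has_vector_derivative 0) (at x within insert x (- \<Delta>))"
      by simp
    then have "(F has_vector_derivative 0) (at x within insert x (- \<Delta>))"
      by (rule has_vector_derivative_transform[rotated 2]) (use F_outside F_endpoint endpoint in auto)
    then have "(F has_vector_derivative F1 x) (at x within (\<Delta> \<union> insert x (- \<Delta>)))"
      using within endpoint by (intro has_vector_derivative_union) (simp_all add: F_endpoint)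
    moreover have "\<Delta> \<union> insert x (- \<Delta>) = UNIV" by auto
    ultimately show ?thesis by simp
  qed
qed

lemma F2_scale: "F2 x = indicator \<Delta> x *\<^sub>R g2 x"
  by (simp add: F2_def trunc_def indicator_def)

lemma measurable_F2 [measurable]: "F2 \<in> borel_measurable borel"
  using g2_Lp by (simp add: in_Lp_def set_borel_measurable_def F2_scale[abs_def])

lemma integrable_indicator_\<Delta>: "integrable lborel (indicator \<Delta> :: real \<Rightarrow> real)"
  using emeasure_\<Delta> by (simp add: integrable_indicator_iff)

text \<open>\<Delta> has finite measure, and y <= 1 + y powr p for y >= 0.\<close>

lemma integrable_F2: "integrable lborel F2"
proof (rule Bochner_Integration.integrable_bound)
  show "integrable lborel (\<lambda>x. indicator \<Delta> x + indicator \<Delta> x *\<^sub>R (cmod (g2 x) powr p))"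
    using g2_Lp integrable_indicator_\<Delta> by (simp add: in_Lp_def set_integrable_def)
  have "y \<le> 1 + y powr p" if "0 \<le> y" for y :: real
  proof (cases "y \<le> 1")
    case False
    then have "y powr 1 \<le> y powr p"
      using p by (intro powr_mono) auto
    then show ?thesis
      using False by simp
  qed (simp add: add_increasing2)
  then show "AE x in lborel. norm (F2 x) \<le> norm (indicator \<Delta> x + indicator \<Delta> x *\<^sub>R (cmod (g2 x) powr p))"
    by (auto simp: F2_scale indicator_def)
qed (use measurable_F2 in simp)

lemma segment_integrable: "k \<in> {1..n} \<Longrightarrow> S \<in> sets borel \<Longrightarrow> S \<subseteq> {a k..b k} \<Longrightarrow>
    integrable lborel (\<lambda>t. indicator S t *\<^sub>R g2 t)"
proof -
  assume k: "k \<in> {1..n}" "S \<in> sets borel" "S \<subseteq> {a k..b k}"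
  then have "S \<subseteq> \<Delta>"
    by (auto simp: \<Delta> segments_def)
  then have "(\<lambda>t. indicator S t *\<^sub>R g2 t) = (\<lambda>t. indicator S t *\<^sub>R F2 t)"
    by (auto simp: F2_scale indicator_def fun_eq_iff)
  moreover have "integrable lborel (\<lambda>t. indicator S t *\<^sub>R F2 t)"
    using k(2) integrable_F2 by (intro integrable_mult_indicator) auto
  ultimately show ?thesis by simp
qed

text \<open>\<open>g1\<close> vanishes at both ends, so the integral of \<open>g2\<close> over the
  whole segment is 0 and the tail from x is minus the initial part, which is
  \<open>g1 x\<close>.\<close>

lemma segment_tail:
  assumes k: "k \<in> {1..n}"
  shows "(CLINT t|lborel. indicator ({x..} \<inter> {a k..b k}) t *\<^sub>R g2 t) = - (indicator {a k..b k} x *\<^sub>R g1 x)"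
proof -
  have akbk: "a k < b k" using k ab by auto
  have full: "(CLINT t|lborel. indicator {a k..b k} t *\<^sub>R g2 t) = 0"
    using g1_integral[OF k, of "b k"] akbk ends k by (simp add: set_lebesgue_integral_def)
  consider "x \<le> a k" | "a k < x" "x \<le> b k" | "b k < x" by linarith
  then show ?thesis
  proof cases
    case 1
    then have "{x..} \<inter> {a k..b k} = {a k..b k}" by auto
    then show ?thesis
      using full 1 ends k by (cases "x = a k") auto
  next
    case 2
    have "(CLINT t|lborel. indicator ({x..} \<inter> {a k..b k}) t *\<^sub>R g2 t) =
        (CLINT t|lborel. indicator {a k..b k} t *\<^sub>R g2 t - indicator {a k..<x} t *\<^sub>R g2 t)"
      using 2 by (intro Bochner_Integration.integral_cong) (auto simp: indicator_def)
    also have "\<dots> = - (CLINT t|lborel. indicator {a k..<x} t *\<^sub>R g2 t)"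
      using 2 k by (subst Bochner_Integration.integral_diff) (auto intro!: segment_integrable simp: full)
    also have "(CLINT t|lborel. indicator {a k..<x} t *\<^sub>R g2 t) = (CLINT t|lborel. indicator {a k..x} t *\<^sub>R g2 t)"
    proof (rule integral_cong_AE)
      show "(\<lambda>t. indicator {a k..<x} t *\<^sub>R g2 t) \<in> borel_measurable lborel"
        using 2 by (intro borel_measurable_integrable[OF segment_integrable[OF k]]) auto
      show "(\<lambda>t. indicator {a k..x} t *\<^sub>R g2 t) \<in> borel_measurable lborel"
        using 2 by (intro borel_measurable_integrable[OF segment_integrable[OF k]]) auto
      show "AE t in lborel. indicator {a k..<x} t *\<^sub>R g2 t = indicator {a k..x} t *\<^sub>R g2 t"
        using AE_lborel_singleton[of x] by eventually_elim (auto simp: indicator_def)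
    qed
    also have "\<dots> = g1 x"
      using g1_integral[OF k, of x] 2 ends k by (simp add: set_lebesgue_integral_def)
    finally show ?thesis
      using 2 by simp
  next
    case 3
    then have "{x..} \<inter> {a k..b k} = {}" by auto
    then show ?thesis
      using 3 by simp
  qed
qed

text \<open>The tail may start anywhere on the line and cross several segments, since each full
  segment contributes 0. This is the form of F1' = F2 that \<open>Exp_resolvent\<close>
  requires.\<close>

lemma F1_tail: "F1 x = - (CLINT t:{x..}|lborel. F2 t)"
proof -
  have "indicator {x..} t *\<^sub>R F2 t = (\<Sum>k\<in>{1..n}. indicator ({x..} \<inter> {a k..b k}) t *\<^sub>R g2 t)" for t
    unfolding F2_scale indicator_\<Delta>
    by (simp only: scaleR_sum_left scaleR_sum_right indicator_inter_arith scaleR_scaleR)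
  then have "(CLINT t:{x..}|lborel. F2 t) = (CLINT t|lborel. \<Sum>k\<in>{1..n}. indicator ({x..} \<inter> {a k..b k}) t *\<^sub>R g2 t)"
    by (simp add: set_lebesgue_integral_def)
  also have "\<dots> = (\<Sum>k\<in>{1..n}. CLINT t|lborel. indicator ({x..} \<inter> {a k..b k}) t *\<^sub>R g2 t)"
    by (intro Bochner_Integration.integral_sum segment_integrable) auto
  also have "\<dots> = (\<Sum>k\<in>{1..n}. - (indicator {a k..b k} x *\<^sub>R g1 x))"
    by (intro sum.cong refl segment_tail)
  also have "\<dots> = - (indicator \<Delta> x *\<^sub>R g1 x)"
    unfolding indicator_\<Delta> by (simp only: sum_negf scaleR_sum_left)
  finally show ?thesis
    by (simp add: F1_def trunc_def indicator_def)
qed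

lemma F1_diff:
  assumes "u \<le> v"
  shows "F1 v - F1 u = (CLINT t:{u..v}|lborel. F2 t)"
proof -
  have int: "integrable lborel (\<lambda>t. indicator S t *\<^sub>R F2 t)" if "S \<in> sets borel" for S
    using that integrable_F2 by (intro integrable_mult_indicator) auto
  have "F1 v - F1 u = (CLINT t|lborel. indicator {u..} t *\<^sub>R F2 t - indicator {v..} t *\<^sub>R F2 t)"
    unfolding F1_tail set_lebesgue_integral_def by (subst Bochner_Integration.integral_diff) (auto intro!: int)
  also have "\<dots> = (CLINT t:{u..v}|lborel. F2 t)"
    unfolding set_lebesgue_integral_def
  proof (rule integral_cong_AE)
    show "AE t in lborel. indicator {u..} t *\<^sub>R F2 t - indicator {v..} t *\<^sub>R F2 t = indicator {u..v} t *\<^sub>R F2 t"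
      using AE_lborel_singleton[of v] by eventually_elim (use assms in \<open>auto simp: indicator_def\<close>)
  qed measurable
  finally show ?thesis .
qed

lemma F1_cont: "continuous_on UNIV F1"
  unfolding continuous_on_sequentially
proof safe
  fix u and x :: real assume u: "u \<longlonglongrightarrow> x"
  have "(\<lambda>n. CLINT t|lborel. indicator {u n..} t *\<^sub>R F2 t) \<longlonglongrightarrow> (CLINT t|lborel. indicator {x..} t *\<^sub>R F2 t)"
  proof (rule integral_dominated_convergence[where w="\<lambda>t. norm (F2 t)"])
    show "AE t in lborel. (\<lambda>n. indicator {u n..} t *\<^sub>R F2 t) \<longlonglongrightarrow> indicator {x..} t *\<^sub>R F2 t"
      using AE_lborel_singleton[of x]
    proof eventually_elim
      case (elim t)
      show ?case
      proof (cases "x < t")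
        case True
        then have "\<forall>\<^sub>F n in sequentially. u n < t"
          by (rule order_tendstoD(2)[OF u])
        then have "\<forall>\<^sub>F n in sequentially. indicator {u n..} t *\<^sub>R F2 t = indicator {x..} t *\<^sub>R F2 t"
          by eventually_elim (use True in \<open>simp add: indicator_def\<close>)
        then show ?thesis
          by (rule tendsto_eventually)
      next
        case False
        then have "t < x" using elim by simp
        then have "\<forall>\<^sub>F n in sequentially. t < u n"
          by (rule order_tendstoD(1)[OF u])
        then have "\<forall>\<^sub>F n in sequentially. indicator {u n..} t *\<^sub>R F2 t = indicator {x..} t *\<^sub>R F2 t"
          by eventually_elim (use \<open>t < x\<close> in \<open>simp add: indicator_def\<close>)
        then show ?thesis
          by (rule tendsto_eventually)
      qed
    qed
    show "AE t in lborel. norm (indicator {u n..} t *\<^sub>R F2 t) \<le> norm (F2 t)" for n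
      by (auto simp: indicator_def)
  qed (use integrable_F2 in auto)
  then show "(F1 \<circ> u) \<longlonglongrightarrow> F1 x"
    unfolding o_def F1_tail set_lebesgue_integral_def by (rule tendsto_minus)
qed

lemma F_cont: "continuous_on UNIV F"
  using F_deriv by (intro continuous_at_imp_continuous_on) (auto intro: has_vector_derivative_continuous)

lemma measurable_F [measurable]: "F \<in> borel_measurable borel" "F1 \<in> borel_measurable borel"
  using F_cont F1_cont by (auto intro: borel_measurable_continuous_onI)

lemma bounded_F: obtains C where "\<And>x. norm (F x) \<le> C" "\<And>x. norm (F1 x) \<le> C"
proof -
  have "bounded (F ` \<Delta>)" "bounded (F1 ` \<Delta>)"
    using F_cont F1_cont
    by (auto intro!: compact_imp_bounded compact_continuous_image compact_\<Delta> intro: continuous_on_subset)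
  then obtain C1 C2 where C: "\<And>x. x \<in> \<Delta> \<Longrightarrow> norm (F x) \<le> C1" "\<And>x. x \<in> \<Delta> \<Longrightarrow> norm (F1 x) \<le> C2"
    unfolding bounded_iff by auto
  show thesis
  proof (rule that)
    show "norm (F x) \<le> max 0 (max C1 C2)" "norm (F1 x) \<le> max 0 (max C1 C2)" for x
      using C[of x] F_outside[of x] by (cases "x \<in> \<Delta>"; force simp: le_max_iff_disj)+
  qed
qed

lemma integrable_F: "integrable lborel F" "integrable lborel F1"
proof -
  obtain C where C: "\<And>x. norm (F x) \<le> C" "\<And>x. norm (F1 x) \<le> C"
    by (rule bounded_F) blast
  have C0: "0 \<le> C" using C(1)[of 0] norm_ge_zero order_trans by blast
  have i: "integrable lborel (\<lambda>x. C * indicator \<Delta> x)"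
    using integrable_indicator_\<Delta> by simp
  show "integrable lborel F"
    by (rule Bochner_Integration.integrable_bound[OF i]) (use C C0 F_outside in \<open>auto simp: indicator_def\<close>)
  show "integrable lborel F1"
    by (rule Bochner_Integration.integrable_bound[OF i]) (use C C0 F_outside in \<open>auto simp: indicator_def\<close>)
qed

lemma F_tail: "F x = - (CLINT t:{x..}|lborel. F1 t)"
proof -
  obtain B where "\<And>y. y \<in> \<Delta> \<Longrightarrow> norm y \<le> B"
    using compact_imp_bounded[OF compact_\<Delta>] unfolding bounded_iff by auto
  then have B: "y \<notin> \<Delta>" if "B < y" for y
    using that by fastforce
  define h where "h = max x B + 1"
  have h: "x \<le> h" "F h = 0" "\<And>t. h \<le> t \<Longrightarrow> F1 t = 0"
    using B by (auto simp: h_def intro!: F_outside)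
  have "(CLINT t:{x..}|lborel. F1 t) = (CLINT t|lborel. indicator {x..h} t *\<^sub>R F1 t)"
    unfolding set_lebesgue_integral_def using h(3)
    by (intro Bochner_Integration.integral_cong) (auto simp: indicator_def)
  also have "\<dots> = F h - F x"
    by (rule integral_FTC_Icc[OF h(1)])
      (auto intro: has_vector_derivative_at_within F_deriv continuous_on_subset[OF F1_cont])
  finally show ?thesis
    using h by simp
qed

lemma exp_test_F: obtains C where "exp_test C F F1 F2"
proof -
  obtain C where C: "\<And>x. norm (F x) \<le> C" "\<And>x. norm (F1 x) \<le> C"
    by (rule bounded_F) blast
  have "exp_test C F F1 F2"
    unfolding exp_test_def using integrable_F integrable_F2 C
    by (auto intro!: Exp_resolvent[where C=C] integrable_Exp F_tail F1_tail)
  then show thesis by (rule that)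
qed

text \<open>Holds even where \<open>F1\<close> is not differentiable: inside a segment
  \<open>F1\<close> and \<open>g1\<close> have the same candidate derivatives, so
  \<open>vector_derivative\<close> makes the same arbitrary choice for both.\<close>

lemma second_derivative:
  assumes "x \<notin> endpoints"
  shows "vector_derivative (\<lambda>y. vector_derivative F (at y)) (at x) = F2 x"
proof -
  have F1: "(\<lambda>y. vector_derivative F (at y)) = F1"
    using vector_derivative_at[OF F_deriv] by auto
  show ?thesis
  proof (cases "x \<in> \<Delta>")
    case True
    obtain k where k: "k \<in> {1..n}" "x \<in> {a k<..<b k}" "{a k<..<b k} \<subseteq> \<Delta>"
      by (rule interior_\<Delta>[OF True assms])
    have eq: "F1 y = g1 y" if "y \<in> {a k<..<b k}" for y
      using that k by (auto simp: F1_def trunc_def)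
    have "(F1 has_vector_derivative d) (at x) \<longleftrightarrow> (g1 has_vector_derivative d) (at x)" for d
      using has_vector_derivative_transform_within_open[where S="{a k<..<b k}" and x=x and f=F1 and g=g1 and f'=d]
        has_vector_derivative_transform_within_open[where S="{a k<..<b k}" and x=x and f=g1 and g=F1 and f'=d]
        k(2) eq by auto
    then have "vector_derivative F1 (at x) = vector_derivative g1 (at x)"
      by (simp add: vector_derivative_def)
    then show ?thesis
      unfolding F1 using True assms by (simp add: F2_def trunc_def deriv_on_def[of \<Delta> g1] at_within_\<Delta>)
  next
    case False
    have "((\<lambda>_. 0) has_vector_derivative 0) (at x)"
      by simp
    then have "(F1 has_vector_derivative 0) (at x)"
      by (rule has_vector_derivative_transform_within_open[where S="- \<Delta>"])
        (use False closed_\<Delta> F_outside in auto)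
    then show ?thesis
      unfolding F1 using False by (simp add: vector_derivative_at F_outside)
  qed
qed

lemma AE_endpoints: "AE x in lborel. x \<notin> endpoints"
  using finite_imp_null_set_lborel[OF finite_endpoints] by (rule AE_not_in)

lemma generator_F:
  "generator A \<gamma> \<nu> F x = of_real (A / 2) * vector_derivative (\<lambda>y. vector_derivative F (at y)) (at x)
     + of_real \<gamma> * F1 x
     + (CLINT y|\<nu>. F (x + y) - F x - of_real (y * indicator {-1..1} y) * F1 x)"
  unfolding generator_def vector_derivative_at[OF F_deriv] ..

context
  fixes A \<gamma> :: real and \<nu> :: "real measure"
  assumes triplet: "levy_triplet A \<gamma> \<nu>"
begin

text \<open>\<open>\<nu>\<close> need not be \<open>\<sigma>\<close>-finite (it may charge 0 with infinite mass), so the parametrised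
  integral is first transported to a finite measure.\<close>

lemma measurable_generator: "generator A \<gamma> \<nu> F \<in> borel_measurable borel"
proof -
  note [measurable_cong] = sets_\<nu>[OF triplet]
  let ?c = "\<lambda>y::real. y\<^sup>2 / (1 + y\<^sup>2)"
  define N where "N = density \<nu> (\<lambda>y. ennreal (?c y))"
  have [measurable_cong]: "sets N = sets borel"
    by (simp add: N_def sets_\<nu>[OF triplet])
  have c: "0 \<le> ?c y" "?c y \<le> 2 * ?c y" for y
  proof -
    show "0 \<le> ?c y"
      by (intro divide_nonneg_nonneg) auto
    then show "?c y \<le> 2 * ?c y"
      by linarith
  qed
  interpret N: finite_measure N
    using \<nu>_bound(1)[OF triplet _ c] sets_eq_imp_space_eq[OF sets_\<nu>[OF triplet]]
    by (intro finite_measureI) (auto simp: N_def)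
  let ?\<Phi> = "\<lambda>x y. F (x + y) - F x - of_real (y * indicator {-1..1} y) * F1 x"
  \<comment> \<open>At y = 0 the weight and its reciprocal are both 0 by the convention on division,
    but the integrand vanishes there as well.\<close>
  have "(CLINT y|\<nu>. ?\<Phi> x y) = (CLINT y|N. ((1 + y\<^sup>2) / y\<^sup>2) *\<^sub>R ?\<Phi> x y)" for x
  proof -
    have "(CLINT y|N. ((1 + y\<^sup>2) / y\<^sup>2) *\<^sub>R ?\<Phi> x y) = (CLINT y|\<nu>. ?c y *\<^sub>R ((1 + y\<^sup>2) / y\<^sup>2) *\<^sub>R ?\<Phi> x y)"
      unfolding N_def by (rule integral_density) auto
    also have "\<dots> = (CLINT y|\<nu>. ?\<Phi> x y)"
    proof (rule Bochner_Integration.integral_cong[OF refl])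
      fix y :: real
      have "1 + y\<^sup>2 \<noteq> 0"
        by (metis add_pos_nonneg less_irrefl zero_le_power2 zero_less_one)
      then show "?c y *\<^sub>R ((1 + y\<^sup>2) / y\<^sup>2) *\<^sub>R ?\<Phi> x y = ?\<Phi> x y"
        by (cases "y = 0") auto
    qed
    finally show ?thesis ..
  qed
  moreover have "(\<lambda>x. CLINT y|N. ((1 + y\<^sup>2) / y\<^sup>2) *\<^sub>R ?\<Phi> x y) \<in> borel_measurable borel"
    by measurable
  ultimately have [measurable]: "(\<lambda>x. CLINT y|\<nu>. ?\<Phi> x y) \<in> borel_measurable borel"
    by simp
  have [measurable]: "(\<lambda>x. vector_derivative (\<lambda>y. vector_derivative F (at y)) (at x)) \<in> borel_measurable borel"
    by (rule measurable_discrete_difference[OF measurable_F2 countable_finite[OF finite_endpoints]])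
      (auto simp: second_derivative)
  show ?thesis
    unfolding generator_F[abs_def] by measurable
qed

text \<open>The two excluded sets are null: the endpoints, where \<open>F1\<close> may have a kink,
  and the points where the average of \<open>F2\<close> under \<open>small_jumps\<close> diverges.
  Off them s F - L F agrees with \<open>resolvent_op\<close>.\<close>

lemma generator_eq_at:
  assumes x: "x \<notin> endpoints" and int: "integrable (small_jumps \<nu>) (\<lambda>v. F2 (x + v))"
  shows "generator A \<gamma> \<nu> F x = of_real (A / 2) * F2 x + of_real \<gamma> * F1 x
     + (CLINT v|small_jumps \<nu>. F2 (x + v)) + ((CLINT y|large_jumps \<nu>. F (x + y))
      - of_real (measure (large_jumps \<nu>) UNIV) * F x)"
proof -
  obtain C where C: "\<And>x. norm (F x) \<le> C"
    by (rule bounded_F) blast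
  have local: "set_integrable lborel {u..v} F2" for u v
    unfolding set_integrable_def using integrable_F2 by (intro integrable_mult_indicator) auto
  have "(CLINT y|\<nu>. F (x + y) - F x - of_real (y * indicator {-1..1} y) * F1 x) =
      (CLINT v|small_jumps \<nu>. F2 (x + v)) + ((CLINT y|large_jumps \<nu>. F (x + y))
      - of_real (measure (large_jumps \<nu>) UNIV) * F x)"
    by (rule jump_integral[OF triplet F_deriv F1_cont measurable_F2 local F1_diff C int])
  then have "generator A \<gamma> \<nu> F x = of_real (A / 2) * F2 x + of_real \<gamma> * F1 x
      + ((CLINT v|small_jumps \<nu>. F2 (x + v)) + ((CLINT y|large_jumps \<nu>. F (x + y))
      - of_real (measure (large_jumps \<nu>) UNIV) * F x))"
    using generator_F[of A \<gamma> \<nu> x] second_derivative[OF x] by argo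
  then show ?thesis
    by (rule trans) (rule add.assoc[symmetric])
qed

lemma AE_integrable_F2: "AE x in lborel. integrable (small_jumps \<nu>) (\<lambda>v. F2 (x + v))"
proof -
  interpret K: conv_measure "small_jumps \<nu>"
    by (rule conv_small_jumps[OF triplet])
  have "(\<integral>\<^sup>+x. \<integral>\<^sup>+v. ennreal (norm (F2 (x + v))) \<partial>small_jumps \<nu> \<partial>lborel) =
      (\<integral>\<^sup>+x. \<integral>\<^sup>+v. ennreal (norm (F2 x)) \<partial>small_jumps \<nu> \<partial>lborel)"
    using K.nn_integral_shift_swap[of "\<lambda>x. ennreal (norm (F2 x))" "\<lambda>_. 1"] by simp
  also have "\<dots> = (\<integral>\<^sup>+x. ennreal (norm (F2 x)) \<partial>lborel) * emeasure (small_jumps \<nu>) UNIV"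
    by (simp add: nn_integral_multc)
  also have "\<dots> < \<infinity>"
    using integrable_F2 K.emeasure_finite[of UNIV, unfolded less_top]
    by (auto simp: integrable_iff_bounded ennreal_mult_less_top)
  finally have "AE x in lborel. (\<integral>\<^sup>+v. ennreal (norm (F2 (x + v))) \<partial>small_jumps \<nu>) \<noteq> \<infinity>"
    by (intro nn_integral_noteq_infinite) auto
  then show ?thesis
    by (rule AE_mp) (auto intro!: AE_I2 integrableI_bounded simp: less_top)
qed

end

end

section \<open>From the pairing on \<Delta> to the resolvent identity on the whole line\<close>

theorem theorem5p1:
  fixes M :: "'a measure" and X :: "real \<Rightarrow> 'a \<Rightarrow> real"
    and A \<gamma> :: real and \<nu> :: "real measure"
    and \<rho> :: "real \<Rightarrow> real \<Rightarrow> real"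
    and n :: nat and a b :: "nat \<Rightarrow> real" and \<Delta> :: "real set"
    and p s :: real and f :: "real \<Rightarrow> complex"
  assumes "levy_process M X"
    and "levy_triplet A \<gamma> \<nu>"
    and "\<And>t z. 0 \<le> t \<Longrightarrow>
           char (distr M borel (X t)) z = exp (- of_real t * levy_exponent A \<gamma> \<nu> z)"
    and "continuous_density M X \<rho>"
    and "1 \<le> n"
    and "\<And>k. 1 \<le> k \<Longrightarrow> k \<le> n \<Longrightarrow> a k < b k"
    and "\<And>k. 1 \<le> k \<Longrightarrow> k < n \<Longrightarrow> b k < a (Suc k)"
    and "\<Delta> = segments n a b"
    and "1 < p"
    and "f \<in> C_Delta p n a b"
    and "0 < s"
  shows "pairing \<Delta>
           (\<lambda>x. of_real s * trunc \<Delta> f x - trunc_generator A \<gamma> \<nu> \<Delta> f x)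
           (\<lambda>x. of_real (psi \<rho> \<Delta> x s))
         = trunc \<Delta> f 0"
proof -
  note triplet = assms(2) and s = assms(11)
  interpret C: C_Delta_function n a b \<Delta> p f
    by (intro C_Delta_function.intro segment_family.intro C_Delta_function_axioms.intro assms)
  interpret L: levy_density M X \<rho> "levy_exponent A \<gamma> \<nu>"
  proof (rule levy_density.intro)
    show "prob_space M" "\<And>t. 0 \<le> t \<Longrightarrow> X t \<in> borel_measurable M"
      using assms(1) unfolding levy_process_def by blast+
  qed (rule assms(3,4), assumption?)+
  have D: "density_semigroup \<rho> \<Delta>"
    by (rule L.density_semigroup[OF C.\<Delta>_borel])
  interpret D: density_semigroup \<rho> \<Delta> by (rule D)
  interpret K: conv_measure "small_jumps \<nu>" by (rule conv_small_jumps[OF triplet])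
  interpret J: conv_measure "large_jumps \<nu>" by (rule conv_large_jumps[OF triplet])
  have RD: "resolvent_density (small_jumps \<nu>) (large_jumps \<nu>) (\<lambda>x. enn2real (D.G s x)) A \<gamma> s"
  proof
    show "fourier (\<lambda>x. enn2real (D.G s x)) z * (s + A / 2 * z\<^sup>2 - \<i> * \<gamma> * z + z\<^sup>2 * char (small_jumps \<nu>) z
      + measure (large_jumps \<nu>) UNIV - char (large_jumps \<nu>) z) = 1" for z
      using L.fourier_G[OF D s, of z] unfolding levy_exponent_jumps[OF triplet] by (simp add: algebra_simps)
  qed (use s triplet D.integrable_g[OF s] D.measurable_G[OF s] in \<open>auto simp: levy_triplet_def\<close>)
  interpret R: resolvent_density "small_jumps \<nu>" "large_jumps \<nu>" "\<lambda>x. enn2real (D.G s x)" A \<gamma> s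
    by (rule RD)
  obtain C where test: "exp_test C C.F C.F1 C.F2"
    by (rule C.exp_test_F)
  note [measurable del] = R.measF D.measurable_G D.measurable_Psi D.measurable_psi
  note [measurable] = C.measurable_generator[OF triplet] D.measurable_psi[OF s]
  let ?R = "R.resolvent_op C.F C.F1 C.F2"
  have [measurable]: "?R \<in> borel_measurable borel"
    unfolding R.resolvent_op_def[abs_def] by measurable
  let ?I = "\<lambda>x. indicator \<Delta> x *\<^sub>R ((of_real s * C.F x - generator A \<gamma> \<nu> C.F x) * of_real (psi \<rho> \<Delta> x s))"
  have "pairing \<Delta> (\<lambda>x. of_real s * trunc \<Delta> f x - trunc_generator A \<gamma> \<nu> \<Delta> f x) (\<lambda>x. of_real (psi \<rho> \<Delta> x s))
      = (CLINT x|lborel. ?I x)"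
    unfolding pairing_def set_lebesgue_integral_def trunc_generator_def C.F_def[symmetric]
    by (intro Bochner_Integration.integral_cong refl) (auto simp: indicator_def trunc_def)
  also have "\<dots> = (CLINT x|lborel. ?R x * of_real (psi \<rho> \<Delta> x s))"
  proof (rule integral_cong_AE)
    show "AE x in lborel. ?I x = ?R x * of_real (psi \<rho> \<Delta> x s)"
      using C.AE_endpoints C.AE_integrable_F2[OF triplet] D.psi_outside[OF s]
    proof eventually_elim
      case (elim x)
      have "of_real s * C.F x - generator A \<gamma> \<nu> C.F x = ?R x"
        unfolding C.generator_eq_at[OF triplet elim(1,2)] R.resolvent_op_def ..
      then show ?case
        using elim(3) by (cases "x \<in> \<Delta>") simp_all
    qed
  qed measurable
  also have "\<dots> = C.F 0"
    by (rule D.psi_identity[OF s RD test]) (rule C.F_outside)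
  finally show ?thesis
    by (simp add: C.F_def)
qed

end
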